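(* Let $N\subset M$ be an inclusion of II$_1$ factors of finite Jones index, with Jones projection $\mathsf p$, and let ${\cal O}(\mathsf p)=\{u\mathsf p u^*: u\in U_M\}$. Let $\gamma\subset{\cal O}(\mathsf p)$ be a piecewise smooth curve which is short (i.e. minimizing) for the 2-metric, that is, $L_2(\gamma)\le L_2(\beta)$ for every piecewise smooth curve $\beta\subset{\cal O}(\mathsf p)$ with the same endpoints as $\gamma$. Then $\gamma$ is a geodesic of the Riemannian (Levi-Civita) connection of ${\cal O}(\mathsf p)$.
   Context: Let $N\subset M$ be II$_1$ factors with finite index $[M:N]=\lambda^{-1}$, $\tau$ the normalized trace of $M$ (and of $N$), $\mathsf p:L^2(M,\tau)\to L^2(N,\tau)$ the Jones (orthogonal) projection, $E:M\to N$ the trace-preserving conditional expectation, and $M_1$ the von Neumann algebra of operators on $L^2(M,\tau)$ generated by $M$ and $\mathsf p$. $M_1$ is a II$_1$ factor whose normalized trace, also denoted $\tau$, restricts to the traces of $M$ and $N$. $U_M$ is the unitary group of $M$, and $\|x\|_2=\tau(x^*x)^{1/2}$. The orbit ${\cal O}(\mathsf p)\subset M_1$ is a smooth submanifold (in the operator norm structure) of the set of selfadjoint projections of $M_1$, with tangent spaces $(T{\cal O}(\mathsf p))_q=\{xq-qx: x\in M,\ x^*=-x\}$ and weak Riemannian metric $\langle x,y\rangle=\tau(y^*x)$ on each tangent space. "Smooth" refers to the norm structure, and for a curve $\gamma$ parametrized in $[0,1]$, $L_2(\gamma)=\int_0^1\|\dot\gamma(t)\|_2\,dt$. The Levi-Civita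 connection is given by $\frac{DX}{dt}=\Pi_{\gamma}(\dot X)$ for a smooth tangent field $X$ along a curve $\gamma$, where $\Pi_q$ is the $\tau$-orthogonal projection of the selfadjoint part of $M_1$ onto $(T{\cal O}(\mathsf p))_q$. Put ${\cal H}=\{z\in M: z^*=-z,\ E(z)=0\}$ and ${\cal H}_q=u{\cal H}u^*$ if $q=u\mathsf p u^*$, $u\in U_M$ (independent of the choice of $u$). The geodesics of this connection starting at $q$ are the curves $\alpha(t)=e^{tz}qe^{-tz}$ with $z\in{\cal H}_q$. *)

theory Defs
  imports "HOL-Analysis.Analysis"
begin

text \<open>
  A complex Hilbert space is a real one (which supplies norm and completeness) with a compatible
  complex structure and a complex inner product, linear in the first argument, whose real part
  is the real inner product. The zero space is excluded so that the identity operator has norm 1.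
\<close>

class complex_hilbert = real_inner + complete_space +
  fixes scaleC :: "complex \<Rightarrow> 'a \<Rightarrow> 'a"  (infixr \<open>*\<^sub>C\<close> 75)
    and cinner :: "'a \<Rightarrow> 'a \<Rightarrow> complex"
  assumes scaleC_add_right: "c *\<^sub>C (x + y) = c *\<^sub>C x + c *\<^sub>C y"
    and scaleC_add_left: "(c + d) *\<^sub>C x = c *\<^sub>C x + d *\<^sub>C x"
    and scaleC_scaleC: "c *\<^sub>C (d *\<^sub>C x) = (c * d) *\<^sub>C x"
    and scaleC_of_real: "complex_of_real r *\<^sub>C x = r *\<^sub>R x"
    and cinner_commute: "cinner x y = cnj (cinner y x)"
    and cinner_add_left: "cinner (x + y) z = cinner x z + cinner y z"
    and cinner_scaleC_left: "cinner (c *\<^sub>C x) y = c * cinner x y"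
    and Re_cinner: "Re (cinner x y) = inner x y"
    and nonzero_vector: "\<exists>x. x \<noteq> 0"

lemma norm_scaleC: "norm (c *\<^sub>C (x::'a::complex_hilbert)) = cmod c * norm x"
proof -
  have right: "cinner u (c *\<^sub>C v) = cnj c * cinner u v" for u v :: 'a
    by (metis cinner_commute cinner_scaleC_left complex_cnj_mult)
  have "cinner (c *\<^sub>C x) (c *\<^sub>C x) = complex_of_real ((cmod c)\<^sup>2) * cinner x x"
    by (simp add: cinner_scaleC_left right mult.assoc[symmetric] complex_norm_square
        del: of_real_power)
  then have "Re (cinner (c *\<^sub>C x) (c *\<^sub>C x)) = (cmod c)\<^sup>2 * Re (cinner x x)"
    by (simp del: of_real_power)
  then show ?thesis
    by (simp add: Re_cinner norm_eq_sqrt_inner real_sqrt_mult)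
qed

typedef (overloaded) 'a bop =
  "{A :: 'a::complex_hilbert \<Rightarrow>\<^sub>L 'a. \<forall>c x. A (c *\<^sub>C x) = c *\<^sub>C A x}"
  by (rule exI[of _ id_blinfun]) simp

setup_lifting type_definition_bop

lift_definition app :: "'a::complex_hilbert bop \<Rightarrow> 'a \<Rightarrow> 'a" is blinfun_apply .

lemma bounded_linear_scaleC: "bounded_linear (\<lambda>x::'a::complex_hilbert. c *\<^sub>C x)"
proof (rule bounded_linear_intro[where K = "cmod c"])
  show "c *\<^sub>C (r *\<^sub>R x) = r *\<^sub>R (c *\<^sub>C x)" for r and x :: 'a
    by (metis scaleC_of_real scaleC_scaleC mult.commute)
  show "norm (c *\<^sub>C x) \<le> norm x * cmod c" for x :: 'a
    by (simp add: norm_scaleC)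
qed (rule scaleC_add_right)

lift_definition scalar_op :: "complex \<Rightarrow> 'a::complex_hilbert bop"
  is "\<lambda>c. Blinfun (\<lambda>x. c *\<^sub>C x)"
  by (simp add: bounded_linear_Blinfun_apply[OF bounded_linear_scaleC] scaleC_scaleC mult.commute)

instantiation bop :: (complex_hilbert) real_normed_algebra_1
begin

lift_definition zero_bop :: "'a bop" is 0
  by (simp add: norm_scaleC flip: norm_eq_zero)

lift_definition one_bop :: "'a bop" is id_blinfun by simp

lift_definition plus_bop :: "'a bop \<Rightarrow> 'a bop \<Rightarrow> 'a bop" is "(+)"
  by (simp add: blinfun.add_left scaleC_add_right)

lift_definition uminus_bop :: "'a bop \<Rightarrow> 'a bop" is uminus
  by (simp add: blinfun.minus_left)
    (metis scaleC_scaleC scaleC_of_real mult.commute scaleR_minus1_left)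

lift_definition minus_bop :: "'a bop \<Rightarrow> 'a bop \<Rightarrow> 'a bop" is "(-)"
  by (simp add: blinfun.diff_left)
    (metis add_diff_cancel diff_add_cancel scaleC_add_right)

lift_definition times_bop :: "'a bop \<Rightarrow> 'a bop \<Rightarrow> 'a bop" is "(o\<^sub>L)" by simp

lift_definition scaleR_bop :: "real \<Rightarrow> 'a bop \<Rightarrow> 'a bop" is scaleR
  by (simp add: blinfun.scaleR_left) (metis scaleC_scaleC scaleC_of_real mult.commute)

lift_definition norm_bop :: "'a bop \<Rightarrow> real" is norm .

definition dist_bop :: "'a bop \<Rightarrow> 'a bop \<Rightarrow> real"
  where "dist_bop A B = norm (A - B)"

definition uniformity_bop :: "('a bop \<times> 'a bop) filter"
  where "uniformity_bop = (INF e\<in>{0<..}. principal {(A, B). dist A B < e})"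

definition open_bop :: "'a bop set \<Rightarrow> bool"
  where "open_bop U = (\<forall>A\<in>U. \<forall>\<^sub>F (A', B) in uniformity. A' = A \<longrightarrow> B \<in> U)"

definition sgn_bop :: "'a bop \<Rightarrow> 'a bop"
  where "sgn_bop A = inverse (norm A) *\<^sub>R A"

instance
proof
  fix A B C :: "'a bop" and r s :: real
  show "A + B + C = A + (B + C)" by transfer simp
  show "A + B = B + A" by transfer simp
  show "0 + A = A" by transfer simp
  show "- A + A = 0" by transfer simp
  show "A - B = A + - B" by transfer simp
  show "r *\<^sub>R (A + B) = r *\<^sub>R A + r *\<^sub>R B" by transfer (simp add: scaleR_add_right)
  show "(r + s) *\<^sub>R A = r *\<^sub>R A + s *\<^sub>R A" by transfer (simp add: scaleR_add_left)
  show "r *\<^sub>R s *\<^sub>R A = (r * s) *\<^sub>R A" by transfer simp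
  show "1 *\<^sub>R A = A" by transfer simp
  show "A * B * C = A * (B * C)" by transfer (simp add: blinfun_eqI)
  show "(A + B) * C = A * C + B * C"
    by transfer (simp add: blinfun.bilinear_simps blinfun_eqI)
  show "A * (B + C) = A * B + A * C"
    by transfer (simp add: blinfun.bilinear_simps blinfun_eqI)
  show "r *\<^sub>R A * B = r *\<^sub>R (A * B)"
    by transfer (simp add: blinfun.bilinear_simps blinfun_eqI)
  show "A * r *\<^sub>R B = r *\<^sub>R (A * B)"
    by transfer (simp add: blinfun.bilinear_simps blinfun_eqI)
  show "1 * A = A" by transfer (simp add: blinfun_eqI)
  show "A * 1 = A" by transfer (simp add: blinfun_eqI)
  obtain v :: 'a where v: "v \<noteq> 0" using nonzero_vector by blast
  show one: "norm (1 :: 'a bop) = 1"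
  proof (transfer, rule antisym)
    show "norm (id_blinfun :: 'a \<Rightarrow>\<^sub>L 'a) \<le> 1"
      by (rule norm_blinfun_bound) simp_all
    show "1 \<le> norm (id_blinfun :: 'a \<Rightarrow>\<^sub>L 'a)"
      using norm_blinfun[of "id_blinfun :: 'a \<Rightarrow>\<^sub>L 'a" v] v by simp
  qed
  show "(0 :: 'a bop) \<noteq> 1"
  proof
    assume "(0 :: 'a bop) = 1"
    moreover have "norm (0 :: 'a bop) = 0" by transfer simp
    ultimately show False using one by simp
  qed
  show "dist A B = norm (A - B)" by (rule dist_bop_def)
  show "sgn A = inverse (norm A) *\<^sub>R A" by (rule sgn_bop_def)
  show "(uniformity :: ('a bop \<times> 'a bop) filter)
      = (INF e\<in>{0<..}. principal {(A, B). dist A B < e})"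
    by (rule uniformity_bop_def)
  show "open U = (\<forall>A\<in>U. \<forall>\<^sub>F (A', B) in uniformity. A' = A \<longrightarrow> B \<in> U)" for U :: "'a bop set"
    by (rule open_bop_def)
  show "(norm A = 0) = (A = 0)" by transfer simp
  show "norm (A + B) \<le> norm A + norm B" by transfer (rule norm_triangle_ineq)
  show "norm (r *\<^sub>R A) = \<bar>r\<bar> * norm A" by transfer simp
  show "norm (A * B) \<le> norm A * norm B" by transfer (rule norm_blinfun_compose)
qed

end

text \<open>The Hilbert space adjoint; it exists for every bounded operator by Riesz representation.\<close>

definition adj :: "'a::complex_hilbert bop \<Rightarrow> 'a bop"
  where "adj A = (THE B. \<forall>x y. cinner (app A x) y = cinner x (app B y))"

text \<open>The orthogonal projection onto a closed complex subspace.\<close>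

definition proj_onto :: "'a::complex_hilbert set \<Rightarrow> 'a bop"
  where "proj_onto S = (THE P. P * P = P \<and> adj P = P \<and> range (app P) = S)"

definition commutant :: "'a::complex_hilbert bop set \<Rightarrow> 'a bop set"
  where "commutant A = {x. \<forall>y\<in>A. x * y = y * x}"

definition von_neumann_algebra :: "'a::complex_hilbert bop set \<Rightarrow> bool"
  where "von_neumann_algebra A \<longleftrightarrow> (\<forall>x\<in>A. adj x \<in> A) \<and> commutant (commutant A) = A"

definition vN_generated :: "'a::complex_hilbert bop set \<Rightarrow> 'a bop set"
  where "vN_generated S = \<Inter>{A. von_neumann_algebra A \<and> S \<subseteq> A}"

definition factor :: "'a::complex_hilbert bop set \<Rightarrow> bool"
  where "factor A \<longleftrightarrow> von_neumann_algebra A \<and> A \<inter> commutant A = range scalar_op"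

text \<open>
  Ultraweak continuity, in the form of the general ultraweakly continuous functional
  \<open>x \<mapsto> \<Sum>n. \<langle>x \<xi>\<^sub>n, \<eta>\<^sub>n\<rangle>\<close> with square-summable sequences of vectors.
\<close>

definition ultraweakly_continuous_on ::
    "'a::complex_hilbert bop set \<Rightarrow> ('a bop \<Rightarrow> complex) \<Rightarrow> bool"
  where "ultraweakly_continuous_on A t \<longleftrightarrow>
    (\<exists>\<xi> \<eta> :: nat \<Rightarrow> 'a. summable (\<lambda>n. (norm (\<xi> n))\<^sup>2) \<and> summable (\<lambda>n. (norm (\<eta> n))\<^sup>2) \<and>
       (\<forall>x\<in>A. t x = (\<Sum>n. cinner (app x (\<xi> n)) (\<eta> n))))"

text \<open>Only the values of \<open>t\<close> on \<open>A\<close> matter: a trace on \<open>A\<close> is a total function here.\<close>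

definition normalized_trace :: "'a::complex_hilbert bop set \<Rightarrow> ('a bop \<Rightarrow> complex) \<Rightarrow> bool"
  where "normalized_trace A t \<longleftrightarrow>
    (\<forall>x\<in>A. \<forall>y\<in>A. t (x + y) = t x + t y) \<and>
    (\<forall>c. \<forall>x\<in>A. t (scalar_op c * x) = c * t x) \<and>
    (\<forall>x\<in>A. Im (t (adj x * x)) = 0 \<and> 0 \<le> Re (t (adj x * x))) \<and>
    (\<forall>x\<in>A. t (adj x * x) = 0 \<longrightarrow> x = 0) \<and>
    (\<forall>x\<in>A. \<forall>y\<in>A. t (x * y) = t (y * x)) \<and>
    t 1 = 1 \<and>
    ultraweakly_continuous_on A t"

text \<open>On a finite factor the normalized trace is unique (among functions on the algebra).\<close>

definition trace_of :: "'a::complex_hilbert bop set \<Rightarrow> 'a bop \<Rightarrow> complex"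
  where "trace_of A = (SOME t. normalized_trace A t)"

definition II1_factor :: "'a::complex_hilbert bop set \<Rightarrow> bool"
  where "II1_factor A \<longleftrightarrow> factor A \<and> (\<exists>t. normalized_trace A t) \<and>
    \<not> (\<exists>B. finite B \<and> A \<subseteq> span B)"

text \<open>
  The Murray--von Neumann coupling constant \<open>dim\<^sub>A(H)\<close> of a II\<open>\<^sub>1\<close> factor \<open>A\<close> acting on \<open>H\<close>:
  if \<open>A'\<close> is finite it is the common value over \<open>\<xi> \<noteq> 0\<close> of
  \<open>tr\<^sub>A([A'\<xi>]) / tr\<^sub>A\<^sub>'([A\<xi>])\<close>, and otherwise it is infinite.
\<close>

definition cyclic_proj :: "'a::complex_hilbert bop set \<Rightarrow> 'a \<Rightarrow> 'a bop"
  where "cyclic_proj A \<xi> = proj_onto (closure ((\<lambda>x. app x \<xi>) ` A))"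

definition coupling_constant :: "'a::complex_hilbert bop set \<Rightarrow> ereal"
  where "coupling_constant A =
    (if \<exists>t. normalized_trace (commutant A) t
     then ereal (THE d. \<forall>\<xi>. \<xi> \<noteq> 0 \<longrightarrow>
       d = Re (trace_of A (cyclic_proj (commutant A) \<xi>)) /
           Re (trace_of (commutant A) (cyclic_proj A \<xi>)))
     else \<infinity>)"

text \<open>
  \<open>standard_rep M \<Omega>\<close> says that the ambient Hilbert space is \<open>L\<^sup>2(M, \<tau>)\<close>, with \<open>M\<close> acting by left
  multiplication: \<open>x \<mapsto> x\<Omega>\<close> embeds \<open>M\<close> densely with \<open>\<langle>x\<Omega>, y\<Omega>\<rangle> = \<tau>(y\<^sup>*x)\<close>, where \<open>\<Omega>\<close> is the
  vector of the unit of \<open>M\<close>.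
\<close>

definition standard_rep :: "'a::complex_hilbert bop set \<Rightarrow> 'a \<Rightarrow> bool"
  where "standard_rep M \<Omega> \<longleftrightarrow>
    normalized_trace M (\<lambda>x. cinner (app x \<Omega>) \<Omega>) \<and>
    closure ((\<lambda>x. app x \<Omega>) ` M) = UNIV"

text \<open>
  The index \<open>[M:N] = dim\<^sub>N(L\<^sup>2(M))\<close>. The algebra \<open>M\<close> enters only through the ambient Hilbert space,
  which has to be \<open>L\<^sup>2(M)\<close> in the sense above.
\<close>

definition jones_index :: "'a::complex_hilbert bop set \<Rightarrow> ereal"
  where "jones_index N = coupling_constant N"

text \<open>\<open>L\<^sup>2(N)\<close> is the closure of \<open>N\<Omega>\<close> in \<open>L\<^sup>2(M)\<close>.\<close>

definition jones_projection :: "'a::complex_hilbert bop set \<Rightarrow> 'a \<Rightarrow> 'a bop"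
  where "jones_projection N \<Omega> = proj_onto (closure ((\<lambda>x. app x \<Omega>) ` N))"

definition basic_construction :: "'a::complex_hilbert bop set \<Rightarrow> 'a bop \<Rightarrow> 'a bop set"
  where "basic_construction M p = vN_generated (insert p M)"

text \<open>
  \<open>C\<^sup>\<infinity>\<close> on the closed interval, for the norm topology, with one-sided derivatives at the
  end points; \<open>D n\<close> is the \<open>n\<close>-th derivative.
\<close>

definition smooth_on :: "real \<Rightarrow> real \<Rightarrow> (real \<Rightarrow> 'v::real_normed_vector) \<Rightarrow> bool"
  where "smooth_on a b f \<longleftrightarrow>
    (\<exists>D :: nat \<Rightarrow> real \<Rightarrow> 'v. (\<forall>t\<in>{a..b}. D 0 t = f t) \<and>
       (\<forall>n. \<forall>t\<in>{a..b}. (D n has_vector_derivative D (Suc n) t) (at t within {a..b})))"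

text \<open>
  Continuity on the unit interval is implied, since the pieces are closed and overlap in their
  end points.
\<close>

definition piecewise_smooth :: "(real \<Rightarrow> 'v::real_normed_vector) \<Rightarrow> bool"
  where "piecewise_smooth f \<longleftrightarrow>
    (\<exists>(m::nat) s. s 0 = 0 \<and> s m = 1 \<and>
       (\<forall>i<m. s i < s (Suc i) \<and> smooth_on (s i) (s (Suc i)) f))"

definition velocity :: "(real \<Rightarrow> 'v::real_normed_vector) \<Rightarrow> real \<Rightarrow> 'v"
  where "velocity f t = vector_derivative f (at t within {0..1})"

definition unitaries :: "'a::complex_hilbert bop set \<Rightarrow> 'a bop set"
  where "unitaries M = {u\<in>M. adj u * u = 1 \<and> u * adj u = 1}"

definition orbit :: "'a::complex_hilbert bop set \<Rightarrow> 'a bop \<Rightarrow> 'a bop set"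
  where "orbit M p = {u * p * adj u | u. u \<in> unitaries M}"

definition tangent_space :: "'a::complex_hilbert bop set \<Rightarrow> 'a bop \<Rightarrow> 'a bop set"
  where "tangent_space M q = {x * q - q * x | x. x \<in> M \<and> adj x = - x}"

definition norm2 :: "('a::complex_hilbert bop \<Rightarrow> complex) \<Rightarrow> 'a bop \<Rightarrow> real"
  where "norm2 \<tau> x = sqrt (Re (\<tau> (adj x * x)))"

definition length2 :: "('a::complex_hilbert bop \<Rightarrow> complex) \<Rightarrow> (real \<Rightarrow> 'a bop) \<Rightarrow> real"
  where "length2 \<tau> \<gamma> = integral {0..1} (\<lambda>t. norm2 \<tau> (velocity \<gamma> t))"

definition tangent_proj ::
    "('a::complex_hilbert bop \<Rightarrow> complex) \<Rightarrow> 'a bop set \<Rightarrow> 'a bop \<Rightarrow> 'a bop \<Rightarrow> 'a bop"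
  where "tangent_proj \<tau> M q x =
    (THE y. y \<in> tangent_space M q \<and> (\<forall>w\<in>tangent_space M q. \<tau> (adj w * (x - y)) = 0))"

text \<open>
  The covariant derivative \<open>DX/dt = \<Pi>\<^sub>\<gamma>(dX/dt)\<close> of the Levi-Civita connection, for a tangent
  field \<open>X\<close> along a curve \<open>\<gamma>\<close> parametrized on the unit interval.
\<close>

definition covariant_derivative ::
    "('a::complex_hilbert bop \<Rightarrow> complex) \<Rightarrow> 'a bop set \<Rightarrow> (real \<Rightarrow> 'a bop) \<Rightarrow>
      (real \<Rightarrow> 'a bop) \<Rightarrow> real \<Rightarrow> 'a bop"
  where "covariant_derivative \<tau> M \<gamma> X t = tangent_proj \<tau> M (\<gamma> t) (velocity X t)"

definition geodesic ::
    "('a::complex_hilbert bop \<Rightarrow> complex) \<Rightarrow> 'a bop set \<Rightarrow> 'a bop \<Rightarrow> (real \<Rightarrow> 'a bop) \<Rightarrow> bool"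
  where "geodesic \<tau> M p \<alpha> \<longleftrightarrow>
    smooth_on 0 1 \<alpha> \<and> \<alpha> ` {0..1} \<subseteq> orbit M p \<and>
    (\<forall>t\<in>{0..1}. covariant_derivative \<tau> M \<alpha> (velocity \<alpha>) t = 0)"

definition piecewise_smooth_in :: "'v::real_normed_vector set \<Rightarrow> (real \<Rightarrow> 'v) \<Rightarrow> bool"
  where "piecewise_smooth_in S \<gamma> \<longleftrightarrow> piecewise_smooth \<gamma> \<and> \<gamma> ` {0..1} \<subseteq> S"

definition short_curve ::
    "('a::complex_hilbert bop \<Rightarrow> complex) \<Rightarrow> 'a bop set \<Rightarrow> (real \<Rightarrow> 'a bop) \<Rightarrow> bool"
  where "short_curve \<tau> S \<gamma> \<longleftrightarrow>
    piecewise_smooth_in S \<gamma> \<and>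
    (\<forall>\<beta>. piecewise_smooth_in S \<beta> \<and> \<beta> 0 = \<gamma> 0 \<and> \<beta> 1 = \<gamma> 1 \<longrightarrow> length2 \<tau> \<gamma> \<le> length2 \<tau> \<beta>)"

text \<open>Exceptional parameters are allowed because a piecewise smooth curve may have corners.\<close>

definition constant_speed ::
    "('a::complex_hilbert bop \<Rightarrow> complex) \<Rightarrow> (real \<Rightarrow> 'a bop) \<Rightarrow> bool"
  where "constant_speed \<tau> \<gamma> \<longleftrightarrow>
    (\<exists>c F. finite F \<and> (\<forall>t\<in>{0..1} - F. norm2 \<tau> (velocity \<gamma> t) = c))"

text \<open>
  Length does not see the parametrization, so a curve is a geodesic as an unparametrized curve if
  it runs monotonically (possibly pausing) through a geodesic.
\<close>

definition geodesic_up_to_reparam ::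
    "('a::complex_hilbert bop \<Rightarrow> complex) \<Rightarrow> 'a bop set \<Rightarrow> 'a bop \<Rightarrow> (real \<Rightarrow> 'a bop) \<Rightarrow> bool"
  where "geodesic_up_to_reparam \<tau> M p \<gamma> \<longleftrightarrow>
    (\<exists>\<alpha> \<phi>. geodesic \<tau> M p \<alpha> \<and> mono_on {0..1} \<phi> \<and> \<phi> ` {0..1} = {0..1::real} \<and>
       (\<forall>t\<in>{0..1}. \<gamma> t = \<alpha> (\<phi> t)))"

end

theory Submission
  imports Defs
begin

text \<open>
  The unitary group of \<open>M\<close> acts isometrically on the orbit, so a shortest curve \<open>\<gamma>\<close> has a conserved
  momentum. Indeed the curves \<open>e\<^sup>f\<^sup>x \<gamma> e\<^sup>-\<^sup>f\<^sup>x\<close>, with \<open>x \<in> M\<close> antihermitian and \<open>f\<close> a piecewise smooth function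
  vanishing at the end points, have speed \<open>\<parallel>\<gamma>' + f' [x, \<gamma>]\<parallel>\<^sub>2\<close>, so minimality forces
  \<open>\<langle>\<gamma>', [x, \<gamma>]\<rangle>\<close> to be a multiple of \<open>\<parallel>\<gamma>'\<parallel>\<^sub>2\<close> that does not depend on the time, even across corners and
  pauses. Write \<open>\<gamma>' = [z, \<gamma>]\<close> with \<open>z \<in> M\<close> antihermitian and \<open>\<gamma> z \<gamma> = 0\<close>. Since \<open>\<tau>(q y) = \<lambda> \<tau>(y)\<close> for \<open>q\<close> in
  the orbit and \<open>y \<in> M\<close>, the momentum is \<open>-2\<lambda> \<tau>(z x)\<close>. Hence \<open>z\<close> is a fixed element times the speed, and
  integrating \<open>\<gamma>' = [z, \<gamma>]\<close> exhibits \<open>\<gamma>\<close> as a reparametrized geodesic \<open>e\<^sup>t\<^sup>z q e\<^sup>-\<^sup>t\<^sup>z\<close>.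
\<close>

section \<open>Hilbert spaces and adjoints\<close>

text \<open>The metric is weak: tangent spaces are in general not complete for the 2-norm, so the
  argument rests on the symmetry of the orbit instead of on local Riemannian theory. Two facts that
  the overview only names carry the operator algebra. That every derivative of a curve in the orbit
  comes from an element of \<open>M\<close> rests on the Pimsner-Popa bound, which makes a local
  section of the orbit differentiable. The identity for \<tau>(q y) needs the compression p y p =
  E(y) p, hence a conditional expectation with values in \<open>N\<close> itself and not merely in
  the closure of its orbit of \<Omega>; it also needs uniqueness of traces on factors, because
  \<open>trace_of\<close> is an arbitrary choice among normalized traces. Operator inequalities are
  obtained by iterating Cauchy-Schwarz, in place of a functional calculus. The generators at two
  times are finally compared by testing the momentum with the difference of the normalized
  generators, where faithfulness of the trace applies.\<close>

instance complex_hilbert \<subseteq> banach ..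

section \<open>Calculus of the complex inner product\<close>

lemma scaleC_minus_one: "(-1) *\<^sub>C (x::'a::complex_hilbert) = - x"
  using scaleC_of_real[of "-1" x] by simp

lemma scaleC_one [simp]: "1 *\<^sub>C (x::'a::complex_hilbert) = x"
  using scaleC_of_real[of 1 x] by simp

lemma scaleC_diff_right: "c *\<^sub>C (x - y) = c *\<^sub>C x - c *\<^sub>C (y::'a::complex_hilbert)"
  by (metis add_diff_cancel diff_add_cancel scaleC_add_right)

lemma scaleC_scaleR: "c *\<^sub>C (r *\<^sub>R x) = r *\<^sub>R (c *\<^sub>C (x::'a::complex_hilbert))"
  by (metis scaleC_of_real scaleC_scaleC mult.commute)

lemma cinner_add_right: "cinner (x::'a::complex_hilbert) (y + z) = cinner x y + cinner x z"
  by (metis cinner_add_left cinner_commute complex_cnj_add)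

lemma cinner_scaleC_right: "cinner (x::'a::complex_hilbert) (c *\<^sub>C y) = cnj c * cinner x y"
  by (metis cinner_commute cinner_scaleC_left complex_cnj_mult)

lemma cinner_scaleR_left: "cinner (r *\<^sub>R x) (y::'a::complex_hilbert) = of_real r * cinner x y"
  by (metis cinner_scaleC_left scaleC_of_real)

lemma cinner_scaleR_right: "cinner x (r *\<^sub>R (y::'a::complex_hilbert)) = of_real r * cinner x y"
  by (metis cinner_scaleC_right complex_cnj_complex_of_real scaleC_of_real)

lemma cinner_minus_left: "cinner (- x) (y::'a::complex_hilbert) = - cinner x y"
  using cinner_scaleR_left[of "-1" x y] by simp

lemma cinner_minus_right: "cinner x (- y::'a::complex_hilbert) = - cinner x y"
  using cinner_scaleR_right[of x "-1" y] by simp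

lemma cinner_diff_left: "cinner (x - y) (z::'a::complex_hilbert) = cinner x z - cinner y z"
  using cinner_add_left[of x "-y" z] by (simp add: cinner_minus_left)

lemma cinner_diff_right: "cinner x (y - z::'a::complex_hilbert) = cinner x y - cinner x z"
  using cinner_add_right[of x y "-z"] by (simp add: cinner_minus_right)

lemma cinner_zero_left [simp]: "cinner 0 (y::'a::complex_hilbert) = 0"
  using cinner_diff_left[of 0 0 y] by simp

lemma cinner_zero_right [simp]: "cinner (y::'a::complex_hilbert) 0 = 0"
  using cinner_diff_right[of y 0 0] by simp

lemma cinner_self: "cinner x (x::'a::complex_hilbert) = of_real ((norm x)\<^sup>2)"
proof (rule complex_eqI)
  show "Re (cinner x x) = Re (of_real ((norm x)\<^sup>2))"
    by (metis Re_cinner Re_complex_of_real power2_norm_eq_inner)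
  have "Im (cinner x x) = Im (cnj (cinner x x))" using cinner_commute[of x x] by simp
  then show "Im (cinner x x) = Im (of_real ((norm x)\<^sup>2))" by simp
qed

lemma Im_cinner: "Im (cinner x (y::'a::complex_hilbert)) = inner x (\<i> *\<^sub>C y)"
  by (simp add: cinner_scaleC_right flip: Re_cinner)

text \<open>Multiplying \<open>x\<close> by the conjugate phase of \<open>cinner x y\<close> makes
  the inner product real, so the real Cauchy-Schwarz inequality applies.\<close>

lemma norm_cinner: "cmod (cinner x (y::'a::complex_hilbert)) \<le> norm x * norm y"
proof (cases "cinner x y = 0")
  case False
  define z where "z = cinner x y"
  define c where "c = cnj (sgn z)"
  have c: "cmod c = 1" using False by (simp add: c_def z_def norm_sgn)
  have "c * z = of_real (inverse (cmod z)) * (z * cnj z)"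
    by (simp add: c_def sgn_div_norm scaleR_conv_of_real mult_ac)
  also have "\<dots> = of_real (inverse (cmod z) * (cmod z)\<^sup>2)"
    by (simp add: complex_norm_square del: of_real_power)
  also have "inverse (cmod z) * (cmod z)\<^sup>2 = cmod z"
    using False by (simp add: z_def power2_eq_square)
  finally have "cinner (c *\<^sub>C x) y = of_real (cmod (cinner x y))"
    by (simp add: cinner_scaleC_left z_def)
  then have "cmod (cinner x y) = inner (c *\<^sub>C x) y"
    by (metis Re_cinner Re_complex_of_real)
  also have "\<dots> \<le> norm (c *\<^sub>C x) * norm y" by (rule norm_cauchy_schwarz)
  finally show ?thesis by (simp add: norm_scaleC c)
qed simp

lemma bounded_bilinear_cinner: "bounded_bilinear (cinner :: 'a::complex_hilbert \<Rightarrow> _)"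
proof (rule bounded_bilinear.intro)
  show "\<exists>K. \<forall>a b. cmod (cinner a (b::'a)) \<le> norm a * norm b * K"
    by (rule exI[of _ 1]) (simp add: norm_cinner)
qed (simp_all add: cinner_add_left cinner_add_right cinner_scaleR_left cinner_scaleR_right
      scaleR_conv_of_real)

lemmas tendsto_cinner = bounded_bilinear.tendsto[OF bounded_bilinear_cinner]

lemma cinner_ext:
  assumes "\<And>z. cinner x z = cinner y (z::'a::complex_hilbert)" shows "x = y"
proof -
  have "cinner (x - y) (x - y) = 0" using assms by (simp add: cinner_diff_left)
  then show ?thesis by (simp add: cinner_self)
qed

section \<open>Projection theorem and Riesz representation\<close>

lemma min_norm_point:
  fixes K :: "'a::{real_inner,complete_space} set"
  assumes "closed K" "convex K" "K \<noteq> {}"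
  shows "\<exists>!k. k \<in> K \<and> (\<forall>y\<in>K. norm k \<le> norm y)"
proof -
  define d where "d = Inf (norm ` K)"
  have bdd: "bdd_below (norm ` K)" by (rule bdd_belowI[of _ 0]) auto
  have d: "d \<le> norm y" if "y \<in> K" for y
    unfolding d_def by (rule cInf_lower) (use that bdd in auto)
  have d0: "0 \<le> d" unfolding d_def by (rule cInf_greatest) (use assms in auto)
  \<comment> \<open>Parallelogram law, with the midpoint of norm at least \<open>d\<close>. It makes
    minimizing sequences Cauchy and the minimizer unique; the uniqueness is what
    \<open>trace_unique\<close> later exploits.\<close>
  have par: "(dist x y)\<^sup>2 \<le> 2 * (norm x)\<^sup>2 + 2 * (norm y)\<^sup>2 - 4 * d\<^sup>2" if "x \<in> K" "y \<in> K" for x y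
  proof -
    have "(1/2) *\<^sub>R x + (1/2) *\<^sub>R y \<in> K"
      using assms(2) that by (rule convexD) auto
    then have "d \<le> norm ((1/2) *\<^sub>R (x + y))" using d by (simp add: scaleR_add_right)
    then have "2 * d \<le> norm (x + y)" by simp
    then have "(2 * d)\<^sup>2 \<le> (norm (x + y))\<^sup>2" by (rule power_mono) (use d0 in simp)
    moreover have "(norm (x + y))\<^sup>2 + (norm (x - y))\<^sup>2 = 2 * (norm x)\<^sup>2 + 2 * (norm y)\<^sup>2"
      by (simp add: power2_norm_eq_inner inner_add_left inner_add_right inner_diff_left
          inner_diff_right inner_commute)
    ultimately show ?thesis by (simp add: dist_norm power_mult_distrib)
  qed
  have "\<exists>x\<in>K. norm x < d + inverse (real (Suc n))" for n
  proof -
    have "Inf (norm ` K) < d + inverse (real (Suc n))" unfolding d_def by simp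
    then show ?thesis using cInf_less_iff[OF _ bdd] assms(3) by auto
  qed
  then obtain f where f: "\<And>n. f n \<in> K" "\<And>n. norm (f n) < d + inverse (real (Suc n))"
    by metis
  have lim_norm: "(\<lambda>n. norm (f n)) \<longlonglongrightarrow> d"
  proof (rule tendsto_sandwich[OF _ _ tendsto_const])
    show "\<forall>\<^sub>F n in sequentially. d \<le> norm (f n)" using d f(1) by simp
    show "\<forall>\<^sub>F n in sequentially. norm (f n) \<le> d + inverse (real (Suc n))"
      using f(2) by (simp add: less_imp_le)
    show "(\<lambda>n. d + inverse (real (Suc n))) \<longlonglongrightarrow> d"
      using tendsto_add[OF tendsto_const LIMSEQ_inverse_real_of_nat, of d] by simp
  qed
  have "Cauchy f"
  proof (rule metric_CauchyI)
    fix e :: real assume e: "0 < e"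
    have "(\<lambda>n. (norm (f n))\<^sup>2) \<longlonglongrightarrow> d\<^sup>2" by (intro tendsto_intros lim_norm)
    from order_tendstoD(2)[OF this, of "d\<^sup>2 + e\<^sup>2/4"] e
    obtain N where N: "\<And>n. n \<ge> N \<Longrightarrow> (norm (f n))\<^sup>2 < d\<^sup>2 + e\<^sup>2/4"
      by (auto simp: eventually_sequentially)
    have "dist (f m) (f n) < e" if "m \<ge> N" "n \<ge> N" for m n
    proof -
      have "(dist (f m) (f n))\<^sup>2 < e\<^sup>2"
        using par[OF f(1) f(1), of m n] N[OF that(1)] N[OF that(2)] by linarith
      then show ?thesis using e by (simp add: power2_less_imp_less)
    qed
    then show "\<exists>M. \<forall>m\<ge>M. \<forall>n\<ge>M. dist (f m) (f n) < e" by blast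
  qed
  then obtain k where k: "f \<longlonglongrightarrow> k" using Cauchy_convergent_iff convergent_def by blast
  have kK: "k \<in> K" using closed_sequentially[OF assms(1)] f(1) k by blast
  have "norm k = d" using LIMSEQ_unique[OF tendsto_norm[OF k] lim_norm] .
  with kK d have 1: "k \<in> K \<and> (\<forall>y\<in>K. norm k \<le> norm y)" by auto
  moreover have "k' = k" if "k' \<in> K \<and> (\<forall>y\<in>K. norm k' \<le> norm y)" for k'
  proof -
    have "norm k' = d" using that kK d[of k'] \<open>norm k = d\<close> by force
    then have "(dist k' k)\<^sup>2 \<le> 0" using par[of k' k] that kK \<open>norm k = d\<close> by simp
    then show ?thesis by simp
  qed
  ultimately show ?thesis by blast
qed

lemma orthogonal_decomposition:
  fixes S :: "'a::{real_inner,complete_space} set"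
  assumes "closed S" "subspace S"
  shows "\<exists>y\<in>S. \<forall>s\<in>S. inner (x - y) s = 0"
proof -
  define K where "K = (\<lambda>s. x + s) ` S"
  have "closed K" unfolding K_def using assms(1) by (rule closed_translation)
  moreover have "convex K" unfolding K_def using assms(2) by (intro convex_translation subspace_imp_convex)
  moreover have "K \<noteq> {}" using subspace_0[OF assms(2)] by (auto simp: K_def)
  ultimately obtain k where k: "k \<in> K" "\<And>y. y \<in> K \<Longrightarrow> norm k \<le> norm y"
    using ex1_implies_ex[OF min_norm_point[of K]] by auto
  then obtain s0 where s0: "s0 \<in> S" "k = x + s0" by (auto simp: K_def)
  have "inner k s = 0" if s: "s \<in> S" for s
  proof (rule ccontr)
    assume n: "inner k s \<noteq> 0"
    \<comment> \<open>The minimizer of the quadratic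
      \<open>t \<mapsto> (norm (k + t *\<^sub>R s))\<^sup>2\<close>.\<close>
    define t where "t = - inner k s / inner s s"
    have ss: "inner s s > 0" using n by auto
    have "k + t *\<^sub>R s \<in> K" using s0 s assms(2) by (auto simp: K_def add.assoc intro!: imageI subspace_add subspace_scale)
    then have "(norm k)\<^sup>2 \<le> (norm (k + t *\<^sub>R s))\<^sup>2" using k(2) by (intro power_mono) auto
    then have "0 \<le> 2 * t * inner k s + t * t * inner s s"
      by (simp add: power2_norm_eq_inner inner_add_left inner_add_right inner_commute algebra_simps)
    also have "\<dots> = - (inner k s)\<^sup>2 / inner s s"
      using ss by (simp add: t_def field_simps power2_eq_square)
    also have "\<dots> < 0" using n ss by (simp add: divide_neg_pos)
    finally show False by simp
  qed
  moreover have "- s0 \<in> S" using s0 assms(2) by (simp add: subspace_neg)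
  ultimately show ?thesis using s0(2) by (intro bexI[of _ "- s0"]) auto
qed

lemma riesz_representation:
  fixes f :: "'a::{real_inner,complete_space} \<Rightarrow> real"
  assumes "bounded_linear f"
  shows "\<exists>v. \<forall>x. f x = inner x v"
proof (cases "\<forall>x. f x = 0")
  case True
  then show ?thesis by (intro exI[of _ 0]) auto
next
  case False
  then obtain u where u: "f u \<noteq> 0" by blast
  interpret f: bounded_linear f by fact
  define S where "S = {x. f x = 0}"
  have "closed S" unfolding S_def
    by (intro closed_Collect_eq linear_continuous_on assms continuous_on_const)
  moreover have "subspace S" by (simp add: S_def subspace_def f.add f.scaleR)
  ultimately obtain y where y: "y \<in> S" "\<And>s. s \<in> S \<Longrightarrow> inner (u - y) s = 0"
    using orthogonal_decomposition by blast
  define w where "w = u - y"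
  have fw: "f w = f u" using y by (simp add: w_def S_def f.diff)
  have ww: "inner w w \<noteq> 0" using fw u f.zero by auto
  have "f x = inner x ((f w / inner w w) *\<^sub>R w)" for x
  proof -
    have "x - (f x / f w) *\<^sub>R w \<in> S" using fw u by (simp add: S_def f.diff f.scaleR)
    then have "inner w (x - (f x / f w) *\<^sub>R w) = 0" using y by (simp add: w_def)
    then show ?thesis using ww fw u by (simp add: inner_diff_right field_simps inner_commute)
  qed
  then show ?thesis by blast
qed

section \<open>Operators, strong limits and completeness\<close>

lemma app_times [simp]: "app (A * B) x = app A (app B x)" by transfer simp
lemma app_one [simp]: "app 1 x = x" by transfer simp
lemma app_zero [simp]: "app 0 x = 0" by transfer simp
lemma app_plus: "app (A + B) x = app A x + app B x" by transfer (simp add: blinfun.add_left)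
lemma app_minus: "app (A - B) x = app A x - app B x" by transfer (simp add: blinfun.diff_left)
lemma app_uminus: "app (- A) x = - app A x" by transfer (simp add: blinfun.minus_left)
lemma app_scaleR: "app (r *\<^sub>R A) x = r *\<^sub>R app A x" by transfer (simp add: blinfun.scaleR_left)
lemma app_scalar_op [simp]: "app (scalar_op c) x = c *\<^sub>C x"
  by transfer (simp add: bounded_linear_Blinfun_apply[OF bounded_linear_scaleC])
lemma app_scaleC: "app A (c *\<^sub>C x) = c *\<^sub>C app A x" by transfer simp
lemma app_add: "app A (x + y) = app A x + app A y" by transfer (simp add: blinfun.add_right)
lemma app_diff: "app A (x - y) = app A x - app A y" by transfer (simp add: blinfun.diff_right)
lemma app_0_right [simp]: "app A 0 = 0" by transfer simp
lemma app_scaleR_right: "app A (r *\<^sub>R x) = r *\<^sub>R app A x" by transfer (simp add: blinfun.scaleR_right)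
lemma norm_app: "norm (app A x) \<le> norm A * norm x" by transfer (rule norm_blinfun)
lemma bop_eqI: "(\<And>x. app A x = app B x) \<Longrightarrow> A = B" by transfer (rule blinfun_eqI)

lemma bounded_bilinear_app: "bounded_bilinear (app :: 'a::complex_hilbert bop \<Rightarrow> _)"
proof (rule bounded_bilinear.intro)
  show "\<exists>K. \<forall>A (x::'a). norm (app A x) \<le> norm A * norm x * K"
    by (rule exI[of _ 1]) (simp add: norm_app)
qed (simp_all add: app_plus app_add app_scaleR app_scaleR_right)

lemmas tendsto_app = bounded_bilinear.tendsto[OF bounded_bilinear_app]

lemma continuous_on_app [continuous_intros]: "continuous_on S (app A)"
  by (intro linear_continuous_on bounded_bilinear.bounded_linear_right[OF bounded_bilinear_app])

lemma norm_bop_bound: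
  assumes "0 \<le> C" "\<And>x. norm (app A x) \<le> C * norm x" shows "norm A \<le> C"
  using assms by transfer (rule norm_blinfun_bound)

lemma bop_exists:
  fixes f :: "'a::complex_hilbert \<Rightarrow> 'a"
  assumes "bounded_linear f" "\<And>c x. f (c *\<^sub>C x) = c *\<^sub>C f x"
  shows "\<exists>A. app A = f"
  using assms
proof (intro exI[of _ "Abs_bop (Blinfun f)"])
  have "app (Abs_bop (Blinfun f)) = blinfun_apply (Blinfun f)"
    unfolding app.rep_eq by (subst Abs_bop_inverse) (auto simp: bounded_linear_Blinfun_apply assms)
  then show "app (Abs_bop (Blinfun f)) = f" by (simp add: bounded_linear_Blinfun_apply assms)
qed

lemma scaleC_tendsto: "f \<longlonglongrightarrow> x \<Longrightarrow> (\<lambda>n. c *\<^sub>C f n) \<longlonglongrightarrow> c *\<^sub>C (x::'a::complex_hilbert)"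
  by (rule bounded_linear.tendsto[OF bounded_linear_scaleC])

text \<open>Serves twice: for completeness of the operator norm, and for strong limits inside a von
  Neumann algebra in \<open>L2_limit\<close>.\<close>

lemma strong_limit:
  fixes A :: "nat \<Rightarrow> 'a::complex_hilbert bop"
  assumes "\<And>n. norm (A n) \<le> C" and "\<And>x. convergent (\<lambda>n. app (A n) x)"
  shows "\<exists>B. norm B \<le> C \<and> (\<forall>x. (\<lambda>n. app (A n) x) \<longlonglongrightarrow> app B x)"
proof -
  define f where "f x = lim (\<lambda>n. app (A n) x)" for x
  have f: "(\<lambda>n. app (A n) x) \<longlonglongrightarrow> f x" for x
    using assms(2) by (simp add: f_def convergent_LIMSEQ_iff)
  have C: "0 \<le> C" using assms(1)[of 0] norm_ge_zero order_trans by blast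
  have bd: "norm (f x) \<le> C * norm x" for x
  proof (rule LIMSEQ_le_const2[OF tendsto_norm[OF f]])
    have "norm (app (A n) x) \<le> C * norm x" for n
      using norm_app[of "A n" x] assms(1)[of n] by (meson mult_right_mono norm_ge_zero order_trans)
    then show "\<exists>N. \<forall>n\<ge>N. norm (app (A n) x) \<le> C * norm x" by blast
  qed
  have "bounded_linear f"
  proof (rule bounded_linear_intro)
    show "f (x + y) = f x + f y" for x y
      using LIMSEQ_unique[OF f[of "x+y"]] tendsto_add[OF f f] by (simp add: app_add)
    show "f (r *\<^sub>R x) = r *\<^sub>R f x" for r x
      using LIMSEQ_unique[OF f[of "r *\<^sub>R x"]] tendsto_scaleR[OF tendsto_const f] by (simp add: app_scaleR_right)
    show "norm (f x) \<le> norm x * C" for x using bd by (simp add: mult.commute)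
  qed
  moreover have "f (c *\<^sub>C x) = c *\<^sub>C f x" for c x
    using LIMSEQ_unique[OF f[of "c *\<^sub>C x"]] scaleC_tendsto[OF f] by (simp add: app_scaleC)
  ultimately obtain B where "app B = f" using bop_exists by blast
  then show ?thesis using f bd C norm_bop_bound by metis
qed

text \<open>Completeness makes \<open>exp\<close> available on operators. A Cauchy sequence has a
  strong limit, and the Cauchy estimate, read at each vector, passes to that limit.\<close>

instance bop :: (complex_hilbert) banach
proof
  fix X :: "nat \<Rightarrow> 'a bop" assume X: "Cauchy X"
  have "Cauchy (\<lambda>n. app (X n) x)" for x
    by (intro bounded_linear.Cauchy[OF bounded_bilinear.bounded_linear_left[OF bounded_bilinear_app] X])
  then have conv: "convergent (\<lambda>n. app (X n) x)" for x by (simp add: Cauchy_convergent_iff)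
  obtain C where C: "\<And>n. norm (X n) \<le> C"
    using X Cauchy_Bseq Bseq_def by metis
  obtain B where B: "\<And>x. (\<lambda>n. app (X n) x) \<longlonglongrightarrow> app B x"
    using strong_limit[OF C conv] by blast
  have "X \<longlonglongrightarrow> B"
  proof (rule metric_LIMSEQ_I)
    fix e :: real assume e: "0 < e"
    then obtain N where N: "\<And>m n. m \<ge> N \<Longrightarrow> n \<ge> N \<Longrightarrow> norm (X m - X n) < e/2"
      using CauchyD[OF X, of "e/2"] by auto
    have "norm (X n - B) \<le> e/2" if n: "n \<ge> N" for n
    proof (rule norm_bop_bound)
      fix x
      have 1: "(\<lambda>m. norm (app (X n) x - app (X m) x)) \<longlonglongrightarrow> norm (app (X n) x - app B x)"
        by (intro tendsto_intros B)
      have "norm (app (X n) x - app (X m) x) \<le> e/2 * norm x" if "m \<ge> N" for m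
      proof -
        have "norm (app (X n - X m) x) \<le> norm (X n - X m) * norm x" by (rule norm_app)
        also have "\<dots> \<le> e/2 * norm x" using N[OF n that] by (intro mult_right_mono) auto
        finally show ?thesis by (simp add: app_minus)
      qed
      then have "norm (app (X n) x - app B x) \<le> e/2 * norm x"
        by (intro LIMSEQ_le_const2[OF 1]) blast
      then show "norm (app (X n - B) x) \<le> e/2 * norm x" by (simp add: app_minus)
    qed (use e in simp)
    then show "\<exists>N. \<forall>n\<ge>N. dist (X n) B < e"
      using e by (intro exI[of _ N]) (auto simp: dist_norm intro: le_less_trans[of _ "e/2"])
  qed
  then show "convergent X" by (auto simp: convergent_def)
qed

section \<open>Adjoints\<close>

lemma adjoint_exists:
  fixes A :: "'a::complex_hilbert bop"
  shows "\<exists>B. \<forall>x y. cinner (app A x) y = cinner x (app B y)"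
proof -
  have "\<exists>v. \<forall>x. inner (app A x) y = inner x v" for y
    by (rule riesz_representation)
      (intro bounded_linear_compose[OF bounded_linear_inner_left]
        bounded_bilinear.bounded_linear_right[OF bounded_bilinear_app])
  then obtain f where f: "\<And>x y. inner (app A x) y = inner x (f y)" by metis
  \<comment> \<open>Riesz gives the adjoint identity for the real inner product only. Complex
    linearity of \<open>A\<close> carries it to the imaginary part, which is the real part after
    multiplication by \<open>- \<i>\<close>.\<close>
  have cf: "cinner (app A x) y = cinner x (f y)" for x y
  proof (rule complex_eqI)
    show "Re (cinner (app A x) y) = Re (cinner x (f y))" by (simp add: Re_cinner f)
    have "Im (cinner u v) = Re (cinner ((- \<i>) *\<^sub>C u) v)" for u v :: 'a by (simp add: cinner_scaleC_left)
    then show "Im (cinner (app A x) y) = Im (cinner x (f y))" by (simp add: Re_cinner f flip: app_scaleC)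
  qed
  have "bounded_linear f"
  proof (rule bounded_linear_intro)
    show "f (x + y) = f x + f y" for x y
      by (rule cinner_ext) (metis cf cinner_add_right cinner_commute)
    show "f (r *\<^sub>R x) = r *\<^sub>R f x" for r x
      by (rule cinner_ext) (metis cf cinner_scaleR_right cinner_commute)
    fix x
    have "(norm (f x))\<^sup>2 = inner (app A (f x)) x" by (simp add: f power2_norm_eq_inner)
    also have "\<dots> \<le> norm (app A (f x)) * norm x" by (rule norm_cauchy_schwarz)
    also have "\<dots> \<le> norm A * norm (f x) * norm x" by (intro mult_right_mono norm_app) simp
    finally have "norm (f x) * norm (f x) \<le> norm (f x) * (norm x * norm A)"
      by (simp add: power2_eq_square mult_ac)
    then show "norm (f x) \<le> norm x * norm A"
      by (cases "norm (f x) = 0") (auto simp: mult_le_cancel_left)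
  qed
  moreover have "f (c *\<^sub>C x) = c *\<^sub>C f x" for c x
    by (rule cinner_ext) (metis cf cinner_scaleC_right cinner_commute)
  ultimately obtain B where "app B = f" using bop_exists by blast
  with cf show ?thesis by auto
qed

lemma adjoint_unique:
  fixes A :: "'a::complex_hilbert bop"
  assumes "\<And>x y. cinner (app A x) y = cinner x (app B y)" "\<And>x y. cinner (app A x) y = cinner x (app C y)"
  shows "B = C"
  by (intro bop_eqI cinner_ext) (metis assms cinner_commute)

lemma cinner_app: "cinner (app A x) y = cinner x (app (adj A) y)"
proof -
  have "\<exists>!B. \<forall>x y. cinner (app A x) y = cinner x (app B y)"
    using adjoint_exists[of A] adjoint_unique[of A] by blast
  from theI'[OF this] show ?thesis unfolding adj_def by blast
qed

lemma adj_eqI: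
  assumes "\<And>x y. cinner (app A x) y = cinner x (app B y)" shows "adj A = B"
  using adjoint_unique[of A "adj A" B] cinner_app assms by blast

lemma cinner_app_adj: "cinner (app (adj A) x) y = cinner x (app A y)"
  by (metis cinner_app cinner_commute)

lemma adj_adj [simp]: "adj (adj A) = A" by (rule adj_eqI) (rule cinner_app_adj)
lemma adj_times [simp]: "adj (A * B) = adj B * adj A" by (rule adj_eqI) (simp add: cinner_app)
lemma adj_one [simp]: "adj 1 = 1" by (rule adj_eqI) simp
lemma adj_zero [simp]: "adj 0 = 0" by (rule adj_eqI) simp
lemma adj_plus [simp]: "adj (A + B) = adj A + adj B"
  by (rule adj_eqI) (simp add: app_plus cinner_add_left cinner_add_right cinner_app)
lemma adj_minus [simp]: "adj (A - B) = adj A - adj B"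
  by (rule adj_eqI) (simp add: app_minus cinner_diff_left cinner_diff_right cinner_app)
lemma adj_uminus [simp]: "adj (- A) = - adj A"
  by (rule adj_eqI) (simp add: app_uminus cinner_minus_left cinner_minus_right cinner_app)
lemma adj_scaleR [simp]: "adj (r *\<^sub>R A) = r *\<^sub>R adj A"
  by (rule adj_eqI) (simp add: app_scaleR cinner_scaleR_left cinner_scaleR_right cinner_app)
lemma adj_scalar_op [simp]: "adj (scalar_op c) = scalar_op (cnj c)"
  by (rule adj_eqI) (simp add: cinner_scaleC_left cinner_scaleC_right)

lemma norm_app_sq: "(norm (app A x))\<^sup>2 = Re (cinner (app (adj A * A) x) x)"
  by (simp add: cinner_app_adj cinner_self)

lemma norm_adj_le: "norm (adj A) \<le> norm A"
proof (rule norm_bop_bound)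
  fix x
  have "(norm (app (adj A) x))\<^sup>2 = Re (cinner (app A (app (adj A) x)) x)" by (simp add: norm_app_sq)
  also have "\<dots> \<le> norm (app A (app (adj A) x)) * norm x"
    using norm_cinner complex_Re_le_cmod order_trans by blast
  also have "\<dots> \<le> norm A * norm (app (adj A) x) * norm x" by (intro mult_right_mono norm_app) simp
  finally have "norm (app (adj A) x) * norm (app (adj A) x) \<le> norm (app (adj A) x) * (norm A * norm x)"
    by (simp add: power2_eq_square mult_ac)
  then show "norm (app (adj A) x) \<le> norm A * norm x"
    by (cases "norm (app (adj A) x) = 0") (auto simp: mult_le_cancel_left)
qed simp

lemma bounded_linear_adj: "bounded_linear adj"
  by (rule bounded_linear_intro[where K=1]) (simp_all add: norm_adj_le)

lemma unitary_isometry: "adj u * u = 1 \<Longrightarrow> norm (app u x) = norm x"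
  using norm_app_sq[of u x] by (simp add: cinner_self)

lemma norm_unitary: "adj u * u = 1 \<Longrightarrow> norm u = 1"
proof -
  assume u: "adj u * u = 1"
  have "norm u \<le> 1" by (rule norm_bop_bound) (simp_all add: unitary_isometry[OF u])
  moreover have "1 \<le> norm u"
    using nonzero_vector norm_app[of u] unitary_isometry[OF u]
    by (metis mult_le_cancel_right1 norm_le_zero_iff norm_eq_zero not_le less_eq_real_def)
  ultimately show ?thesis by simp
qed

text \<open>Equal ranges give \<open>P * Q = Q\<close> and \<open>Q * P = P\<close>; the adjoint of
  the first is \<open>Q * P = Q\<close>.\<close>

lemma projection_ext:
  assumes "P * P = P" "adj P = P" "Q * Q = Q" "adj Q = Q" "range (app P) = range (app Q)"
  shows "P = Q"
proof -
  have "P * Q = Q"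
  proof (rule bop_eqI)
    fix x obtain y where "app Q x = app P y" using assms(5) by (metis imageE rangeI)
    then show "app (P * Q) x = app Q x" by (metis app_times assms(1))
  qed
  moreover have "Q * P = P"
  proof (rule bop_eqI)
    fix x obtain y where "app P x = app Q y" using assms(5) by (metis imageE rangeI)
    then show "app (Q * P) x = app P x" by (metis app_times assms(3))
  qed
  ultimately show ?thesis by (metis adj_times assms(2,4))
qed

text \<open>Justifies the definite description in \<open>proj_onto\<close>. The projection is built
  for the real inner product; stability of \<open>S\<close> under complex scalars makes it complex
  linear and symmetric for \<open>cinner\<close>.\<close>

lemma proj_onto:
  fixes S :: "'a::complex_hilbert set"
  assumes cl: "closed S" and sub: "subspace S" and cS: "\<And>c x. x \<in> S \<Longrightarrow> c *\<^sub>C x \<in> S"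
  shows "proj_onto S * proj_onto S = proj_onto S" "adj (proj_onto S) = proj_onto S"
    "range (app (proj_onto S)) = S"
proof -
  obtain f where f: "\<And>x. f x \<in> S" "\<And>x s. s \<in> S \<Longrightarrow> inner (x - f x) s = 0"
    using orthogonal_decomposition[OF cl sub] by metis
  have uniq: "y = f x" if "y \<in> S" "\<And>s. s \<in> S \<Longrightarrow> inner (x - y) s = 0" for x y
  proof -
    have "inner (x - y) (f x - y) - inner (x - f x) (f x - y) = 0"
      using that f sub by (simp add: subspace_diff)
    then have "inner (f x - y) (f x - y) = 0" by (simp add: inner_diff_left)
    then show ?thesis by simp
  qed
  have fC: "f (c *\<^sub>C x) = c *\<^sub>C f x" for c x
  proof (rule uniq[symmetric])
    show "c *\<^sub>C f x \<in> S" using cS f by blast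
    fix s assume s: "s \<in> S"
    have "inner (c *\<^sub>C x - c *\<^sub>C f x) s = Re (cinner (x - f x) (cnj c *\<^sub>C s))"
      by (simp add: cinner_scaleC_right cinner_scaleC_left flip: Re_cinner scaleC_diff_right)
    also have "\<dots> = 0" using f(2)[OF cS[OF s]] by (simp add: Re_cinner)
    finally show "inner (c *\<^sub>C x - c *\<^sub>C f x) s = 0" .
  qed
  have fS: "f x = x" if "x \<in> S" for x using uniq[of x x] that by simp
  have bl: "bounded_linear f"
  proof (rule bounded_linear_intro[where K=1])
    show "f (x + y) = f x + f y" for x y
    proof (rule uniq[symmetric])
      show "f x + f y \<in> S" using f sub by (simp add: subspace_add)
      fix s assume s: "s \<in> S"
      have "inner (x + y - (f x + f y)) s = inner (x - f x) s + inner (y - f y) s"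
        by (simp add: inner_diff_left inner_add_left)
      then show "inner (x + y - (f x + f y)) s = 0" using f(2)[OF s] by simp
    qed
    show "f (r *\<^sub>R x) = r *\<^sub>R f x" for r x
      using fC[of "of_real r" x] by (simp add: scaleC_of_real)
    fix x
    have "inner (x - f x) (f x) = 0" using f by blast
    then have "(norm (f x))\<^sup>2 = inner x (f x)" by (simp add: power2_norm_eq_inner inner_diff_left)
    also have "\<dots> \<le> norm x * norm (f x)" by (rule norm_cauchy_schwarz)
    finally show "norm (f x) \<le> norm x * 1"
      by (cases "norm (f x) = 0") (auto simp: mult_le_cancel_left power2_eq_square)
  qed
  obtain P where P: "app P = f" using bop_exists[OF bl fC] by blast
  have PP: "P * P = P" by (rule bop_eqI) (simp add: P fS f(1))
  have sym: "inner (f x) y = inner x (f y)" for x y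
    using f(2)[OF f(1), of x y] f(2)[OF f(1), of y x]
    by (simp add: inner_diff_right inner_diff_left inner_commute)
  have "adj P = P"
  proof (rule adj_eqI)
    fix x y
    show "cinner (app P x) y = cinner x (app P y)"
    proof (rule complex_eqI)
      show "Re (cinner (app P x) y) = Re (cinner x (app P y))" by (simp add: Re_cinner P sym)
      show "Im (cinner (app P x) y) = Im (cinner x (app P y))" by (simp add: Im_cinner P sym flip: fC)
    qed
  qed
  moreover have "range (app P) = S"
  proof
    show "range (app P) \<subseteq> S" using f(1) P by auto
    show "S \<subseteq> range (app P)" using fS P by (metis rangeI subsetI)
  qed
  ultimately have *: "P * P = P \<and> adj P = P \<and> range (app P) = S" using PP by blast
  then have "\<exists>!P. P * P = P \<and> adj P = P \<and> range (app P) = S"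
    using projection_ext by (metis (no_types, lifting))
  from theI'[OF this] show "proj_onto S * proj_onto S = proj_onto S" "adj (proj_onto S) = proj_onto S"
    "range (app (proj_onto S)) = S" unfolding proj_onto_def by blast+
qed

text \<open>A linear relation spares the user a choice of representatives: the bound, applied to the
  difference of two pairs over the same point, shows single-valuedness. It yields both
  \<open>J\<close> and the conditional expectation.\<close>

lemma dense_relation_extension:
  fixes R :: "('a::real_normed_vector \<times> 'b::banach) set"
  assumes sub: "subspace R" and bd: "\<And>x y. (x, y) \<in> R \<Longrightarrow> norm y \<le> C * norm x"
    and dense: "closure (fst ` R) = UNIV"
  shows "\<exists>f. bounded_linear f \<and> (\<forall>(x, y)\<in>R. f x = y) \<and> (\<forall>x. norm (f x) \<le> C * norm x)"
proof -
  define D where "D = fst ` R"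
  define g where "g x = (SOME y. (x, y) \<in> R)" for x
  have R2: "y = y'" if "(x, y) \<in> R" "(x, y') \<in> R" for x y y'
  proof -
    have "(x, y) - (x, y') \<in> R" using sub that by (intro subspace_diff)
    then have "norm (y - y') \<le> C * 0" using bd[of 0 "y - y'"] by simp
    then show ?thesis by simp
  qed
  have DR: "x \<in> D" if "(x, y) \<in> R" for x y
    using imageI[OF that, of fst] by (simp add: D_def)
  have gR: "(x, g x) \<in> R" if "x \<in> D" for x
    using that unfolding D_def g_def by (metis (mono_tags, lifting) imageE prod.collapse someI)
  have g: "g x = y" if "(x, y) \<in> R" for x y
    using R2[OF gR[OF DR[OF that]] that] .
  \<comment> \<open>\<open>C\<close> may be zero or negative, whereas \<open>max C 1\<close> can be
    divided by.\<close>
  have C1: "norm y \<le> max C 1 * norm x" if "(x, y) \<in> R" for x y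
    using bd[OF that] by (meson max.cobounded1 mult_right_mono norm_ge_zero order_trans)
  have "uniformly_continuous_on D g"
    unfolding uniformly_continuous_on_def
  proof (intro allI impI)
    fix e :: real assume e: "0 < e"
    show "\<exists>d>0. \<forall>x\<in>D. \<forall>x'\<in>D. dist x' x < d \<longrightarrow> dist (g x') (g x) < e"
    proof (intro exI[of _ "e / max C 1"] conjI ballI impI)
      show "0 < e / max C 1" using e by simp
      fix x x' assume x: "x \<in> D" "x' \<in> D" and d: "dist x' x < e / max C 1"
      have "(x', g x') - (x, g x) \<in> R" by (rule subspace_diff[OF sub gR[OF x(2)] gR[OF x(1)]])
      then have "norm (g x' - g x) \<le> max C 1 * norm (x' - x)" using C1 by simp
      also have "\<dots> < e" using d by (simp add: dist_norm field_simps)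
      finally show "dist (g x') (g x) < e" by (simp add: dist_norm)
    qed
  qed
  then obtain f where uf: "uniformly_continuous_on (closure D) f" and f: "\<And>x. x \<in> D \<Longrightarrow> g x = f x"
    using uniformly_continuous_on_extension_on_closure by metis
  have cf: "continuous_on UNIV f"
    using uniformly_continuous_imp_continuous[OF uf] dense by (simp add: D_def)
  have lim: "\<exists>u. (\<forall>n. u n \<in> D) \<and> u \<longlonglongrightarrow> x" for x
    using dense closure_sequential[of x D] by (auto simp: D_def)
  have cont: "(\<lambda>n. f (u n)) \<longlonglongrightarrow> f x" if "u \<longlonglongrightarrow> x" for u x
    using continuous_on_tendsto_compose[OF cf that] by simp
  have fR: "f x = y" if "(x, y) \<in> R" for x y
    using g[OF that] f[OF DR[OF that]] by simp
  have add: "f (x + y) = f x + f y" for x y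
  proof -
    obtain u v where u: "\<And>n. u n \<in> D" "u \<longlonglongrightarrow> x" and v: "\<And>n. v n \<in> D" "v \<longlonglongrightarrow> y"
      using lim[of x] lim[of y] by auto
    have "f (u n + v n) = f (u n) + f (v n)" for n
    proof (rule fR)
      have "(u n, g (u n)) + (v n, g (v n)) \<in> R" by (rule subspace_add[OF sub gR[OF u(1)] gR[OF v(1)]])
      then show "(u n + v n, f (u n) + f (v n)) \<in> R" using f u v by simp
    qed
    moreover have "(\<lambda>n. f (u n + v n)) \<longlonglongrightarrow> f (x + y)"
      by (intro cont tendsto_add u v)
    moreover have "(\<lambda>n. f (u n) + f (v n)) \<longlonglongrightarrow> f x + f y"
      by (intro tendsto_add cont u v)
    ultimately show ?thesis using LIMSEQ_unique by auto
  qed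
  have sc: "f (r *\<^sub>R x) = r *\<^sub>R f x" for r x
  proof -
    obtain u where u: "\<And>n. u n \<in> D" "u \<longlonglongrightarrow> x" using lim[of x] by auto
    have "f (r *\<^sub>R u n) = r *\<^sub>R f (u n)" for n
    proof (rule fR)
      have "r *\<^sub>R (u n, g (u n)) \<in> R" by (rule subspace_scale[OF sub gR[OF u(1)]])
      then show "(r *\<^sub>R u n, r *\<^sub>R f (u n)) \<in> R" using f u by simp
    qed
    moreover have "(\<lambda>n. f (r *\<^sub>R u n)) \<longlonglongrightarrow> f (r *\<^sub>R x)"
      by (intro cont tendsto_scaleR tendsto_const u)
    moreover have "(\<lambda>n. r *\<^sub>R f (u n)) \<longlonglongrightarrow> r *\<^sub>R f x"
      by (intro tendsto_scaleR tendsto_const cont u)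
    ultimately show ?thesis using LIMSEQ_unique by auto
  qed
  have nf: "norm (f x) \<le> C * norm x" for x
  proof -
    obtain u where u: "\<And>n. u n \<in> D" "u \<longlonglongrightarrow> x" using lim[of x] by auto
    have "norm (f (u n)) \<le> C * norm (u n)" for n
      using bd[OF gR[OF u(1)]] f u by simp
    moreover have "(\<lambda>n. norm (f (u n))) \<longlonglongrightarrow> norm (f x)" by (intro tendsto_norm cont u)
    moreover have "(\<lambda>n. C * norm (u n)) \<longlonglongrightarrow> C * norm x" by (intro tendsto_intros u)
    ultimately show ?thesis by (meson LIMSEQ_le)
  qed
  have "bounded_linear f"
    by (rule bounded_linear_intro[where K=C]) (use add sc nf in \<open>auto simp: mult.commute\<close>)
  with fR nf show ?thesis by blast
qed

section \<open>Von Neumann algebras in standard form\<close>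

lemma commutantI: "(\<And>y. y \<in> A \<Longrightarrow> x * y = y * x) \<Longrightarrow> x \<in> commutant A"
  by (simp add: commutant_def)

lemma commutantD: "x \<in> commutant A \<Longrightarrow> y \<in> A \<Longrightarrow> x * y = y * x"
  by (simp add: commutant_def)

lemma commutant_antimono: "A \<subseteq> B \<Longrightarrow> commutant B \<subseteq> commutant A"
  by (auto simp: commutant_def)

lemma commutant_commutant_superset: "A \<subseteq> commutant (commutant A)"
  by (auto simp: commutant_def)

lemma scalar_op_commute: "scalar_op c * y = y * scalar_op c"
  by (rule bop_eqI) (simp add: app_scaleC)

lemma scalar_op_one [simp]: "scalar_op 1 = 1"
  by (rule bop_eqI) simp

lemma scalar_op_of_real: "scalar_op (of_real r) = r *\<^sub>R 1"
  by (rule bop_eqI) (simp add: scaleC_of_real app_scaleR)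

lemma scalar_op_mult: "scalar_op c * scalar_op d = scalar_op (c * d)"
  by (rule bop_eqI) (simp add: scaleC_scaleC)

lemma adj_commutant:
  assumes "\<And>y. y \<in> A \<Longrightarrow> adj y \<in> A" "x \<in> commutant A" shows "adj x \<in> commutant A"
proof (rule commutantI)
  fix y assume "y \<in> A"
  then have "x * adj y = adj y * x" by (intro commutantD[OF assms(2)] assms(1))
  then have "adj (x * adj y) = adj (adj y * x)" by simp
  then show "adj x * y = y * adj x" by simp
qed

lemma vN_commutant:
  assumes "\<And>y. y \<in> A \<Longrightarrow> adj y \<in> A" shows "von_neumann_algebra (commutant A)"
  unfolding von_neumann_algebra_def
proof (intro conjI ballI)
  show "adj x \<in> commutant A" if "x \<in> commutant A" for x using adj_commutant[OF assms that] .
  show "commutant (commutant (commutant A)) = commutant A"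
    using commutant_antimono[OF commutant_commutant_superset[of A]] commutant_commutant_superset[of "commutant A"]
    by blast
qed

lemma adj_power [simp]: "adj (x ^ n) = adj x ^ n"
  by (induction n) (simp_all add: power_commutes)

lemma adj_exp: "adj (exp x) = exp (adj x)"
proof -
  have "adj (\<Sum>n. x ^ n /\<^sub>R fact n) = (\<Sum>n. adj (x ^ n /\<^sub>R fact n))"
    by (rule bounded_linear.suminf[OF bounded_linear_adj summable_exp_generic])
  then show ?thesis by (simp add: exp_def)
qed

lemma continuous_on_mult_left_bop: "continuous_on S (\<lambda>x::'a::complex_hilbert bop. y * x)"
  by (intro linear_continuous_on bounded_linear_mult_right)

lemma continuous_on_mult_right_bop: "continuous_on S (\<lambda>x::'a::complex_hilbert bop. x * y)"
  by (intro linear_continuous_on bounded_linear_mult_left)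

section \<open>Closure properties and unitaries of a von Neumann algebra\<close>

locale vn_algebra =
  fixes A :: "'a::complex_hilbert bop set"
  assumes vN: "von_neumann_algebra A"
begin

lemma bicommutant: "commutant (commutant A) = A" using vN by (simp add: von_neumann_algebra_def)
lemma adj_closed: "x \<in> A \<Longrightarrow> adj x \<in> A" using vN by (simp add: von_neumann_algebra_def)

lemma memI: "(\<And>y. y \<in> commutant A \<Longrightarrow> x * y = y * x) \<Longrightarrow> x \<in> A"
  using bicommutant commutantI by metis

lemma commutes: "x \<in> A \<Longrightarrow> y \<in> commutant A \<Longrightarrow> x * y = y * x"
  by (simp add: commutantD)

lemma one_closed: "1 \<in> A" by (rule memI) simp
lemma scalar_closed: "scalar_op c \<in> A" by (rule memI) (rule scalar_op_commute)
lemma zero_closed: "0 \<in> A" by (rule memI) simp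
lemma plus_closed: "x \<in> A \<Longrightarrow> y \<in> A \<Longrightarrow> x + y \<in> A"
  by (rule memI) (simp add: commutes algebra_simps)
lemma minus_closed: "x \<in> A \<Longrightarrow> y \<in> A \<Longrightarrow> x - y \<in> A"
  by (rule memI) (simp add: commutes algebra_simps)
lemma uminus_closed: "x \<in> A \<Longrightarrow> - x \<in> A"
  by (rule memI) (simp add: commutes)
lemma times_closed: "x \<in> A \<Longrightarrow> y \<in> A \<Longrightarrow> x * y \<in> A"
proof (rule memI)
  fix z assume "x \<in> A" "y \<in> A" "z \<in> commutant A"
  then have "y * z = z * y" "x * z = z * x" using commutes by blast+
  then show "x * y * z = z * (x * y)" by (metis mult.assoc)
qed
lemma scaleR_closed: "x \<in> A \<Longrightarrow> r *\<^sub>R x \<in> A"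
  by (rule memI) (simp add: commutes)
lemma power_closed: "x \<in> A \<Longrightarrow> x ^ n \<in> A"
  by (induction n) (simp_all add: one_closed times_closed)

lemmas alg_closed = adj_closed one_closed scalar_closed zero_closed plus_closed minus_closed
  uminus_closed times_closed scaleR_closed power_closed

lemma subspace: "subspace A"
  by (simp add: subspace_def alg_closed)

lemma closed: "closed A"
proof -
  have "A = (\<Inter>y\<in>commutant A. {x. x * y = y * x})" using memI commutes by blast
  moreover have "closed {x. x * y = y * x}" for y :: "'a bop"
    by (intro closed_Collect_eq continuous_on_mult_left_bop continuous_on_mult_right_bop)
  ultimately show ?thesis by (metis (no_types, lifting) closed_INT)
qed

lemma limit_closed: "(\<And>n. f n \<in> A) \<Longrightarrow> f \<longlonglongrightarrow> x \<Longrightarrow> x \<in> A"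
  using closed_sequentially[OF closed] by blast

lemma exp_closed: assumes "x \<in> A" shows "exp x \<in> A"
proof (rule limit_closed)
  show "(\<lambda>n. \<Sum>i<n. x ^ i /\<^sub>R fact i) \<longlonglongrightarrow> exp x"
    using summable_exp_generic[of x] by (simp add: exp_def summable_LIMSEQ)
  show "(\<Sum>i<n. x ^ i /\<^sub>R fact i) \<in> A" for n
    by (intro subspace_sum[OF subspace] scaleR_closed power_closed assms)
qed

lemma unitaries_closed: "u \<in> unitaries A \<Longrightarrow> v \<in> unitaries A \<Longrightarrow> u * v \<in> unitaries A"
  unfolding unitaries_def
  by (auto simp: times_closed mult.assoc) (metis mult.assoc mult_1_left)+

lemma unitaries_adj: "u \<in> unitaries A \<Longrightarrow> adj u \<in> unitaries A"
  by (auto simp: unitaries_def adj_closed)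

lemma exp_unitary:
  assumes "x \<in> A" "adj x = - x" shows "exp x \<in> unitaries A"
  using assms exp_minus_inverse[of x] exp_minus_inverse[of "-x"]
  by (simp add: unitaries_def exp_closed adj_exp)

text \<open>Differentiating \<open>exp (t *\<^sub>R a)\<close> at 0 settles antihermitian
  \<open>a\<close>, and every element is a complex combination of two antihermitian ones.\<close>

lemma commute_unitaries_imp:
  assumes y: "\<And>u. u \<in> unitaries A \<Longrightarrow> u * y = y * u" and a: "a \<in> A" shows "a * y = y * a"
proof -
  have anti: "a * y = y * a" if a: "a \<in> A" "adj a = - a" for a
  proof -
    have "((\<lambda>t. exp (t *\<^sub>R a) * y - y * exp (t *\<^sub>R a)) has_vector_derivative
        exp (0 *\<^sub>R a) * a * y - y * (exp (0 *\<^sub>R a) * a)) (at 0)"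
      by (intro derivative_intros bounded_linear.has_vector_derivative[OF bounded_linear_mult_left]
          bounded_linear.has_vector_derivative[OF bounded_linear_mult_right]
          exp_scaleR_has_vector_derivative_right)
    moreover have "(\<lambda>t. exp (t *\<^sub>R a) * y - y * exp (t *\<^sub>R a)) = (\<lambda>t. 0)"
      using y exp_unitary[of "_ *\<^sub>R a"] a by (simp add: scaleR_closed)
    ultimately have "((\<lambda>t::real. 0) has_vector_derivative a * y - y * a) (at 0)" by simp
    then have "a * y - y * a = 0"
      using vector_derivative_unique_at has_vector_derivative_const by blast
    then show ?thesis by simp
  qed
  \<comment> \<open>\<open>b\<close> is the antihermitian part of \<open>a\<close> and
    \<open>c\<close> is \<i> times its hermitian part; both are antihermitian, and \<open>a\<close>
    is \<open>b\<close> minus \<i> times \<open>c\<close>.\<close>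
  define b where "b = (1/2) *\<^sub>R (a - adj a)"
  define c where "c = scalar_op \<i> * ((1/2) *\<^sub>R (a + adj a))"
  have cs: "adj c = - c"
    by (rule bop_eqI) (simp add: c_def app_uminus app_scaleC scaleC_scaleC[symmetric] app_scaleR
        app_plus scaleC_scaleR add.commute flip: scaleC_minus_one, simp add: scaleC_scaleC)
  have "adj b = - b" by (simp add: b_def flip: scaleR_minus_right)
  then have 1: "b * y = y * b" using a by (intro anti) (auto simp: b_def alg_closed)
  have 2: "c * y = y * c" using a cs by (intro anti) (auto simp: c_def alg_closed)
  have "scalar_op (- \<i>) * c = (scalar_op (- \<i>) * scalar_op \<i>) * ((1/2) *\<^sub>R (a + adj a))"
    by (simp only: c_def mult.assoc)
  then have "scalar_op (- \<i>) * c = (1/2) *\<^sub>R (a + adj a)"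
    by (simp add: scalar_op_mult)
  then have "a = b + scalar_op (- \<i>) * c"
    by (simp add: b_def scaleR_add_right scaleR_diff_right flip: scaleR_add_left)
  moreover have "scalar_op (- \<i>) * c * y = y * (scalar_op (- \<i>) * c)"
  proof -
    have "scalar_op (- \<i>) * c * y = scalar_op (- \<i>) * y * c" by (simp only: mult.assoc 2)
    also have "scalar_op (- \<i>) * y = y * scalar_op (- \<i>)" by (rule scalar_op_commute)
    finally show ?thesis by (simp only: mult.assoc)
  qed
  ultimately show ?thesis using 1 by (simp only: distrib_left distrib_right)
qed

end

section \<open>Ultraweakly continuous functionals\<close>

lemma summable_uw:
  fixes \<xi> \<eta> :: "nat \<Rightarrow> 'a::complex_hilbert"
  assumes "summable (\<lambda>n. (norm (\<xi> n))\<^sup>2)" "summable (\<lambda>n. (norm (\<eta> n))\<^sup>2)"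
  shows "summable (\<lambda>n. norm (\<xi> n) * norm (\<eta> n))"
proof (rule summable_comparison_test')
  show "summable (\<lambda>n. (norm (\<xi> n))\<^sup>2 + (norm (\<eta> n))\<^sup>2)" by (intro summable_add assms)
  show "norm (norm (\<xi> n) * norm (\<eta> n)) \<le> (norm (\<xi> n))\<^sup>2 + (norm (\<eta> n))\<^sup>2" for n
  proof -
    have "0 \<le> norm (\<xi> n) * norm (\<eta> n)" by simp
    with sum_squares_bound[of "norm (\<xi> n)" "norm (\<eta> n)"] show ?thesis
      by (simp only: real_norm_def abs_of_nonneg)
  qed
qed

lemma norm_cinner_app: "cmod (cinner (app x \<xi>) \<eta>) \<le> norm x * (norm \<xi> * norm \<eta>)"
  using order_trans[OF norm_cinner mult_right_mono[OF norm_app norm_ge_zero], of x \<xi> \<eta>]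
  by (simp only: mult.assoc)

text \<open>Norm continuity of such functionals is what allows the trace to be applied under
  derivatives.\<close>

lemma bounded_linear_uw:
  fixes \<xi> \<eta> :: "nat \<Rightarrow> 'a::complex_hilbert"
  assumes "summable (\<lambda>n. (norm (\<xi> n))\<^sup>2)" "summable (\<lambda>n. (norm (\<eta> n))\<^sup>2)"
  shows "bounded_linear (\<lambda>x. \<Sum>n. cinner (app x (\<xi> n)) (\<eta> n))"
proof -
  note s = summable_uw[OF assms]
  have sn: "summable (\<lambda>n. cmod (cinner (app x (\<xi> n)) (\<eta> n)))" for x
    by (rule summable_comparison_test'[OF summable_mult[OF s, of "norm x"]]) (simp add: norm_cinner_app)
  note sc = summable_norm_cancel[OF sn]
  show ?thesis
  proof (rule bounded_linear_intro)
    show "(\<Sum>n. cinner (app (x + y) (\<xi> n)) (\<eta> n))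
      = (\<Sum>n. cinner (app x (\<xi> n)) (\<eta> n)) + (\<Sum>n. cinner (app y (\<xi> n)) (\<eta> n))" for x y
      by (simp add: app_plus cinner_add_left suminf_add sc)
    show "(\<Sum>n. cinner (app (r *\<^sub>R x) (\<xi> n)) (\<eta> n)) = r *\<^sub>R (\<Sum>n. cinner (app x (\<xi> n)) (\<eta> n))" for r x
      by (simp add: app_scaleR cinner_scaleR_left suminf_mult sc) (simp add: scaleR_conv_of_real)
    show "cmod (\<Sum>n. cinner (app x (\<xi> n)) (\<eta> n)) \<le> norm x * (\<Sum>n. norm (\<xi> n) * norm (\<eta> n))" for x
    proof -
      have "cmod (\<Sum>n. cinner (app x (\<xi> n)) (\<eta> n)) \<le> (\<Sum>n. cmod (cinner (app x (\<xi> n)) (\<eta> n)))"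
        by (rule summable_norm[OF sn])
      also have "\<dots> \<le> (\<Sum>n. norm x * (norm (\<xi> n) * norm (\<eta> n)))"
        by (intro suminf_le sn summable_mult s norm_cinner_app)
      also have "\<dots> = norm x * (\<Sum>n. norm (\<xi> n) * norm (\<eta> n))" by (rule suminf_mult[OF s])
      finally show ?thesis .
    qed
  qed
qed

text \<open>On a bounded sequence the terms of the series are dominated by a summable one, so
  Tannery's theorem exchanges the limit with the sum.\<close>

lemma uw_strong_limit:
  fixes \<xi> \<eta> :: "nat \<Rightarrow> 'a::complex_hilbert"
  assumes "summable (\<lambda>n. (norm (\<xi> n))\<^sup>2)" "summable (\<lambda>n. (norm (\<eta> n))\<^sup>2)"
    and X: "\<And>k. norm (X k) \<le> C" "\<And>v. (\<lambda>k. app (X k) v) \<longlonglongrightarrow> app B v"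
  shows "(\<lambda>k. \<Sum>n. cinner (app (X k) (\<xi> n)) (\<eta> n)) \<longlonglongrightarrow> (\<Sum>n. cinner (app B (\<xi> n)) (\<eta> n))"
proof (rule tannerys_theorem[THEN conjunct2, THEN conjunct2])
  show "((\<lambda>k. cinner (app (X k) (\<xi> n)) (\<eta> n)) \<longlongrightarrow> cinner (app B (\<xi> n)) (\<eta> n)) sequentially" for n
    by (intro tendsto_cinner X tendsto_const)
  show "summable (\<lambda>n. C * (norm (\<xi> n) * norm (\<eta> n)))"
    by (intro summable_mult summable_uw assms)
  have "cmod (cinner (app (X k) (\<xi> n)) (\<eta> n)) \<le> C * (norm (\<xi> n) * norm (\<eta> n))" for k n
    by (rule order_trans[OF norm_cinner_app]) (intro mult_right_mono X, simp)
  then show "\<forall>\<^sub>F (n, k) in at_top \<times>\<^sub>F sequentially.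
      cmod (cinner (app (X k) (\<xi> n)) (\<eta> n)) \<le> C * (norm (\<xi> n) * norm (\<eta> n))"
    by (intro always_eventually) auto
qed simp

lemma dense_ext:
  fixes f g :: "'a::topological_space \<Rightarrow> 'b::t2_space"
  assumes "closure D = UNIV" "continuous_on UNIV f" "continuous_on UNIV g" "\<And>x. x \<in> D \<Longrightarrow> f x = g x"
  shows "f x = g x"
proof -
  have "closure D \<subseteq> {x. f x = g x}"
    by (rule closure_minimal) (use assms in \<open>auto intro: closed_Collect_eq\<close>)
  then show ?thesis using assms(1) by auto
qed

section \<open>The trace vector and the modular conjugation\<close>

locale standard_vn = vn_algebra M for M :: "'a::complex_hilbert bop set" +
  fixes \<Omega> :: 'a
  assumes std: "standard_rep M \<Omega>"
begin

lemma dense: "closure ((\<lambda>x. app x \<Omega>) ` M) = UNIV"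
  using std by (simp add: standard_rep_def)

lemma tr_comm: "x \<in> M \<Longrightarrow> y \<in> M \<Longrightarrow> cinner (app (x * y) \<Omega>) \<Omega> = cinner (app (y * x) \<Omega>) \<Omega>"
  using std unfolding standard_rep_def normalized_trace_def by blast

lemma tr_one: "cinner \<Omega> \<Omega> = 1"
  using std unfolding standard_rep_def normalized_trace_def by simp

lemma separating: "x \<in> M \<Longrightarrow> app x \<Omega> = 0 \<Longrightarrow> x = 0"
  using std unfolding standard_rep_def normalized_trace_def by simp

lemma separating_eq: "x \<in> M \<Longrightarrow> y \<in> M \<Longrightarrow> app x \<Omega> = app y \<Omega> \<Longrightarrow> x = y"
  using separating[of "x - y"] by (simp add: minus_closed app_minus)

lemma cinner_adj_Omega:
  "x \<in> M \<Longrightarrow> y \<in> M \<Longrightarrow> cinner (app (adj x) \<Omega>) (app (adj y) \<Omega>) = cinner (app y \<Omega>) (app x \<Omega>)"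
  using tr_comm[of y "adj x"] by (simp add: cinner_app_adj adj_closed cinner_app[symmetric])

text \<open>Traciality makes \<open>app x \<Omega> \<mapsto> app (adj x) \<Omega>\<close> isometric,
  so it extends from the dense orbit of \<Omega> to the whole space.\<close>

lemma J_exists: "\<exists>J. bounded_linear J \<and> (\<forall>x\<in>M. J (app x \<Omega>) = app (adj x) \<Omega>)"
proof -
  define R where "R = (\<lambda>x. (app x \<Omega>, app (adj x) \<Omega>)) ` M"
  have RI: "(app x \<Omega>, app (adj x) \<Omega>) \<in> R" if "x \<in> M" for x using that by (auto simp: R_def)
  have sub: "subspace R" unfolding subspace_def
  proof (intro conjI ballI allI)
    show "0 \<in> R" using RI[OF zero_closed] by (simp add: zero_prod_def)
    show "u + v \<in> R" if "u \<in> R" "v \<in> R" for u v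
      using that RI[OF plus_closed] by (force simp: R_def app_plus)
    show "c *\<^sub>R u \<in> R" if "u \<in> R" for c u
      using that RI[OF scaleR_closed] by (force simp: R_def app_scaleR)
  qed
  have bd: "norm v \<le> 1 * norm u" if uv: "(u, v) \<in> R" for u v
  proof -
    obtain x where "x \<in> M" "u = app x \<Omega>" "v = app (adj x) \<Omega>" using uv by (auto simp: R_def)
    then have "cinner v v = cinner u u" using cinner_adj_Omega by blast
    then show ?thesis by (simp add: cinner_self flip: of_real_power)
  qed
  have "closure (fst ` R) = UNIV" using dense by (simp add: R_def image_image)
  from dense_relation_extension[OF sub bd this]
  obtain f where f: "bounded_linear f" "\<forall>(x, y)\<in>R. f x = y" by blast
  have "f (app x \<Omega>) = app (adj x) \<Omega>" if "x \<in> M" for x using bspec[OF f(2) RI[OF that]] by simp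
  with f(1) show ?thesis by blast
qed

definition "J = (SOME f. bounded_linear f \<and> (\<forall>x\<in>M. f (app x \<Omega>) = app (adj x) \<Omega>))"

lemma bounded_linear_J: "bounded_linear J" and J_app: "x \<in> M \<Longrightarrow> J (app x \<Omega>) = app (adj x) \<Omega>"
  using someI_ex[OF J_exists] unfolding J_def by blast+

lemma continuous_on_J: "continuous_on S J" by (rule linear_continuous_on[OF bounded_linear_J])

lemmas J_add = linear_add[OF bounded_linear.linear[OF bounded_linear_J]]
lemma dense_ext_M:
  assumes "continuous_on UNIV f" "continuous_on UNIV g" "\<And>x. x \<in> M \<Longrightarrow> f (app x \<Omega>) = g (app x \<Omega>)"
  shows "f v = (g v :: 'b::t2_space)"
  using dense_ext[OF dense assms(1,2)] assms(3) by auto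

lemma J_J [simp]: "J (J v) = v"
proof (rule dense_ext_M[where f = "\<lambda>v. J (J v)" and g = "\<lambda>v. v"])
  show "continuous_on UNIV (\<lambda>v. J (J v))"
    using bounded_linear_compose[OF bounded_linear_J bounded_linear_J] linear_continuous_on by blast
qed (simp_all add: J_app adj_closed)

lemma J_scaleC: "J (c *\<^sub>C v) = cnj c *\<^sub>C J v"
proof (rule dense_ext_M[where f = "\<lambda>v. J (c *\<^sub>C v)" and g = "\<lambda>v. cnj c *\<^sub>C J v"])
  show "continuous_on UNIV (\<lambda>v. J (c *\<^sub>C v))"
    using bounded_linear_compose[OF bounded_linear_J bounded_linear_scaleC] linear_continuous_on by blast
  show "continuous_on UNIV (\<lambda>v. cnj c *\<^sub>C J v)"
    using bounded_linear_compose[OF bounded_linear_scaleC bounded_linear_J] linear_continuous_on by blast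
  show "J (c *\<^sub>C app x \<Omega>) = cnj c *\<^sub>C J (app x \<Omega>)" if "x \<in> M" for x
    using J_app[of "scalar_op c * x"] J_app[OF that] that
    by (simp add: times_closed scalar_closed app_scaleC)
qed

lemma cinner_J: "cinner (J v) (J w) = cinner w v"
proof -
  have *: "cinner (J v) (app (adj y) \<Omega>) = cinner (app y \<Omega>) v" if y: "y \<in> M" for v y
  proof (rule dense_ext_M[where f = "\<lambda>v. cinner (J v) (app (adj y) \<Omega>)" and g = "cinner (app y \<Omega>)"])
    show "continuous_on UNIV (\<lambda>v. cinner (J v) (app (adj y) \<Omega>))"
      by (intro linear_continuous_on bounded_linear_compose[OF bounded_bilinear.bounded_linear_left[OF bounded_bilinear_cinner]] bounded_linear_J)
    show "continuous_on UNIV (cinner (app y \<Omega>))"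
      by (intro linear_continuous_on bounded_bilinear.bounded_linear_right[OF bounded_bilinear_cinner])
  qed (simp add: J_app cinner_adj_Omega y)
  show ?thesis
  proof (rule dense_ext_M[where f = "\<lambda>w. cinner (J v) (J w)" and g = "\<lambda>w. cinner w v"])
    show "continuous_on UNIV (\<lambda>w. cinner (J v) (J w))"
      by (intro linear_continuous_on bounded_linear_compose[OF bounded_bilinear.bounded_linear_right[OF bounded_bilinear_cinner]] bounded_linear_J)
    show "continuous_on UNIV (\<lambda>w. cinner w v)"
      by (intro linear_continuous_on bounded_bilinear.bounded_linear_left[OF bounded_bilinear_cinner])
  qed (simp add: J_app *)
qed

lemma cinner_J_left: "cinner (J v) w = cinner (J w) v"
  using cinner_J[of v "J w"] by simp

lemma cinner_J_right: "cinner v (J w) = cinner w (J v)"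
  using cinner_J[of "J v" w] by simp

lemma norm_J: "norm (J v) = norm v"
proof -
  have "cinner (J v) (J v) = cinner v v" by (rule cinner_J)
  then show ?thesis by (simp add: cinner_self flip: of_real_power)
qed

lemma conjJ_exists: "\<exists>B. app B = (\<lambda>v. J (app A (J v)))"
proof (rule bop_exists)
  show "bounded_linear (\<lambda>v. J (app A (J v)))"
    by (intro bounded_linear_compose[OF bounded_linear_J] bounded_linear_J
        bounded_linear_compose[OF bounded_bilinear.bounded_linear_right[OF bounded_bilinear_app]])
qed (simp add: J_scaleC app_scaleC)

definition "conjJ A = (SOME B. app B = (\<lambda>v. J (app A (J v))))"

lemma app_conjJ [simp]: "app (conjJ A) v = J (app A (J v))"
  using someI_ex[OF conjJ_exists[of A]] unfolding conjJ_def by simp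

lemma conjJ_conjJ [simp]: "conjJ (conjJ A) = A" by (rule bop_eqI) simp
lemma conjJ_times: "conjJ (A * B) = conjJ A * conjJ B" by (rule bop_eqI) simp
lemma conjJ_one [simp]: "conjJ 1 = 1" by (rule bop_eqI) simp
lemma conjJ_plus: "conjJ (A + B) = conjJ A + conjJ B" by (rule bop_eqI) (simp add: app_plus J_add)
lemma conjJ_scalar: "conjJ (scalar_op c) = scalar_op (cnj c)" by (rule bop_eqI) (simp add: J_scaleC)
lemma conjJ_adj: "adj (conjJ A) = conjJ (adj A)"
proof (rule adj_eqI)
  fix v w
  have "cinner (app (conjJ A) v) w = cinner (J w) (app A (J v))" by (simp add: cinner_J_left)
  also have "\<dots> = cinner (app (adj A) (J w)) (J v)" by (simp only: cinner_app_adj)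
  also have "\<dots> = cinner v (app (conjJ (adj A)) w)" by (simp add: cinner_J_right[of v])
  finally show "cinner (app (conjJ A) v) w = cinner v (app (conjJ (adj A)) w)" .
qed

lemma conjJ_app: "x \<in> M \<Longrightarrow> y \<in> M \<Longrightarrow> app (conjJ x) (app y \<Omega>) = app (y * adj x) \<Omega>"
  using J_app[of "x * adj y"] by (simp add: J_app times_closed adj_closed)

lemma conjJ_Omega: "x \<in> M \<Longrightarrow> app (conjJ x) \<Omega> = app (adj x) \<Omega>"
  using conjJ_app[OF _ one_closed, of x] by simp

text \<open>By \<open>conjJ_app\<close>, \<open>conjJ x\<close> acts on the orbit of \<Omega> as
  right multiplication by \<open>adj x\<close>, and right multiplications commute with left
  ones.\<close>

lemma conjJ_commutant: assumes "x \<in> M" shows "conjJ x \<in> commutant M"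
proof (rule commutantI, rule bop_eqI)
  fix y v assume y: "y \<in> M"
  show "app (conjJ x * y) v = app (y * conjJ x) v"
  proof (rule dense_ext_M[where f = "app (conjJ x * y)" and g = "app (y * conjJ x)"])
    fix z assume z: "z \<in> M"
    show "app (conjJ x * y) (app z \<Omega>) = app (y * conjJ x) (app z \<Omega>)"
      using conjJ_app[OF assms times_closed[OF y z]] conjJ_app[OF assms z]
      by (simp del: app_conjJ)
  qed (intro continuous_intros)+
qed

text \<open>For \<open>B = N\<close> this makes \<Omega> cyclic for \<open>commutant N\<close>, so a
  bounded operator can be prescribed on the vectors \<open>app a \<Omega>\<close> with
  \<open>a\<close> in \<open>commutant N\<close>.\<close>

lemma commutant_dense:
  assumes "B \<subseteq> M" shows "closure ((\<lambda>a. app a \<Omega>) ` commutant B) = UNIV"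
proof -
  have "(\<lambda>x. app x \<Omega>) ` M \<subseteq> (\<lambda>a. app a \<Omega>) ` commutant B"
  proof
    fix v assume "v \<in> (\<lambda>x. app x \<Omega>) ` M"
    then obtain x where x: "x \<in> M" "v = app x \<Omega>" by blast
    have "conjJ (adj x) \<in> commutant B"
      using conjJ_commutant[OF adj_closed[OF x(1)]] commutant_antimono[OF assms] by blast
    moreover have "v = app (conjJ (adj x)) \<Omega>"
      using conjJ_Omega[OF adj_closed[OF x(1)]] x(2) by simp
    ultimately show "v \<in> (\<lambda>a. app a \<Omega>) ` commutant B" by blast
  qed
  from closure_mono[OF this] show ?thesis using dense by auto
qed

text \<open>Convergence at the single vector \<Omega> spreads to every
  \<open>app x \<Omega>\<close>, because \<open>conjJ (adj x)\<close> moves \<Omega> there and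
  commutes with all \<open>X n\<close>. The norm bound then gives strong convergence by
  density.\<close>

lemma L2_limit:
  assumes A: "von_neumann_algebra A" "A \<subseteq> M" and X: "\<And>n. X n \<in> A" "\<And>n. norm (X n) \<le> C"
    and k: "(\<lambda>n. app (X n) \<Omega>) \<longlonglongrightarrow> k"
  shows "\<exists>y\<in>A. app y \<Omega> = k \<and> (\<forall>v. (\<lambda>n. app (X n) v) \<longlonglongrightarrow> app y v)"
proof -
  interpret A: vn_algebra A using A(1) by unfold_locales
  have C: "0 \<le> C" using X(2)[of 0] norm_ge_zero order_trans by blast
  have conv: "convergent (\<lambda>n. app (X n) v)" for v
  proof -
    have "Cauchy (\<lambda>n. app (X n) v)"
    proof (rule metric_CauchyI)
      fix e :: real assume e: "0 < e"
      \<comment> \<open>\<open>C + 1\<close> avoids a zero denominator. Approximating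
        \<open>v\<close> costs \<open>e / 4\<close> at each of two indices and leaves
        \<open>e / 2\<close> for the Cauchy estimate at \<open>w\<close>.\<close>
      have "\<exists>w\<in>(\<lambda>x. app x \<Omega>) ` M. dist w v < e / (4 * (C + 1))"
      proof -
        have "v \<in> closure ((\<lambda>x. app x \<Omega>) ` M)" using dense by simp
        moreover have "0 < e / (4 * (C + 1))" using e C by simp
        ultimately show ?thesis unfolding closure_approachable by blast
      qed
      then obtain x where x: "x \<in> M" "dist (app x \<Omega>) v < e / (4 * (C + 1))" by auto
      define w where "w = app x \<Omega>"
      have w: "app (X n) w = app (conjJ (adj x)) (app (X n) \<Omega>)" for n
        using conjJ_app[OF adj_closed[OF x(1)] subsetD[OF A(2) X(1)], of n] by (simp add: w_def)
      have "(\<lambda>n. app (X n) w) \<longlonglongrightarrow> app (conjJ (adj x)) k"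
        unfolding w by (intro tendsto_app tendsto_const k)
      then have "Cauchy (\<lambda>n. app (X n) w)" using LIMSEQ_imp_Cauchy by blast
      then obtain N where N: "\<And>m n. m \<ge> N \<Longrightarrow> n \<ge> N \<Longrightarrow> dist (app (X m) w) (app (X n) w) < e / 2"
        using e unfolding Cauchy_def by (metis half_gt_zero)
      have d: "dist (app (X n) v) (app (X n) w) \<le> e / 4" for n
      proof -
        have "norm (app (X n) (v - w)) \<le> norm (X n) * norm (v - w)" by (rule norm_app)
        also have "\<dots> \<le> (C + 1) * (e / (4 * (C + 1)))"
          using x(2) X(2)[of n] C by (intro mult_mono) (auto simp: w_def dist_norm norm_minus_commute)
        also have "\<dots> = e / 4" using C by (simp add: field_simps)
        finally show ?thesis by (simp add: dist_norm app_diff)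
      qed
      have "dist (app (X m) v) (app (X n) v) < e" if "m \<ge> N" "n \<ge> N" for m n
        using d[of m] d[of n] N[OF that]
          dist_triangle[of "app (X m) v" "app (X n) v" "app (X m) w"]
          dist_triangle[of "app (X m) w" "app (X n) v" "app (X n) w"]
        by (simp add: dist_commute)
      then show "\<exists>N. \<forall>m\<ge>N. \<forall>n\<ge>N. dist (app (X m) v) (app (X n) v) < e" by blast
    qed
    then show ?thesis by (simp add: Cauchy_convergent_iff)
  qed
  obtain y where y: "\<And>v. (\<lambda>n. app (X n) v) \<longlonglongrightarrow> app y v"
    using strong_limit[OF X(2) conv] by blast
  have "y \<in> A"
  proof (rule A.memI, rule bop_eqI)
    fix b v assume b: "b \<in> commutant A"
    have "(\<lambda>n. app b (app (X n) v)) \<longlonglongrightarrow> app b (app y v)" by (intro tendsto_app tendsto_const y)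
    moreover have "app b (app (X n) v) = app (X n) (app b v)" for n
      using A.commutes[OF X(1) b, of n] by (metis app_times)
    ultimately have "(\<lambda>n. app (X n) (app b v)) \<longlonglongrightarrow> app b (app y v)" by simp
    from LIMSEQ_unique[OF y this] show "app (y * b) v = app (b * y) v" by simp
  qed
  moreover have "app y \<Omega> = k" using LIMSEQ_unique[OF y k] .
  ultimately show ?thesis using y by blast
qed

end

section \<open>Traces\<close>

text \<open>
  Iterating Cauchy--Schwarz along \<open>s k = \<langle>D\<^sup>k\<xi>, \<xi>\<rangle>\<close> gives \<open>\<langle>D\<xi>, \<xi>\<rangle> \<le> \<parallel>D\<parallel> \<langle>\<xi>, \<xi>\<rangle>\<close> for any positive
  semidefinite form for which \<open>D\<close> is symmetric, without square roots of operators.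
\<close>

lemma power_domination:
  fixes s :: "nat \<Rightarrow> real"
  assumes s0: "0 \<le> s 0" and s1: "0 \<le> s 1" and sq: "\<And>k. (s k)\<^sup>2 \<le> s 0 * s (2 * k)"
    and bound: "\<And>k. s k \<le> C * B ^ k" and B: "0 \<le> B"
  shows "s 1 \<le> s 0 * B"
proof (cases "s 0 = 0")
  case True
  then show ?thesis using sq[of 1] by simp
next
  case False
  with s0 have pos: "0 < s 0" by simp
  define r where "r = s 1 / s 0"
  have r0: "0 \<le> r" using pos s1 by (simp add: r_def)
  have r: "r ^ (2 ^ j) \<le> s (2 ^ j) / s 0" for j
  proof (induction j)
    case 0
    show ?case by (simp add: r_def)
  next
    case (Suc j)
    have "r ^ (2 ^ Suc j) = (r ^ (2 ^ j))\<^sup>2" by (simp add: power_mult[symmetric] mult.commute)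
    also have "\<dots> \<le> (s (2 ^ j) / s 0)\<^sup>2" by (intro power_mono Suc.IH zero_le_power r0)
    also have "\<dots> = (s (2 ^ j))\<^sup>2 / (s 0 * s 0)" by (simp add: power_divide power2_eq_square)
    also have "\<dots> \<le> s 0 * s (2 * 2 ^ j) / (s 0 * s 0)" using pos sq[of "2 ^ j"] by (intro divide_right_mono) auto
    also have "\<dots> = s (2 ^ Suc j) / s 0" using pos by simp
    finally show ?case .
  qed
  have le: "r ^ (2 ^ j) \<le> C / s 0 * B ^ (2 ^ j)" for j
    using r[of j] bound[of "2 ^ j"] pos by (simp add: field_simps)
  have "r \<le> B"
  proof (rule ccontr)
    assume "\<not> r \<le> B"
    then have rB: "B < r" by simp
    show False
    proof (cases "B = 0")
      case True
      then show False using le[of 0] rB by simp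
    next
      case False
      with B have B0: "0 < B" by simp
      then have "1 < r / B" using rB by simp
      \<comment> \<open>If \<open>B < r\<close>, the powers of \<open>r / B\<close> outgrow the
        constant \<open>C / s 0\<close>, whereas \<open>le\<close> keeps those with exponent a power
        of two below it.\<close>
      then obtain n where n: "C / s 0 < (r / B) ^ n" using real_arch_pow by blast
      have "(r / B) ^ n \<le> (r / B) ^ (2 ^ n)"
        using \<open>1 < r / B\<close> by (intro power_increasing) (auto intro: less_imp_le)
      also have "\<dots> = r ^ (2 ^ n) / B ^ (2 ^ n)" by (rule power_divide)
      also have "\<dots> \<le> C / s 0" using le[of n] B0 by (simp add: divide_le_eq)
      finally show False using n by simp
    qed
  qed
  then show ?thesis using pos by (simp add: r_def field_simps)
qed

section \<open>Uniqueness of traces by averaging over unitaries\<close>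

context standard_vn
begin

text \<open>
  The vector of least norm in the closed convex hull of the unitary orbit of \<open>x\<Omega>\<close> is fixed by all
  unitaries, so it comes from a central element of \<open>A\<close>, that is, from a scalar.
\<close>

lemma trace_unique:
  assumes A: "factor A" "A \<subseteq> M"
    and add: "\<And>x y. x \<in> A \<Longrightarrow> y \<in> A \<Longrightarrow> \<phi> (x + y) = \<phi> x + \<phi> y"
    and sc: "\<And>c x. x \<in> A \<Longrightarrow> \<phi> (scalar_op c * x) = c * \<phi> x"
    and tr: "\<And>x y. x \<in> A \<Longrightarrow> y \<in> A \<Longrightarrow> \<phi> (x * y) = \<phi> (y * x)"
    and uw: "ultraweakly_continuous_on A \<phi>" and x: "x \<in> A"
  shows "\<phi> x = cinner (app x \<Omega>) \<Omega> * \<phi> 1"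
proof -
  interpret A: vn_algebra A using A(1) by unfold_locales (simp add: factor_def)
  have AM: "y \<in> M" if "y \<in> A" for y using that A(2) by blast
  have scR: "\<phi> (r *\<^sub>R y) = of_real r * \<phi> y" if "y \<in> A" for r y
    using sc[OF that, of "of_real r"] by (simp add: scalar_op_of_real)
  define S where "S = (\<lambda>u. u * x * adj u) ` unitaries A"
  define C where "C = convex hull S"
  \<comment> \<open>A convex set that records what all averages of \<open>x\<close> share: the norm
    bound and the values of the two functionals to be compared.\<close>
  define P where "P = {y \<in> A. norm y \<le> norm x \<and> cinner (app y \<Omega>) \<Omega> = cinner (app x \<Omega>) \<Omega> \<and> \<phi> y = \<phi> x}"
  have "S \<subseteq> P"
  proof
    fix y assume "y \<in> S"
    then obtain u where u: "u \<in> A" "adj u * u = 1" "u * adj u = 1" "y = u * x * adj u"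
      by (auto simp: S_def unitaries_def)
    have uA: "u * x \<in> A" "adj u \<in> A" using u x by (auto intro: A.alg_closed)
    have r: "adj u * (u * x) = x" using u(2) by (metis mult.assoc mult_1_left)
    have "norm y \<le> norm u * norm x * norm (adj u)"
      unfolding u(4) by (meson mult_right_mono norm_ge_zero norm_mult_ineq order_trans)
    also have "\<dots> = norm x" using norm_unitary[OF u(2)] norm_unitary[of "adj u"] u(3) by simp
    finally have "norm y \<le> norm x" .
    moreover have "cinner (app y \<Omega>) \<Omega> = cinner (app x \<Omega>) \<Omega>"
      using tr_comm[OF AM AM, OF uA] by (simp only: u(4) r)
    moreover have "\<phi> y = \<phi> x" using tr[OF uA] by (simp only: u(4) r)
    ultimately show "y \<in> P" using u uA by (simp add: P_def A.times_closed)
  qed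
  moreover have "convex P"
  proof (rule convexI)
    fix y z :: "'a bop" and u v :: real
    assume yz: "y \<in> P" "z \<in> P" and uv: "0 \<le> u" "0 \<le> v" "u + v = 1"
    have one: "of_real u + of_real v = (1::complex)" using uv(3) by (metis of_real_1 of_real_add)
    have "norm (u *\<^sub>R y + v *\<^sub>R z) \<le> u * norm y + v * norm z"
      using norm_triangle_ineq[of "u *\<^sub>R y" "v *\<^sub>R z"] uv by simp
    also have "\<dots> \<le> u * norm x + v * norm x" using yz uv by (intro add_mono mult_left_mono) (auto simp: P_def)
    also have "\<dots> = norm x" by (simp add: uv(3) flip: distrib_right)
    finally have "norm (u *\<^sub>R y + v *\<^sub>R z) \<le> norm x" .
    then show "u *\<^sub>R y + v *\<^sub>R z \<in> P"
      using yz by (simp add: P_def A.alg_closed add scR app_plus app_scaleR cinner_add_left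
          cinner_scaleR_left one flip: distrib_right)
  qed
  ultimately have CP: "C \<subseteq> P" unfolding C_def by (rule hull_minimal)
  define K where "K = closure ((\<lambda>c. app c \<Omega>) ` C)"
  have "linear (\<lambda>c. app c \<Omega>)"
    using bounded_bilinear.bounded_linear_left[OF bounded_bilinear_app] bounded_linear.linear by blast
  then have cv: "convex K"
    unfolding K_def C_def by (intro convex_closure convex_linear_image convex_convex_hull)
  have "1 * x * adj 1 \<in> C"
    unfolding C_def S_def by (intro hull_inc imageI) (simp add: unitaries_def A.one_closed)
  then have "K \<noteq> {}" unfolding K_def by auto
  with cv have ex1: "\<exists>!k. k \<in> K \<and> (\<forall>y\<in>K. norm k \<le> norm y)"
    by (intro min_norm_point) (simp_all add: K_def)
  define k where "k = (THE k. k \<in> K \<and> (\<forall>y\<in>K. norm k \<le> norm y))"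
  have k: "k \<in> K" "\<And>y. y \<in> K \<Longrightarrow> norm k \<le> norm y"
    using theI'[OF ex1] by (auto simp: k_def)
  have kuniq: "k' = k" if "k' \<in> K" "norm k' = norm k" for k'
    using the1_equality[OF ex1, of k'] that k(2) by (simp add: k_def)
  obtain f where f: "\<And>n. f n \<in> (\<lambda>c. app c \<Omega>) ` C" "f \<longlonglongrightarrow> k"
    using k(1) unfolding K_def closure_sequential by blast
  have "\<exists>X. \<forall>n. X n \<in> C \<and> f n = app (X n) \<Omega>"
    by (rule choice) (use f(1) in \<open>blast\<close>)
  then obtain X where X: "\<And>n. X n \<in> C" "f = (\<lambda>n. app (X n) \<Omega>)" by blast
  have XP: "X n \<in> P" for n using X(1) CP by blast
  have Xk: "(\<lambda>n. app (X n) \<Omega>) \<longlonglongrightarrow> k" using f(2) by (simp only: X(2))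
  have XA: "X n \<in> A" and Xn: "norm (X n) \<le> norm x" for n using XP[of n] by (simp_all add: P_def)
  obtain y where y: "y \<in> A" "app y \<Omega> = k" "\<And>v. (\<lambda>n. app (X n) v) \<longlonglongrightarrow> app y v"
    using L2_limit[OF A.vN A(2) XA Xn Xk] by blast
  have inv: "v * y = y * v" if v: "v \<in> unitaries A" for v
  proof -
    have vA: "v \<in> A" and vv: "adj v * v = 1" "v * adj v = 1" using v by (auto simp: unitaries_def)
    \<comment> \<open>On vectors, conjugation by \<open>v\<close> is the isometry given by
      \<open>v\<close> times \<open>conjJ v\<close>. It maps \<open>K\<close> into itself, hence
      fixes the unique vector of least norm.\<close>
    define T where "T w = app v (app (conjJ v) w)" for w
    have Tapp: "T (app c \<Omega>) = app (v * c * adj v) \<Omega>" if "c \<in> A" for c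
      using conjJ_app[OF AM[OF vA] AM[OF that]] by (simp add: T_def del: app_conjJ)
    have "S \<subseteq> {c. v * c * adj v \<in> C}"
    proof
      fix c assume "c \<in> S"
      then obtain u where u: "u \<in> unitaries A" "c = u * x * adj u" by (auto simp: S_def)
      have "v * c * adj v = (v * u) * x * adj (v * u)" by (simp add: u(2) mult.assoc)
      also have "\<dots> \<in> C" unfolding C_def S_def by (intro hull_inc imageI A.unitaries_closed v u)
      finally show "c \<in> {c. v * c * adj v \<in> C}" by simp
    qed
    moreover have "convex {c. v * c * adj v \<in> C}"
    proof -
      have "convex ((\<lambda>c. v * c * adj v) -` C)"
        by (intro convex_linear_vimage linearI) (simp_all add: C_def distrib_left distrib_right)
      then show ?thesis by (simp add: vimage_def)
    qed
    ultimately have Cinv: "C \<subseteq> {c. v * c * adj v \<in> C}" unfolding C_def by (rule hull_minimal)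
    have "T ` K \<subseteq> K" unfolding K_def
    proof (rule image_closure_subset)
      show "continuous_on (closure ((\<lambda>c. app c \<Omega>) ` C)) T"
      proof -
        have "T = app (v * conjJ v)" by (rule ext) (simp add: T_def)
        then show ?thesis by (simp only: continuous_on_app)
      qed
      show "T ` (\<lambda>c. app c \<Omega>) ` C \<subseteq> closure ((\<lambda>c. app c \<Omega>) ` C)"
      proof clarify
        fix c assume c: "c \<in> C"
        have "c \<in> A" using c CP by (auto simp: P_def)
        moreover have "v * c * adj v \<in> C" using Cinv c by blast
        ultimately have "T (app c \<Omega>) \<in> (\<lambda>c. app c \<Omega>) ` C" by (simp only: Tapp image_eqI)
        then show "T (app c \<Omega>) \<in> closure ((\<lambda>c. app c \<Omega>) ` C)" by (rule subsetD[OF closure_subset])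
      qed
    qed simp
    then have "T k \<in> K" using k(1) by blast
    moreover have "norm (T k) = norm k"
    proof -
      have "norm (T k) = norm (J (app v (J k)))" unfolding T_def by (simp add: unitary_isometry[OF vv(1)])
      then show ?thesis by (simp add: norm_J unitary_isometry[OF vv(1)])
    qed
    ultimately have "T k = k" using kuniq by simp
    then have "app (v * y * adj v) \<Omega> = app y \<Omega>" using Tapp[OF y(1)] y(2) by argo
    then have "v * y * adj v = y"
      using separating_eq[of "v * y * adj v" y] AM[OF vA] AM[OF y(1)] by (simp add: alg_closed)
    then have "v * y * adj v * v = y * v" by (rule arg_cong)
    then have "v * y * (adj v * v) = y * v" by (simp only: mult.assoc)
    then show ?thesis by (simp add: vv)
  qed
  have "y \<in> commutant A" using A.commute_unitaries_imp[OF inv] by (auto intro!: commutantI)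
  then have "y \<in> range scalar_op" using y(1) A(1) by (auto simp: factor_def)
  then obtain c where c: "y = scalar_op c" by blast
  have "(\<lambda>n. cinner (app (X n) \<Omega>) \<Omega>) \<longlonglongrightarrow> cinner (app y \<Omega>) \<Omega>"
    by (intro tendsto_cinner y(3) tendsto_const)
  moreover have "cinner (app (X n) \<Omega>) \<Omega> = cinner (app x \<Omega>) \<Omega>" for n using XP[of n] by (simp add: P_def)
  ultimately have "cinner (app y \<Omega>) \<Omega> = cinner (app x \<Omega>) \<Omega>"
    by (simp only: LIMSEQ_const_iff)
  then have cx: "c = cinner (app x \<Omega>) \<Omega>" by (simp add: c cinner_scaleC_left tr_one)
  obtain \<xi> \<eta> where u: "summable (\<lambda>n. (norm (\<xi> n))\<^sup>2)" "summable (\<lambda>n. (norm (\<eta> n))\<^sup>2)"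
    and u': "\<And>x. x \<in> A \<Longrightarrow> \<phi> x = (\<Sum>n. cinner (app x (\<xi> n)) (\<eta> n))"
    using uw unfolding ultraweakly_continuous_on_def by blast
  \<comment> \<open>Ultraweak continuity enters here: \<open>X\<close> converges to \<open>y\<close>
    only strongly, but with bounded norms.\<close>
  have "(\<lambda>k. \<phi> (X k)) \<longlonglongrightarrow> \<phi> y"
    using uw_strong_limit[OF u Xn y(3)] u'[OF XA] u'[OF y(1)] by simp
  moreover have "\<phi> (X n) = \<phi> x" for n using XP[of n] by (simp add: P_def)
  ultimately have "\<phi> y = \<phi> x" by (simp only: LIMSEQ_const_iff)
  moreover have "\<phi> y = c * \<phi> 1" using sc[OF A.one_closed, of c] by (simp add: c)
  ultimately show ?thesis using cx by simp
qed

end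

section \<open>Inequalities for a faithful trace\<close>

locale traced_vn = vn_algebra A for A :: "'a::complex_hilbert bop set" +
  fixes \<tau> :: "'a bop \<Rightarrow> complex"
  assumes trace: "normalized_trace A \<tau>"
begin

lemmas tr_facts = trace[unfolded normalized_trace_def]

lemma tr_plus: "x \<in> A \<Longrightarrow> y \<in> A \<Longrightarrow> \<tau> (x + y) = \<tau> x + \<tau> y"
  using tr_facts[THEN conjunct1] by blast

lemma tr_scalar: "x \<in> A \<Longrightarrow> \<tau> (scalar_op c * x) = c * \<tau> x"
  using tr_facts[THEN conjunct2, THEN conjunct1] by blast

lemma tr_Im: "x \<in> A \<Longrightarrow> Im (\<tau> (adj x * x)) = 0"
  and tr_nonneg: "x \<in> A \<Longrightarrow> 0 \<le> Re (\<tau> (adj x * x))"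
  using tr_facts[THEN conjunct2, THEN conjunct2, THEN conjunct1] by blast+

lemma tr_faithful: "x \<in> A \<Longrightarrow> \<tau> (adj x * x) = 0 \<Longrightarrow> x = 0"
  using tr_facts[THEN conjunct2, THEN conjunct2, THEN conjunct2, THEN conjunct1] by blast

lemma tr_commute: "x \<in> A \<Longrightarrow> y \<in> A \<Longrightarrow> \<tau> (x * y) = \<tau> (y * x)"
  using tr_facts[THEN conjunct2, THEN conjunct2, THEN conjunct2, THEN conjunct2, THEN conjunct1] by blast

lemma tr_1: "\<tau> 1 = 1" and tr_uw: "ultraweakly_continuous_on A \<tau>"
  using tr_facts by simp_all

lemma tr_scaleR: "x \<in> A \<Longrightarrow> \<tau> (r *\<^sub>R x) = of_real r * \<tau> x"
  using tr_scalar[of x "of_real r"] by (simp add: scalar_op_of_real)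

lemma tr_uminus: "x \<in> A \<Longrightarrow> \<tau> (- x) = - \<tau> x"
  using tr_scaleR[of x "-1"] by simp

lemma tr_minus: "x \<in> A \<Longrightarrow> y \<in> A \<Longrightarrow> \<tau> (x - y) = \<tau> x - \<tau> y"
  using tr_plus[of x "-y"] tr_uminus[of y] by (simp add: uminus_closed)

lemma tr_zero: "\<tau> 0 = 0" using tr_scaleR[OF one_closed, of 0] by simp

text \<open>Hermitian symmetry is not among the axioms of \<open>normalized_trace\<close>. It comes
  by polarization from reality of \<tau> at \<open>adj a * a\<close>, where \<open>a\<close> is
  \<open>x\<close> plus \<i> times \<open>y\<close>.\<close>

lemma Re_tr_sym: assumes "x \<in> A" "y \<in> A" shows "Re (\<tau> (adj y * x)) = Re (\<tau> (adj x * y))"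
proof -
  define z where "z = scalar_op \<i> * y"
  have z: "z \<in> A" using assms by (simp add: z_def alg_closed)
  have yx: "\<tau> (adj x * z) = \<i> * \<tau> (adj x * y)"
  proof -
    have "adj x * z = scalar_op \<i> * (adj x * y)"
      unfolding z_def by (metis mult.assoc scalar_op_commute)
    then show ?thesis using assms by (simp add: tr_scalar alg_closed)
  qed
  have xy: "\<tau> (adj z * x) = - \<i> * \<tau> (adj y * x)"
  proof -
    have "adj z * x = scalar_op (- \<i>) * (adj y * x)"
      by (simp add: z_def mult.assoc[symmetric] scalar_op_commute)
    then show ?thesis using assms by (simp only: tr_scalar alg_closed)
  qed
  have "adj (x + z) * (x + z) = (adj x * x + adj z * z) + (adj x * z + adj z * x)"
    by (simp add: algebra_simps)
  then have "\<tau> (adj (x + z) * (x + z)) = (\<tau> (adj x * x) + \<tau> (adj z * z)) + (\<tau> (adj x * z) + \<tau> (adj z * x))"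
    using assms z by (simp only: tr_plus alg_closed)
  then have "Im (\<tau> (adj x * z) + \<tau> (adj z * x)) = 0"
    using tr_Im[of "x + z"] tr_Im[OF z] tr_Im[OF assms(1)] assms z by (simp add: plus_closed)
  then show ?thesis by (simp add: yx xy)
qed

lemma tr_CS:
  assumes "x \<in> A" "y \<in> A"
  shows "(Re (\<tau> (adj y * x)))\<^sup>2 \<le> Re (\<tau> (adj y * y)) * Re (\<tau> (adj x * x))"
proof -
  define a b c where "a = Re (\<tau> (adj y * y))" and "b = Re (\<tau> (adj y * x))" and "c = Re (\<tau> (adj x * x))"
  have q: "0 \<le> c + 2 * r * b + r\<^sup>2 * a" for r
  proof -
    have "adj (x + r *\<^sub>R y) * (x + r *\<^sub>R y)
      = (adj x * x + r *\<^sub>R (adj x * y)) + (r *\<^sub>R (adj y * x) + (r * r) *\<^sub>R (adj y * y))"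
      by (simp add: algebra_simps)
    then have "\<tau> (adj (x + r *\<^sub>R y) * (x + r *\<^sub>R y))
      = (\<tau> (adj x * x) + r * \<tau> (adj x * y)) + (r * \<tau> (adj y * x) + (r * r) * \<tau> (adj y * y))"
      using assms by (simp only: tr_plus tr_scaleR alg_closed of_real_mult)
    then show ?thesis using tr_nonneg[of "x + r *\<^sub>R y"] assms Re_tr_sym[OF assms]
      by (simp add: a_def b_def c_def plus_closed scaleR_closed power2_eq_square)
  qed
  have a0: "0 \<le> a" using tr_nonneg[OF assms(2)] by (simp add: a_def)
  have "b\<^sup>2 \<le> a * c"
  proof (cases "a = 0")
    case True
    have "b = 0"
    proof (rule ccontr)
      assume "b \<noteq> 0"
      \<comment> \<open>With \<open>a = 0\<close> the quadratic is affine in \<open>r\<close>, and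
        this value of \<open>r\<close> gives it the value -1.\<close>
      then have "2 * (- (c + 1) / (2 * b)) * b = - (c + 1)" by simp
      then show False using q[of "- (c + 1) / (2 * b)"] unfolding True by linarith
    qed
    then show ?thesis by (simp add: True)
  next
    case False
    then show ?thesis using q[of "- b / a"] a0 by (simp add: field_simps power2_eq_square)
  qed
  then show ?thesis by (simp add: a_def b_def c_def)
qed

text \<open>Only the values of \<open>\<tau>\<close> on \<open>A\<close> are controlled; off \<open>A\<close> a bounded linear extension is needed to differentiate.\<close>

definition "uw_ext = (SOME T. bounded_linear T \<and> (\<forall>x\<in>A. T x = \<tau> x))"

lemma bounded_linear_uw_ext: "bounded_linear uw_ext" and uw_ext: "x \<in> A \<Longrightarrow> uw_ext x = \<tau> x"
proof -
  obtain \<xi> \<eta> where u: "summable (\<lambda>n. (norm (\<xi> n))\<^sup>2)" "summable (\<lambda>n. (norm (\<eta> n))\<^sup>2)"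
    and u': "\<And>x. x \<in> A \<Longrightarrow> \<tau> x = (\<Sum>n. cinner (app x (\<xi> n)) (\<eta> n))"
    using tr_uw unfolding ultraweakly_continuous_on_def by blast
  have "\<exists>T. bounded_linear T \<and> (\<forall>x\<in>A. T x = \<tau> x)"
    by (rule exI[of _ "\<lambda>x. \<Sum>n. cinner (app x (\<xi> n)) (\<eta> n)"]) (simp add: bounded_linear_uw[OF u] u')
  from someI_ex[OF this] have "bounded_linear uw_ext \<and> (\<forall>x\<in>A. uw_ext x = \<tau> x)"
    unfolding uw_ext_def .
  then show "bounded_linear uw_ext" "x \<in> A \<Longrightarrow> uw_ext x = \<tau> x" by simp_all
qed

text \<open>The operator inequality between \<open>adj y * y\<close> and its norm, read under the
  trace. \<open>power_domination\<close> applies to the moments of \<open>D = adj y * y\<close> in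
  the state of \<open>a\<close>.\<close>

lemma tr_bound:
  assumes "a \<in> A" "y \<in> A"
  shows "Re (\<tau> (adj (y * a) * (y * a))) \<le> Re (\<tau> (adj a * a)) * norm (adj y * y)"
proof -
  define D where "D = adj y * y"
  define s where "s k = Re (\<tau> (adj a * (D ^ k * a)))" for k
  have D: "D \<in> A" "adj D = D" using assms by (simp_all add: D_def alg_closed)
  obtain K where K: "0 \<le> K" "\<And>x. cmod (uw_ext x) \<le> norm x * K"
    using bounded_linear.nonneg_bounded[OF bounded_linear_uw_ext] by blast
  have "s 1 \<le> s 0 * norm D"
  proof (rule power_domination)
    show "0 \<le> s 0" using tr_nonneg[OF assms(1)] by (simp add: s_def)
    show "0 \<le> s 1" using tr_nonneg[OF times_closed[OF assms(2,1)]] by (simp add: s_def D_def mult.assoc)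
    fix k
    have "D ^ (2 * k) = adj (D ^ k) * D ^ k" by (simp add: D(2) mult_2 power_add)
    then have "s (2 * k) = Re (\<tau> (adj (D ^ k * a) * (D ^ k * a)))"
      by (simp add: s_def mult.assoc)
    then show "(s k)\<^sup>2 \<le> s 0 * s (2 * k)"
      using tr_CS[of "D ^ k * a" a] assms D by (simp add: s_def alg_closed)
    have "s k \<le> cmod (\<tau> (adj a * (D ^ k * a)))" unfolding s_def by (rule complex_Re_le_cmod)
    also have "\<dots> \<le> norm (adj a * (D ^ k * a)) * K"
      using K(2)[of "adj a * (D ^ k * a)"] assms D by (simp add: uw_ext alg_closed)
    also have "\<dots> \<le> (norm (adj a) * (norm D ^ k * norm a)) * K"
      by (intro mult_right_mono K order_trans[OF norm_mult_ineq] mult_mono norm_power_ineq) auto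
    finally show "s k \<le> (norm (adj a) * norm a * K) * norm D ^ k" by (simp add: mult_ac)
  qed simp
  then show ?thesis by (simp add: s_def D_def mult.assoc)
qed

lemma norm2_sq: "x \<in> A \<Longrightarrow> (norm2 \<tau> x)\<^sup>2 = Re (\<tau> (adj x * x))"
  by (simp add: norm2_def tr_nonneg)

lemma norm2_zero: assumes "x \<in> A" "norm2 \<tau> x = 0" shows "x = 0"
proof (rule tr_faithful[OF assms(1)])
  have "Re (\<tau> (adj x * x)) = 0" using norm2_sq[OF assms(1)] assms(2) by simp
  then show "\<tau> (adj x * x) = 0" using tr_Im[OF assms(1)] by (simp add: complex_eq_iff)
qed

end

section \<open>The conditional expectation\<close>

lemma subspace_closure:
  fixes S :: "'a::real_normed_vector set"
  assumes S: "subspace S" shows "subspace (closure S)"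
  unfolding subspace_def
proof (intro conjI ballI allI)
  show "0 \<in> closure S" using subspace_0[OF S] closure_subset by blast
  fix x assume "x \<in> closure S"
  then obtain f where f: "\<And>n. f n \<in> S" "f \<longlonglongrightarrow> x" unfolding closure_sequential by blast
  show "c *\<^sub>R x \<in> closure S" for c
    unfolding closure_sequential
    by (intro exI[of _ "\<lambda>n. c *\<^sub>R f n"] conjI allI subspace_scale[OF S] f tendsto_scaleR tendsto_const)
  fix y assume "y \<in> closure S"
  then obtain g where g: "\<And>n. g n \<in> S" "g \<longlonglongrightarrow> y" unfolding closure_sequential by blast
  show "x + y \<in> closure S"
    unfolding closure_sequential
    by (intro exI[of _ "\<lambda>n. f n + g n"] conjI allI subspace_add[OF S] f g tendsto_add)
qed

locale subfactor = standard_vn M \<Omega> for M :: "'a::complex_hilbert bop set" and \<Omega> +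
  fixes N :: "'a bop set" and t :: "'a bop \<Rightarrow> complex"
  assumes factor_M: "factor M" and factor_N: "factor N" and N_subset: "N \<subseteq> M"
    and commutant_trace: "normalized_trace (commutant N) t"
begin

sublocale N: vn_algebra N
  using factor_N by unfold_locales (simp add: factor_def)

sublocale N': vn_algebra "commutant N"
  by unfold_locales (rule vN_commutant, rule N.adj_closed)

lemma NM: "n \<in> N \<Longrightarrow> n \<in> M" using N_subset by blast

section \<open>The Jones projection and its commutation relations\<close>

definition "L = closure ((\<lambda>x. app x \<Omega>) ` N)"

definition "p = jones_projection N \<Omega>"

lemma p_facts: "p * p = p" "adj p = p" "range (app p) = L"
proof -
  have sub: "subspace ((\<lambda>x. app x \<Omega>) ` N)"
    using bounded_bilinear.bounded_linear_left[OF bounded_bilinear_app, of \<Omega>] bounded_linear.linear N.subspace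
    by (intro linear_subspace_image) auto
  have cl: "closed L" by (simp add: L_def)
  have subL: "subspace L" unfolding L_def by (rule subspace_closure[OF sub])
  have scL: "c *\<^sub>C v \<in> L" if "v \<in> L" for c v
  proof -
    have "(\<lambda>v. c *\<^sub>C v) ` closure ((\<lambda>x. app x \<Omega>) ` N) \<subseteq> closure ((\<lambda>x. app x \<Omega>) ` N)"
    proof (rule image_closure_subset)
      show "continuous_on (closure ((\<lambda>x. app x \<Omega>) ` N)) ((*\<^sub>C) c)"
        by (rule linear_continuous_on[OF bounded_linear_scaleC])
      have "c *\<^sub>C app x \<Omega> \<in> (\<lambda>x. app x \<Omega>) ` N" if "x \<in> N" for x
        using that by (intro image_eqI[of _ _ "scalar_op c * x"]) (simp_all add: N.alg_closed)
      then show "(*\<^sub>C) c ` (\<lambda>x. app x \<Omega>) ` N \<subseteq> closure ((\<lambda>x. app x \<Omega>) ` N)"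
        using closure_subset by fastforce
    qed simp
    then show ?thesis using that by (auto simp: L_def)
  qed
  show "p * p = p" "adj p = p" "range (app p) = L"
    unfolding p_def jones_projection_def L_def[symmetric] by (rule proj_onto[OF cl subL scL]; assumption)+
qed

lemma p_idem: "app p (app p v) = app p v"
  using p_facts(1) app_times[of p p v] by simp

lemma p_range: "app p v \<in> L" using p_facts(3) by blast

lemma p_fix: "v \<in> L \<Longrightarrow> app p v = v"
proof -
  assume "v \<in> L"
  then obtain w where "v = app p w" using p_facts(3) by blast
  then show ?thesis by (simp add: p_idem)
qed

lemma N_in_L: "n \<in> N \<Longrightarrow> app n \<Omega> \<in> L"
  unfolding L_def by (intro subsetD[OF closure_subset] imageI)

lemma p_N_Omega: "n \<in> N \<Longrightarrow> app p (app n \<Omega>) = app n \<Omega>"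
  by (intro p_fix N_in_L)

lemma p_Omega: "app p \<Omega> = \<Omega>"
  using p_N_Omega[OF N.one_closed] by simp

lemma L_invariant:
  assumes "continuous_on UNIV f" "\<And>n. n \<in> N \<Longrightarrow> f (app n \<Omega>) \<in> L" "v \<in> L" shows "f v \<in> L"
proof -
  have "f ` closure ((\<lambda>x. app x \<Omega>) ` N) \<subseteq> L"
  proof (rule image_closure_subset)
    show "continuous_on (closure ((\<lambda>x. app x \<Omega>) ` N)) f" using assms(1) continuous_on_subset by blast
    show "closed L" by (simp add: L_def)
    show "f ` (\<lambda>x. app x \<Omega>) ` N \<subseteq> L" using assms(2) by blast
  qed
  then show ?thesis using assms(3) by (auto simp: L_def)
qed

lemma L_ext:
  assumes "continuous_on UNIV f" "continuous_on UNIV g" "\<And>n. n \<in> N \<Longrightarrow> f (app n \<Omega>) = (g (app n \<Omega>) :: 'a)" "v \<in> L"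
  shows "f v = g v"
proof -
  have "L \<subseteq> {v. f v = g v}" unfolding L_def
    by (rule closure_minimal) (use assms(1-3) in \<open>auto intro: closed_Collect_eq\<close>)
  then show ?thesis using assms(4) by blast
qed

lemma N_L: assumes "n \<in> N" "v \<in> L" shows "app n v \<in> L"
proof (rule L_invariant[OF continuous_on_app _ assms(2)])
  fix m assume "m \<in> N"
  then show "app n (app m \<Omega>) \<in> L" using N_in_L[OF N.times_closed[OF assms(1)], of m] by simp
qed

text \<open>\<open>N\<close> leaves \<open>L\<close> invariant, so
  \<open>p * (m * p) = m * p\<close> for every \<open>m\<close> in \<open>N\<close>; the adjoint of
  this identity for \<open>adj n\<close> supplies the other half.\<close>

lemma p_N: assumes "n \<in> N" shows "p * n = n * p"
proof -
  have *: "p * (m * p) = m * p" if "m \<in> N" for m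
    by (rule bop_eqI) (simp add: p_fix N_L that p_range)
  have "adj (p * (adj n * p)) = adj (adj n * p)" using *[OF N.adj_closed[OF assms]] by simp
  then have "p * n * p = p * n" by (simp add: p_facts mult.assoc)
  then show ?thesis using *[OF assms] by (simp add: mult.assoc)
qed

lemma p_commutant: "p \<in> commutant N" by (rule commutantI) (rule p_N)

lemma J_L: "v \<in> L \<Longrightarrow> J v \<in> L"
  by (rule L_invariant[OF continuous_on_J]) (simp_all add: J_app NM N_in_L N.adj_closed)

text \<open>\<open>J\<close> leaves \<open>L\<close> invariant, whence
  \<open>p * conjJ p = conjJ p\<close>. Conjugating this identity by \<open>J\<close> and taking its
  adjoint gives two values of \<open>conjJ p * p\<close>.\<close>

lemma conjJ_p: "conjJ p = p"
proof -
  have 1: "p * conjJ p = conjJ p" by (rule bop_eqI) (simp add: p_fix J_L p_range)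
  have "conjJ (p * conjJ p) = conjJ (conjJ p)" by (simp only: 1)
  then have 2: "conjJ p * p = p" by (simp add: conjJ_times)
  have "adj (p * conjJ p) = adj (conjJ p)" by (simp only: 1)
  then have "conjJ p * p = conjJ p" by (simp add: conjJ_adj p_facts)
  with 2 show ?thesis by simp
qed

lemma commutant_M_subset: "commutant M \<subseteq> commutant N" by (rule commutant_antimono[OF N_subset])

lemma conjJ_in_N': "x \<in> M \<Longrightarrow> conjJ x \<in> commutant N"
  using conjJ_commutant commutant_M_subset by blast

text \<open>
  \<open>P\<close> is \<open>pN'p\<close>, which plays the role of the commutant of \<open>N\<close> on \<open>L\<^sup>2(N)\<close>. The vector \<open>\<Omega>\<close> is a trace
  vector for it with the same involution \<open>J\<close>, so \<open>JPJ\<close> commutes with \<open>P\<close>.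
\<close>

definition "P = {B \<in> commutant N. p * B * p = B}"

lemma P_N': "B \<in> P \<Longrightarrow> B \<in> commutant N" by (simp add: P_def)

lemma P_left: "B \<in> P \<Longrightarrow> p * B = B"
proof -
  assume "B \<in> P"
  then have B: "p * B * p = B" by (simp add: P_def)
  have "p * B = p * (p * B * p)" by (simp only: B)
  also have "\<dots> = p * B * p" by (simp only: mult.assoc[symmetric] p_facts)
  finally show ?thesis by (simp only: B)
qed

lemma P_right: "B \<in> P \<Longrightarrow> B * p = B"
proof -
  assume "B \<in> P"
  then have B: "p * B * p = B" by (simp add: P_def)
  have "B * p = p * B * p * p" by (simp only: B)
  also have "\<dots> = p * B * p" by (simp only: mult.assoc p_facts)
  finally show ?thesis by (simp only: B)
qed

lemma P_I: "a \<in> commutant N \<Longrightarrow> p * a * p \<in> P"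
proof -
  assume a: "a \<in> commutant N"
  have "p * (p * a * p) * p = p * p * a * (p * p)" by (simp only: mult.assoc)
  also have "\<dots> = p * a * p" by (simp only: p_facts)
  finally show ?thesis using a p_commutant by (simp add: P_def N'.times_closed)
qed

lemma P_adj: "B \<in> P \<Longrightarrow> adj B \<in> P"
proof -
  assume B: "B \<in> P"
  then have "adj (p * B * p) = adj B" by (simp add: P_def)
  then show ?thesis using P_N'[OF B] by (simp add: P_def N'.adj_closed p_facts mult.assoc)
qed

lemma P_times: assumes "A \<in> P" "B \<in> P" shows "A * B \<in> P"
proof -
  have "p * (A * B) * p = p * A * (B * p)" by (simp only: mult.assoc)
  also have "\<dots> = A * B" by (simp only: P_left[OF assms(1)] P_right[OF assms(2)])
  finally show ?thesis using assms by (simp add: P_def N'.times_closed)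
qed

lemma P_Omega_L: "B \<in> P \<Longrightarrow> app B v \<in> L"
  using P_left[of B] p_range[of "app B v"] app_times[of p B v] by simp

text \<open>Both vectors lie in \<open>L\<close>. Tested against \<open>app n \<Omega>\<close> with
  \<open>n\<close> in \<open>N\<close>, they agree because \<open>adj B\<close> commutes with
  \<open>adj n\<close>, so their difference is orthogonal to \<open>L\<close>.\<close>

lemma J_P: assumes B: "B \<in> P" shows "J (app B \<Omega>) = app (adj B) \<Omega>"
proof -
  define w where "w = J (app B \<Omega>) - app (adj B) \<Omega>"
  have n: "cinner w (app n \<Omega>) = 0" if n: "n \<in> N" for n
  proof -
    have com: "adj B * adj n = adj n * adj B"
      using commutantD[OF P_N'[OF P_adj[OF B]] N.adj_closed[OF n]] .
    have "cinner (J (app B \<Omega>)) (app n \<Omega>) = cinner (J (app n \<Omega>)) (app B \<Omega>)" by (rule cinner_J_left)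
    also have "\<dots> = cinner (app (adj n) \<Omega>) (app B \<Omega>)" by (simp only: J_app[OF NM[OF n]])
    also have "\<dots> = cinner (app (adj B * adj n) \<Omega>) \<Omega>" by (simp add: cinner_app_adj)
    also have "\<dots> = cinner (app (adj n * adj B) \<Omega>) \<Omega>" by (simp only: com)
    also have "\<dots> = cinner (app (adj B) \<Omega>) (app n \<Omega>)" by (simp add: cinner_app_adj)
    finally show ?thesis by (simp add: w_def cinner_diff_left)
  qed
  have w: "app p w = w"
    using J_L[OF P_Omega_L[OF B], of \<Omega>] P_Omega_L[OF P_adj[OF B], of \<Omega>]
    by (simp add: w_def app_diff p_fix)
  have "L \<subseteq> {v. cinner w v = 0}" unfolding L_def
  proof (rule closure_minimal)
    show "closed {v. cinner w v = 0}"
      by (intro closed_Collect_eq linear_continuous_on continuous_on_const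
          bounded_bilinear.bounded_linear_right[OF bounded_bilinear_cinner])
  qed (use n in auto)
  moreover have "w \<in> L" using p_range[of w] w by simp
  ultimately have "cinner w w = 0" by blast
  then show ?thesis by (simp add: cinner_self w_def)
qed

text \<open>On vectors \<open>app R \<Omega>\<close> with \<open>R\<close> in \<open>P\<close> this
  is the commutation of left and right multiplication, computed by \<open>J_P\<close>. Such vectors
  are dense in \<open>L\<close>: compressing the right multiplication by \<open>n\<close> with
  \<open>p\<close> produces \<open>app n \<Omega>\<close>.\<close>

lemma P_conjJ_commute:
  assumes A: "A \<in> P" and T: "T \<in> P" shows "conjJ T * A = A * conjJ T"
proof -
  have R: "app (conjJ T * A) (app R \<Omega>) = app (A * conjJ T) (app R \<Omega>)" if R: "R \<in> P" for R
  proof -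
    have "app (conjJ T * A) (app R \<Omega>) = J (app T (J (app (A * R) \<Omega>)))" by simp
    also have "\<dots> = J (app (T * (adj R * adj A)) \<Omega>)" by (subst J_P[OF P_times[OF A R]]) simp
    also have "\<dots> = app (adj (T * (adj R * adj A))) \<Omega>" by (intro J_P P_times T P_adj A R)
    also have "\<dots> = app A (app (adj (T * adj R)) \<Omega>)" by simp
    also have "\<dots> = app A (J (app (T * adj R) \<Omega>))" by (simp only: J_P[OF P_times[OF T P_adj[OF R]]])
    also have "\<dots> = app A (J (app T (J (app R \<Omega>))))" by (simp only: J_P[OF R] app_times)
    finally show ?thesis by simp
  qed
  have N: "app (conjJ T * A) (app n \<Omega>) = app (A * conjJ T) (app n \<Omega>)" if n: "n \<in> N" for n
  proof -
    have "app (p * conjJ (adj n) * p) \<Omega> = app p (app (conjJ (adj n)) \<Omega>)"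
      by (simp only: app_times p_Omega)
    also have "\<dots> = app n \<Omega>"
      using conjJ_Omega[OF NM[OF N.adj_closed[OF n]]] p_N_Omega[OF n] by (simp del: app_conjJ)
    finally have "app (p * conjJ (adj n) * p) \<Omega> = app n \<Omega>" .
    then show ?thesis
      using R[OF P_I[OF conjJ_in_N'[OF NM[OF N.adj_closed[OF n]]]]] by (simp only:)
  qed
  have L: "app (conjJ T * A) v = app (A * conjJ T) v" if "v \<in> L" for v
    by (rule L_ext[OF continuous_on_app continuous_on_app N that])
  have Tp: "conjJ T * p = conjJ T"
  proof -
    have "conjJ (T * p) = conjJ T" by (simp only: P_right[OF T])
    then show ?thesis by (simp only: conjJ_times conjJ_p)
  qed
  show ?thesis
  proof (rule bop_eqI)
    fix v
    have "app (conjJ T * A) v = app (conjJ T * (A * p)) v" by (simp only: P_right[OF A])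
    also have "\<dots> = app (conjJ T * A) (app p v)" by (simp only: app_times)
    also have "\<dots> = app (A * conjJ T) (app p v)" by (rule L[OF p_range])
    also have "\<dots> = app (A * (conjJ T * p)) v" by (simp only: app_times)
    finally show "app (conjJ T * A) v = app (A * conjJ T) v" by (simp only: Tp)
  qed
qed

text \<open>\<open>conjJ x\<close> lies in \<open>commutant N\<close>, so \<open>p * x * p\<close>
  is \<open>conjJ\<close> of an element of \<open>P\<close>.\<close>

lemma compression_commute:
  assumes "A \<in> P" "x \<in> M" shows "(p * x * p) * A = A * (p * x * p)"
proof -
  have "conjJ (p * conjJ x * p) = p * x * p" by (simp add: conjJ_times conjJ_p)
  then show ?thesis using P_conjJ_commute[OF assms(1) P_I[OF conjJ_in_N'[OF assms(2)]]] by (simp only:)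
qed

lemma commute_power: "D * A = A * D \<Longrightarrow> D ^ k * A = A * (D::'a bop) ^ k"
proof (induction k)
  case (Suc k)
  have "D ^ Suc k * A = D * (D ^ k * A)" by (simp only: power_Suc mult.assoc)
  also have "\<dots> = D * A * D ^ k" by (simp only: Suc.IH[OF Suc.prems] mult.assoc)
  also have "\<dots> = A * D ^ Suc k" by (simp only: Suc.prems power_Suc mult.assoc)
  finally show ?case .
qed simp

text \<open>This is the bound needed to define an operator by
  \<open>app a \<Omega> \<mapsto> app a (app T \<Omega>)\<close>. On the range of \<open>p\<close>
  the form \<open>cinner (app a v) (app a w)\<close> is represented by the element \<open>A\<close>
  of \<open>P\<close>, which commutes with \<open>T\<close> and \<open>adj T\<close>, so
  \<open>power_domination\<close> applies to the moments of \<open>D\<close>.\<close>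

lemma compression_bound:
  assumes a: "a \<in> commutant N" and x: "x \<in> M"
  defines "T \<equiv> p * x * p"
  shows "(norm (app a (app T \<Omega>)))\<^sup>2 \<le> (norm (app a \<Omega>))\<^sup>2 * norm (adj T * T)"
proof -
  define A where "A = p * (adj a * a) * p"
  define D where "D = adj T * T"
  have AP: "A \<in> P" unfolding A_def by (intro P_I N'.times_closed N'.adj_closed a)
  have TA: "T * A = A * T" unfolding T_def by (rule compression_commute[OF AP x])
  have T': "adj T = p * adj x * p" by (simp add: T_def p_facts mult.assoc)
  have TA': "adj T * A = A * adj T" unfolding T' by (rule compression_commute[OF AP adj_closed[OF x]])
  have DA: "D * A = A * D"
  proof -
    have "D * A = adj T * (T * A)" by (simp only: D_def mult.assoc)
    also have "\<dots> = (adj T * A) * T" by (simp only: TA mult.assoc)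
    also have "\<dots> = A * D" by (simp only: TA' D_def mult.assoc)
    finally show ?thesis .
  qed
  have Dadj: "adj D = D" by (simp add: D_def)
  have pT: "app p (app T v) = app T v" for v by (simp add: T_def p_idem)
  have pD: "app p (app (D ^ k) \<Omega>) = app (D ^ k) \<Omega>" for k
  proof (cases k)
    case 0
    then show ?thesis by (simp add: p_Omega)
  next
    case (Suc j)
    have "app p (app D v) = app D v" for v by (simp add: D_def T' p_idem)
    then show ?thesis by (simp add: Suc)
  qed
  have A_inner: "cinner (app A v) w = cinner (app a v) (app a w)" if "app p v = v" "app p w = w" for v w
  proof -
    have "cinner (app A v) w = cinner (app p (app (adj a) (app a v))) w" by (simp add: A_def that(1))
    also have "\<dots> = cinner (app (adj a) (app a v)) w"
      using cinner_app[of p "app (adj a) (app a v)" w] by (simp add: p_facts that(2))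
    finally show ?thesis by (simp add: cinner_app_adj)
  qed
  define s where "s k = Re (cinner (app A (app (D ^ k) \<Omega>)) \<Omega>)" for k
  have s_eq: "s k = Re (cinner (app a (app (D ^ k) \<Omega>)) (app a \<Omega>))" for k
    unfolding s_def by (simp add: A_inner pD p_Omega)
  have s2: "s (2 * k) = (norm (app a (app (D ^ k) \<Omega>)))\<^sup>2" for k
  proof -
    have "D ^ (2 * k) = D ^ k * D ^ k" by (simp add: mult_2 power_add)
    then have "app A (app (D ^ (2 * k)) \<Omega>) = app (A * D ^ k) (app (D ^ k) \<Omega>)" by simp
    also have "A * D ^ k = adj (D ^ k) * A" using commute_power[OF DA, of k] by (simp add: Dadj)
    finally have "s (2 * k) = Re (cinner (app A (app (D ^ k) \<Omega>)) (app (D ^ k) \<Omega>))"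
      by (simp add: s_def cinner_app_adj flip: adj_power)
    also have "\<dots> = Re (cinner (app a (app (D ^ k) \<Omega>)) (app a (app (D ^ k) \<Omega>)))"
      by (simp only: A_inner[OF pD pD])
    finally show ?thesis by (simp add: cinner_self flip: of_real_power)
  qed
  have s0: "s 0 = (norm (app a \<Omega>))\<^sup>2" using s2[of 0] by simp
  have s1: "s 1 = (norm (app a (app T \<Omega>)))\<^sup>2"
  proof -
    have "app A (app D \<Omega>) = app (A * adj T) (app T \<Omega>)" by (simp add: D_def)
    also have "\<dots> = app (adj T) (app A (app T \<Omega>))" by (simp only: TA'[symmetric] app_times)
    finally have "s 1 = Re (cinner (app A (app T \<Omega>)) (app T \<Omega>))" by (simp add: s_def cinner_app_adj)
    then show ?thesis by (simp add: A_inner[OF pT pT] cinner_self flip: of_real_power)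
  qed
  have "s 1 \<le> s 0 * norm D"
  proof (rule power_domination)
    show "0 \<le> s 0" "0 \<le> s 1" by (simp_all only: s0 s1 zero_le_power2)
    fix k
    have le: "\<bar>s k\<bar> \<le> norm (app a (app (D ^ k) \<Omega>)) * norm (app a \<Omega>)"
      unfolding s_eq using norm_cinner abs_Re_le_cmod order_trans by blast
    then have "\<bar>s k\<bar>\<^sup>2 \<le> (norm (app a (app (D ^ k) \<Omega>)) * norm (app a \<Omega>))\<^sup>2" by (rule power_mono) simp
    then show "(s k)\<^sup>2 \<le> s 0 * s (2 * k)"
      unfolding s0 s2 by (simp add: power_mult_distrib mult.commute)
    have "norm (app a (app (D ^ k) \<Omega>)) \<le> norm a * (norm D ^ k * norm \<Omega>)"
      by (intro order_trans[OF norm_app] mult_left_mono mult_right_mono norm_power_ineq) auto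
    then have "norm (app a (app (D ^ k) \<Omega>)) * norm (app a \<Omega>) \<le> norm a * (norm D ^ k * norm \<Omega>) * norm (app a \<Omega>)"
      by (rule mult_right_mono) simp
    with le show "s k \<le> (norm a * norm \<Omega> * norm (app a \<Omega>)) * norm D ^ k" by (simp add: mult_ac)
  qed simp
  then show ?thesis by (simp only: s0 s1 D_def)
qed

text \<open>
  \<open>E(x)\<close> is the operator \<open>a\<Omega> \<mapsto> a p x \<Omega>\<close> for \<open>a \<in> N'\<close>; it commutes with \<open>N'\<close>, hence lies in \<open>N'' = N\<close>.
\<close>

lemma conditional_expectation:
  assumes x: "x \<in> M" shows "\<exists>n\<in>N. app n \<Omega> = app p (app x \<Omega>) \<and> p * x * p = n * p"
proof -
  define T where "T = p * x * p"
  have TO: "app T \<Omega> = app p (app x \<Omega>)" by (simp add: T_def p_Omega)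
  define R where "R = (\<lambda>a. (app a \<Omega>, app a (app T \<Omega>))) ` commutant N"
  have RI: "(app a \<Omega>, app a (app T \<Omega>)) \<in> R" if "a \<in> commutant N" for a using that by (auto simp: R_def)
  have sub: "subspace R" unfolding subspace_def
  proof (intro conjI ballI allI)
    show "0 \<in> R" using RI[OF N'.zero_closed] by (simp add: zero_prod_def)
    show "u + v \<in> R" if "u \<in> R" "v \<in> R" for u v
      using that RI[OF N'.plus_closed] by (force simp: R_def app_plus)
    show "c *\<^sub>R u \<in> R" if "u \<in> R" for c u
      using that RI[OF N'.scaleR_closed] by (force simp: R_def app_scaleR)
  qed
  have bd: "norm v \<le> sqrt (norm (adj T * T)) * norm u" if uv: "(u, v) \<in> R" for u v
  proof -
    obtain a where a: "a \<in> commutant N" "u = app a \<Omega>" "v = app a (app T \<Omega>)" using uv by (auto simp: R_def)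
    have "(norm v)\<^sup>2 \<le> (norm u)\<^sup>2 * norm (adj T * T)"
      unfolding a(2,3) T_def by (rule compression_bound[OF a(1) x])
    also have "\<dots> = (sqrt (norm (adj T * T)) * norm u)\<^sup>2" by (simp add: power_mult_distrib)
    finally show ?thesis by (rule power2_le_imp_le) simp
  qed
  have "closure (fst ` R) = UNIV" using commutant_dense[OF N_subset] by (simp add: R_def image_image)
  from dense_relation_extension[OF sub bd this]
  obtain f where f: "bounded_linear f" "\<forall>(x, y)\<in>R. f x = y" by blast
  have fa: "f (app a \<Omega>) = app a (app T \<Omega>)" if "a \<in> commutant N" for a
    using bspec[OF f(2) RI[OF that]] by simp
  have fC: "f (c *\<^sub>C v) = c *\<^sub>C f v" for c v
  proof (rule dense_ext[OF commutant_dense[OF N_subset],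
        where f = "\<lambda>v. f (c *\<^sub>C v)" and g = "\<lambda>v. c *\<^sub>C f v"])
    show "continuous_on UNIV (\<lambda>v. f (c *\<^sub>C v))"
      by (intro linear_continuous_on bounded_linear_compose[OF f(1) bounded_linear_scaleC])
    show "continuous_on UNIV (\<lambda>v. c *\<^sub>C f v)"
      by (intro linear_continuous_on bounded_linear_compose[OF bounded_linear_scaleC f(1)])
    fix w assume "w \<in> (\<lambda>a. app a \<Omega>) ` commutant N"
    then obtain a where a: "a \<in> commutant N" "w = app a \<Omega>" by blast
    show "f (c *\<^sub>C w) = c *\<^sub>C f w"
      using fa[OF N'.times_closed[OF N'.scalar_closed a(1)], of c] fa[OF a(1)] by (simp add: a(2))
  qed
  obtain n where n: "app n = f" using bop_exists[OF f(1) fC] by blast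
  have nN: "n \<in> N"
  proof (rule N.memI, rule bop_eqI)
    fix b v assume b: "b \<in> commutant N"
    show "app (n * b) v = app (b * n) v"
    proof (rule dense_ext[OF commutant_dense[OF N_subset] continuous_on_app continuous_on_app])
      fix w assume "w \<in> (\<lambda>a. app a \<Omega>) ` commutant N"
      then obtain a where a: "a \<in> commutant N" "w = app a \<Omega>" by blast
      show "app (n * b) w = app (b * n) w"
        using fa[OF N'.times_closed[OF b a(1)]] fa[OF a(1)] by (simp add: a(2) n)
    qed
  qed
  have nO: "app n \<Omega> = app p (app x \<Omega>)" using fa[OF N'.one_closed] by (simp add: n TO)
  have "p * x * p = n * p"
  proof (rule bop_eqI)
    fix v
    \<comment> \<open>Enough to check on \<open>app m \<Omega>\<close> with \<open>m\<close> in
      \<open>N\<close>. Right multiplication by \<open>m\<close>, here \<open>r\<close>, commutes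
      with \<open>p\<close> and with left multiplications, which moves the check to
      \<Omega>.\<close>
    have "app (p * x) w = app n w" if "w \<in> L" for w
    proof (rule L_ext[OF continuous_on_app continuous_on_app _ that])
      fix m assume m: "m \<in> N"
      define r where "r = conjJ (adj m)"
      have mM: "adj m \<in> M" using m by (intro NM N.adj_closed)
      have r: "app r (app y \<Omega>) = app y (app m \<Omega>)" if "y \<in> M" for y
        using conjJ_app[OF mM that] by (simp add: r_def)
      have pr: "p * r = r * p"
      proof -
        have "conjJ (p * adj m) = conjJ (adj m * p)" using p_N[OF N.adj_closed[OF m]] by simp
        then show ?thesis by (simp add: r_def conjJ_times conjJ_p)
      qed
      have "app (p * x) (app m \<Omega>) = app (p * r) (app x \<Omega>)" using r[OF x] by simp
      also have "\<dots> = app r (app n \<Omega>)" by (simp only: pr app_times nO)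
      also have "\<dots> = app n (app m \<Omega>)" by (rule r[OF NM[OF nN]])
      finally show "app (p * x) (app m \<Omega>) = app n (app m \<Omega>)" .
    qed
    from this[OF p_range[of v]] show "app (p * x * p) v = app (n * p) v" by simp
  qed
  with nN nO show ?thesis by blast
qed

end

section \<open>The basic construction and the tangent spaces of the orbit\<close>

text \<open>The bicommutant of a selfadjoint set is a von Neumann algebra, and monotonicity of
  bicommutants makes it the least one.\<close>

lemma vN_generated_selfadjoint:
  assumes "\<And>y. y \<in> S \<Longrightarrow> adj y \<in> S"
  shows "vN_generated S = commutant (commutant S)"
proof
  have "von_neumann_algebra (commutant (commutant S))"
    by (rule vN_commutant) (rule adj_commutant[OF assms])
  then show "vN_generated S \<subseteq> commutant (commutant S)"
    unfolding vN_generated_def using commutant_commutant_superset[of S] by blast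
  show "commutant (commutant S) \<subseteq> vN_generated S"
    unfolding vN_generated_def
  proof (intro Inter_greatest)
    fix A assume "A \<in> {A. von_neumann_algebra A \<and> S \<subseteq> A}"
    then have "commutant (commutant A) = A" "S \<subseteq> A" by (auto simp: von_neumann_algebra_def)
    then show "commutant (commutant S) \<subseteq> A"
      using commutant_antimono[OF commutant_antimono, of S A] by simp
  qed
qed

text \<open>Meant for \<open>tangent_at_p\<close>, where elements of the section are chosen one term
  of a sequence at a time.\<close>

lemma has_vector_derivative_sequentially:
  fixes f :: "real \<Rightarrow> 'a::real_normed_vector"
  assumes f: "(f has_vector_derivative D) (at x within S)"
    and t: "\<And>n. t n \<in> S" "\<And>n. t n \<noteq> x" "t \<longlonglongrightarrow> x"
  shows "(\<lambda>n. (1 / (t n - x)) *\<^sub>R (f (t n) - f x)) \<longlonglongrightarrow> D"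
proof -
  have "((\<lambda>y. (f y - f x - (y - x) *\<^sub>R D) /\<^sub>R norm (y - x)) \<longlongrightarrow> 0) (at x within S)"
    using f by (simp add: has_vector_derivative_def has_derivative_within diff_diff_eq inverse_eq_divide)
  moreover have "filterlim t (at x within S) sequentially"
    using t by (simp add: filterlim_at)
  ultimately have "(\<lambda>n. (f (t n) - f x - (t n - x) *\<^sub>R D) /\<^sub>R norm (t n - x)) \<longlonglongrightarrow> 0"
    by (rule filterlim_compose)
  then have "(\<lambda>n. norm ((f (t n) - f x - (t n - x) *\<^sub>R D) /\<^sub>R norm (t n - x))) \<longlonglongrightarrow> 0"
    by (simp only: tendsto_norm_zero_iff)
  moreover have "norm ((f (t n) - f x - (t n - x) *\<^sub>R D) /\<^sub>R norm (t n - x))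
      = norm ((1 / (t n - x)) *\<^sub>R (f (t n) - f x) - D)" for n
  proof -
    have "f (t n) - f x - (t n - x) *\<^sub>R D = (t n - x) *\<^sub>R ((1 / (t n - x)) *\<^sub>R (f (t n) - f x) - D)"
      using t(2)[of n] by (simp add: scaleR_diff_right)
    then show ?thesis using t(2)[of n] by (simp only: norm_scaleR) simp
  qed
  ultimately have "(\<lambda>n. norm ((1 / (t n - x)) *\<^sub>R (f (t n) - f x) - D)) \<longlonglongrightarrow> 0" by (simp only:)
  then show ?thesis by (simp only: tendsto_norm_zero_iff LIM_zero_iff)
qed

context subfactor
begin

definition "M1 = basic_construction M p"

lemma M1_eq: "M1 = commutant (commutant (insert p M))"
  unfolding M1_def basic_construction_def
  by (rule vN_generated_selfadjoint) (auto simp: p_facts adj_closed)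

lemma M1_vN: "von_neumann_algebra M1"
  unfolding M1_eq by (rule vN_commutant, rule adj_commutant) (auto simp: p_facts adj_closed)

lemma M_M1: "x \<in> M \<Longrightarrow> x \<in> M1" and p_M1: "p \<in> M1"
  unfolding M1_eq using commutant_commutant_superset[of "insert p M"] by blast+

text \<open>The generators \<open>p\<close> and \<open>M\<close> commute with \<open>conjJ n\<close>
  for \<open>n\<close> in \<open>N\<close>, for \<open>p\<close> because \<open>conjJ p = p\<close>;
  hence so does \<open>M1\<close>, and conjugation by \<open>J\<close> finishes.\<close>

lemma conjJ_M1: assumes "x \<in> M1" shows "conjJ x \<in> commutant N"
proof -
  have sub: "insert p M \<subseteq> commutant (conjJ ` N)"
  proof
    fix y assume y: "y \<in> insert p M"
    show "y \<in> commutant (conjJ ` N)"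
    proof (rule commutantI)
      fix z assume "z \<in> conjJ ` N"
      then obtain n where n: "n \<in> N" "z = conjJ n" by blast
      show "y * z = z * y"
      proof (cases "y = p")
        case True
        have "conjJ (p * n) = conjJ (n * p)" using p_N[OF n(1)] by simp
        then show ?thesis by (simp add: True n(2) conjJ_times conjJ_p)
      next
        case False
        then have "y \<in> M" using y by blast
        then show ?thesis using commutantD[OF conjJ_commutant[OF NM[OF n(1)]]] n(2) by metis
      qed
    qed
  qed
  have "M1 \<subseteq> commutant (conjJ ` N)"
  proof -
    have "von_neumann_algebra (commutant (conjJ ` N))"
    proof (rule vN_commutant)
      fix y assume "y \<in> conjJ ` N"
      then show "adj y \<in> conjJ ` N" by (auto simp: conjJ_adj N.adj_closed)
    qed
    then show ?thesis unfolding M1_def basic_construction_def vN_generated_def using sub by blast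
  qed
  then have x: "x \<in> commutant (conjJ ` N)" using assms by blast
  show ?thesis
  proof (rule commutantI)
    fix n assume "n \<in> N"
    then have "x * conjJ n = conjJ n * x" using commutantD[OF x] by blast
    then have "conjJ (x * conjJ n) = conjJ (conjJ n * x)" by simp
    then show "conjJ x * n = n * conjJ x" by (simp add: conjJ_times)
  qed
qed

text \<open>The finite index enters only here: \<open>JM\<^sub>1J \<subseteq> N'\<close>, and \<open>N'\<close> has a trace.\<close>

lemma M1_trace_exists: "\<exists>s. normalized_trace M1 s"
proof -
  interpret A: vn_algebra M1 by unfold_locales (rule M1_vN)
  interpret T: traced_vn "commutant N" t by unfold_locales (rule commutant_trace)
  \<comment> \<open>\<open>conjJ\<close> and \<open>adj\<close> are both conjugate linear, so the
    composite is linear. It reverses products, which the trace \<open>t\<close> absorbs.\<close>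
  define s where "s x = t (conjJ (adj x))" for x
  have c: "conjJ (adj x) \<in> commutant N" "conjJ x \<in> commutant N" if "x \<in> M1" for x
    by (rule conjJ_M1[OF A.adj_closed[OF that]], rule conjJ_M1[OF that])
  have sq: "s (adj x * x) = t (adj (conjJ x) * conjJ x)" for x
    by (simp add: s_def conjJ_times conjJ_adj)
  have "normalized_trace M1 s" unfolding normalized_trace_def
  proof (intro conjI ballI allI impI)
    fix x y assume x: "x \<in> M1" and y: "y \<in> M1"
    show "s (x + y) = s x + s y" using c[OF x] c[OF y] by (simp add: s_def conjJ_plus T.tr_plus)
    show "s (x * y) = s (y * x)"
      using T.tr_commute[OF c(1)[OF y] c(1)[OF x]] by (simp add: s_def conjJ_times)
  next
    fix c x assume x: "x \<in> M1"
    have "conjJ (adj (scalar_op c * x)) = scalar_op c * conjJ (adj x)"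
      by (simp add: conjJ_times conjJ_scalar scalar_op_commute)
    then show "s (scalar_op c * x) = c * s x"
      using T.tr_scalar[OF c(1)[OF x]]
      by (simp only: s_def)
  next
    fix x assume x: "x \<in> M1"
    show "Im (s (adj x * x)) = 0" "0 \<le> Re (s (adj x * x))"
      using T.tr_Im[OF c(2)[OF x]] T.tr_nonneg[OF c(2)[OF x]] by (simp_all only: sq)
    assume "s (adj x * x) = 0"
    then have "conjJ x = 0" using T.tr_faithful[OF c(2)[OF x]] by (simp only: sq)
    then have "conjJ (conjJ x) = conjJ 0" by simp
    moreover have "conjJ 0 = 0" using linear_0[OF bounded_linear.linear[OF bounded_linear_J]] by (intro bop_eqI) simp
    ultimately show "x = 0" by simp
  next
    show "s 1 = 1" by (simp add: s_def T.tr_1)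
    obtain \<xi> \<eta> where u: "summable (\<lambda>n. (norm (\<xi> n))\<^sup>2)" "summable (\<lambda>n. (norm (\<eta> n))\<^sup>2)"
      and u': "\<And>x. x \<in> commutant N \<Longrightarrow> t x = (\<Sum>n. cinner (app x (\<xi> n)) (\<eta> n))"
      using T.tr_uw unfolding ultraweakly_continuous_on_def by blast
    \<comment> \<open>Conjugation by \<open>J\<close> and the adjoint exchange the roles of the two
      sequences of vectors.\<close>
    have "s x = (\<Sum>n. cinner (app x (J (\<eta> n))) (J (\<xi> n)))" if "x \<in> M1" for x
    proof -
      have "cinner (app (conjJ (adj x)) v) w = cinner (app x (J w)) (J v)" for v w
        by (simp add: cinner_J_left[of _ w] cinner_app)
      then show ?thesis unfolding s_def u'[OF c(1)[OF that]] by (simp only:)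
    qed
    with u show "ultraweakly_continuous_on M1 s" unfolding ultraweakly_continuous_on_def
      by (intro exI[of _ "\<lambda>n. J (\<eta> n)"] exI[of _ "\<lambda>n. J (\<xi> n)"]) (simp add: norm_J)
  qed
  then show ?thesis by blast
qed

section \<open>The trace of the basic construction and the Markov property\<close>

definition "\<tau> = trace_of M1"

sublocale T: traced_vn M1 \<tau>
proof
  show "von_neumann_algebra M1" by (rule M1_vN)
  show "normalized_trace M1 \<tau>" unfolding \<tau>_def trace_of_def by (rule someI_ex[OF M1_trace_exists])
qed

text \<open>\<open>trace_of\<close> is a choice of which only the axioms are known;
  \<open>trace_unique\<close> on the factor \<open>M\<close> identifies its restriction with the
  vector state of \<Omega>.\<close>

lemma tau_M: "y \<in> M \<Longrightarrow> \<tau> y = cinner (app y \<Omega>) \<Omega>"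
proof -
  assume y: "y \<in> M"
  have "ultraweakly_continuous_on M \<tau>"
    using T.tr_uw M_M1 unfolding ultraweakly_continuous_on_def by blast
  then have "\<tau> y = cinner (app y \<Omega>) \<Omega> * \<tau> 1"
    using y by (intro trace_unique[OF factor_M]) (auto simp: M_M1 T.tr_plus T.tr_scalar intro: T.tr_commute)
  then show ?thesis by (simp add: T.tr_1)
qed

text \<open>Since \<open>p\<close> commutes with \<open>N\<close>, the functional
  \<open>n \<mapsto> \<tau> (p * n)\<close> is tracial on the factor \<open>N\<close>, hence a
  multiple of the vector state.\<close>

lemma tau_p_N: assumes n: "n \<in> N" shows "\<tau> (p * n) = cinner (app n \<Omega>) \<Omega> * \<tau> p"
proof -
  have N1: "m \<in> M1" if "m \<in> N" for m using that by (intro M_M1 NM)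
  note cl = N1 p_M1 T.alg_closed
  have "\<tau> (p * n) = cinner (app n \<Omega>) \<Omega> * \<tau> (p * 1)"
  proof (rule trace_unique[OF factor_N N_subset _ _ _ _ n])
    show "\<tau> (p * (x + y)) = \<tau> (p * x) + \<tau> (p * y)" if "x \<in> N" "y \<in> N" for x y
      using that by (simp add: distrib_left T.tr_plus cl)
    show "\<tau> (p * (scalar_op c * x)) = c * \<tau> (p * x)" if "x \<in> N" for c x
    proof -
      have "p * (scalar_op c * x) = scalar_op c * (p * x)"
        by (metis mult.assoc scalar_op_commute)
      then show ?thesis using that by (simp add: T.tr_scalar cl)
    qed
    show "\<tau> (p * (x * y)) = \<tau> (p * (y * x))" if "x \<in> N" "y \<in> N" for x y
    proof -
      have "\<tau> (p * (x * y)) = \<tau> (p * x * y)" by (simp only: mult.assoc)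
      also have "\<dots> = \<tau> (y * (p * x))" using that by (intro T.tr_commute) (simp_all add: cl)
      also have "y * (p * x) = p * (y * x)" using p_N[OF that(2)] by (simp add: mult.assoc[symmetric])
      finally show ?thesis .
    qed
    obtain \<xi> \<eta> where u: "summable (\<lambda>n. (norm (\<xi> n))\<^sup>2)" "summable (\<lambda>n. (norm (\<eta> n))\<^sup>2)"
      and u': "\<And>x. x \<in> M1 \<Longrightarrow> \<tau> x = (\<Sum>n. cinner (app x (\<xi> n)) (\<eta> n))"
      using T.tr_uw unfolding ultraweakly_continuous_on_def by blast
    have "summable (\<lambda>n. (norm (app p (\<eta> n)))\<^sup>2)"
    proof (rule summable_comparison_test'[OF summable_mult[OF u(2), of "(norm p)\<^sup>2"]])
      show "norm ((norm (app p (\<eta> n)))\<^sup>2) \<le> (norm p)\<^sup>2 * (norm (\<eta> n))\<^sup>2" for n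
        using power_mono[OF norm_app[of p "\<eta> n"], of 2] by (simp add: power_mult_distrib)
    qed
    moreover have "\<tau> (p * x) = (\<Sum>n. cinner (app x (\<xi> n)) (app p (\<eta> n)))" if "x \<in> N" for x
      using u'[of "p * x"] that by (simp add: cl cinner_app[of p] p_facts)
    ultimately show "ultraweakly_continuous_on N (\<lambda>x. \<tau> (p * x))"
      using u(1) unfolding ultraweakly_continuous_on_def
      by (intro exI[of _ \<xi>] exI[of _ "\<lambda>n. app p (\<eta> n)"]) simp
  qed
  then show ?thesis by simp
qed

text \<open>The constant of the Markov property, classically the inverse of the index.\<close>

definition "lam = Re (\<tau> p)"

lemma tau_p_lam: "\<tau> p = of_real lam" and lam_pos: "0 < lam"
proof -
  have pp: "\<tau> (adj p * p) = \<tau> p" by (simp only: p_facts)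
  have "Im (\<tau> p) = 0" "0 \<le> Re (\<tau> p)" using T.tr_Im[OF p_M1] T.tr_nonneg[OF p_M1] by (simp_all only: pp)
  then show l: "\<tau> p = of_real lam" by (simp add: lam_def complex_eq_iff)
  have "p \<noteq> 0" using p_Omega tr_one by force
  then have "\<tau> p \<noteq> 0" using T.tr_faithful[OF p_M1] pp by auto
  then have "lam \<noteq> 0" using l by auto
  then show "0 < lam" using \<open>0 \<le> Re (\<tau> p)\<close> unfolding lam_def by linarith
qed

text \<open>The compression \<open>p * y * p = n * p\<close> reduces to \<open>tau_p_N\<close>, and
  passing from \<open>y\<close> to \<open>n\<close> preserves the vector state because
  \<open>p\<close> fixes \<Omega>.\<close>

lemma tau_p: assumes y: "y \<in> M" shows "\<tau> (p * y) = of_real lam * cinner (app y \<Omega>) \<Omega>"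
proof -
  obtain n where n: "n \<in> N" "app n \<Omega> = app p (app y \<Omega>)" "p * y * p = n * p"
    using conditional_expectation[OF y] by blast
  have "\<tau> (p * y) = \<tau> (p * (p * y))" by (simp only: mult.assoc[symmetric] p_facts)
  also have "\<dots> = \<tau> (p * y * p)" by (intro T.tr_commute T.times_closed p_M1 M_M1 y)
  also have "\<dots> = \<tau> (p * n)" by (simp only: n(3) p_N[OF n(1)])
  also have "\<dots> = cinner (app n \<Omega>) \<Omega> * \<tau> p" by (rule tau_p_N[OF n(1)])
  also have "cinner (app n \<Omega>) \<Omega> = cinner (app y \<Omega>) \<Omega>"
    using cinner_app[of p "app y \<Omega>" \<Omega>] by (simp add: n(2) p_facts p_Omega)
  finally show ?thesis by (simp add: tau_p_lam)
qed

lemma unitaries_M: "u \<in> unitaries M \<Longrightarrow> u \<in> M \<and> adj u \<in> M \<and> adj u * u = 1 \<and> u * adj u = 1"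
  by (auto simp: unitaries_def adj_closed)

lemma tau_orbit:
  assumes q: "q \<in> orbit M p" and y: "y \<in> M" shows "\<tau> (q * y) = of_real lam * \<tau> y"
proof -
  obtain u where u: "u \<in> unitaries M" "q = u * p * adj u" using q by (auto simp: orbit_def)
  note uM = unitaries_M[OF u(1)]
  have "\<tau> (q * y) = \<tau> (u * (p * adj u * y))" by (simp only: u(2) mult.assoc)
  also have "\<dots> = \<tau> (p * adj u * y * u)" using uM y by (intro T.tr_commute T.times_closed p_M1 M_M1) auto
  also have "\<dots> = \<tau> (p * (adj u * y * u))" by (simp only: mult.assoc)
  also have "\<dots> = of_real lam * \<tau> (adj u * y * u)"
    using uM y tau_p[of "adj u * y * u"] tau_M[of "adj u * y * u"] by (simp add: alg_closed)
  also have "\<tau> (adj u * y * u) = \<tau> (u * (adj u * y))"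
    using uM y by (intro T.tr_commute T.times_closed M_M1) auto
  also have "u * (adj u * y) = y" using uM by (simp only: mult.assoc[symmetric]) simp
  finally show ?thesis .
qed

lemma orbit_M1: assumes "q \<in> orbit M p" shows "q \<in> M1"
proof -
  obtain u where u: "u \<in> unitaries M" "q = u * p * adj u" using assms by (auto simp: orbit_def)
  show ?thesis using unitaries_M[OF u(1)] by (simp add: u(2) T.times_closed M_M1 p_M1)
qed

lemma orbit_proj: assumes "q \<in> orbit M p" shows "q * q = q" "adj q = q"
proof -
  obtain u where u: "u \<in> unitaries M" "q = u * p * adj u" using assms by (auto simp: orbit_def)
  note uM = unitaries_M[OF u(1)]
  have "q * q = u * p * (adj u * u) * (p * adj u)" by (simp only: u(2) mult.assoc)
  also have "\<dots> = u * (p * p) * adj u" using uM by (simp only: mult_1_right) (simp only: mult.assoc)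
  finally show "q * q = q" by (simp only: p_facts u(2))
  show "adj q = q" by (simp add: u(2) p_facts mult.assoc)
qed

lemma orbit_conj: assumes "q \<in> orbit M p" "u \<in> unitaries M" shows "u * q * adj u \<in> orbit M p"
proof -
  obtain v where v: "v \<in> unitaries M" "q = v * p * adj v" using assms by (auto simp: orbit_def)
  have "u * q * adj u = (u * v) * p * adj (u * v)" by (simp add: v(2) mult.assoc)
  then show ?thesis unfolding orbit_def using unitaries_closed[OF assms(2) v(1)] by blast
qed

text \<open>It allows elements of \<open>M\<close> to be recovered continuously from their products
  with \<open>p\<close>. For \<open>b = m * a\<close> the Markov property makes the real part of
  \<open>\<tau> (adj b * (m * p * a))\<close> equal to \<open>lam\<close> times the squared norm of
  \<open>app b \<Omega>\<close>. On the other hand \<open>tr_CS\<close> and \<open>tr_bound\<close>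
  bound it by \<open>norm (m * p)\<close> times the norms of \<open>app a \<Omega>\<close> and
  \<open>app b \<Omega>\<close>. Density of the vectors \<open>app a \<Omega>\<close> completes the
  estimate.\<close>

lemma pimsner_popa: assumes m: "m \<in> M" shows "lam * norm m \<le> norm (m * p)"
proof -
  define y where "y = m * p"
  have y1: "y \<in> M1" using m by (simp add: y_def T.times_closed M_M1 p_M1)
  have tn: "Re (\<tau> (adj a * a)) = (norm (app a \<Omega>))\<^sup>2" if "a \<in> M" for a
    using that tau_M[of "adj a * a"] by (simp only: norm_app_sq alg_closed)
  have *: "lam * norm (app m (app a \<Omega>)) \<le> norm y * norm (app a \<Omega>)" if a: "a \<in> M" for a
  proof -
    define b where "b = m * a"
    have b: "b \<in> M" using m a by (simp add: b_def times_closed)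
    note cl = M_M1[OF a] M_M1[OF b] M_M1[OF m] y1 p_M1 T.alg_closed
    have "\<tau> (adj b * (y * a)) = \<tau> ((adj b * m) * (p * a))" by (simp only: y_def mult.assoc)
    also have "\<dots> = \<tau> ((p * a) * (adj b * m))" by (rule T.tr_commute) (simp_all add: cl)
    also have "\<dots> = \<tau> (p * (a * (adj b * m)))" by (simp only: mult.assoc)
    also have "\<dots> = of_real lam * \<tau> (a * (adj b * m))"
      using a b m by (simp add: tau_p tau_M alg_closed del: app_times)
    also have "\<tau> (a * (adj b * m)) = \<tau> (adj b * m * a)" by (rule T.tr_commute) (simp_all add: cl)
    finally have "Re (\<tau> (adj b * (y * a))) = lam * Re (\<tau> (adj b * b))" by (simp add: b_def mult.assoc)
    then have 1: "Re (\<tau> (adj b * (y * a))) = lam * (norm (app b \<Omega>))\<^sup>2" by (simp only: tn[OF b])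
    have "(lam * (norm (app b \<Omega>))\<^sup>2)\<^sup>2 \<le> Re (\<tau> (adj b * b)) * Re (\<tau> (adj (y * a) * (y * a)))"
      unfolding 1[symmetric] by (rule T.tr_CS) (simp_all add: cl)
    also have "\<dots> \<le> (norm (app b \<Omega>))\<^sup>2 * ((norm (app a \<Omega>))\<^sup>2 * norm (adj y * y))"
      unfolding tn[OF b] using T.tr_bound[OF M_M1[OF a] y1] tn[OF a] by (intro mult_left_mono) auto
    also have "\<dots> \<le> (norm (app b \<Omega>))\<^sup>2 * ((norm (app a \<Omega>))\<^sup>2 * (norm y * norm y))"
    proof (intro mult_left_mono)
      have "norm (adj y * y) \<le> norm (adj y) * norm y" by (rule norm_mult_ineq)
      also have "\<dots> \<le> norm y * norm y" by (intro mult_right_mono norm_adj_le) simp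
      finally show "norm (adj y * y) \<le> norm y * norm y" .
    qed auto
    also have "\<dots> = (norm (app b \<Omega>) * (norm (app a \<Omega>) * norm y))\<^sup>2" by (simp add: power2_eq_square mult_ac)
    finally have "lam * (norm (app b \<Omega>))\<^sup>2 \<le> norm (app b \<Omega>) * (norm (app a \<Omega>) * norm y)"
      by (rule power2_le_imp_le) simp
    then have "norm (app b \<Omega>) * (lam * norm (app b \<Omega>)) \<le> norm (app b \<Omega>) * (norm y * norm (app a \<Omega>))"
      by (simp add: power2_eq_square mult_ac)
    then have "lam * norm (app b \<Omega>) \<le> norm y * norm (app a \<Omega>)"
      by (cases "norm (app b \<Omega>) = 0") (auto simp: mult_le_cancel_left)
    then show ?thesis by (simp add: b_def)
  qed
  have "lam * norm (app m v) \<le> norm y * norm v" for v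
  proof -
    have "closure ((\<lambda>a. app a \<Omega>) ` M) \<subseteq> {v. lam * norm (app m v) \<le> norm y * norm v}"
    proof (rule closure_minimal)
      show "closed {v. lam * norm (app m v) \<le> norm y * norm v}"
        by (intro closed_Collect_le continuous_intros continuous_on_app)
    qed (use * in auto)
    then show ?thesis using dense by auto
  qed
  then have "norm m \<le> norm y / lam"
    using lam_pos by (intro norm_bop_bound) (simp_all add: field_simps)
  then show ?thesis using lam_pos by (simp add: y_def field_simps)
qed

lemma mp_inj: "m \<in> M \<Longrightarrow> m * p = 0 \<Longrightarrow> m = 0"
  using pimsner_popa[of m] lam_pos by (simp add: mult_le_0_iff)

text \<open>For \<open>q = u p u\<^sup>*\<close> the element is \<open>g = u E(u\<^sup>*)\<close>, a cross section of the orbit near \<open>p\<close>.\<close>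

lemma orbit_section:
  assumes q: "q \<in> orbit M p"
  shows "\<exists>g\<in>M. g * p = q * p \<and> p * q * p = adj g * g * p"
proof -
  obtain u where u: "u \<in> unitaries M" "q = u * p * adj u" using q by (auto simp: orbit_def)
  note uM = unitaries_M[OF u(1)]
  obtain n where n: "n \<in> N" "p * adj u * p = n * p" using conditional_expectation[of "adj u"] uM by blast
  have n': "p * u * p = p * adj n"
  proof -
    have "adj (p * adj u * p) = adj (n * p)" by (simp only: n(2))
    then show ?thesis by (simp add: p_facts mult.assoc)
  qed
  have 1: "u * n * p = q * p" by (simp only: u(2) mult.assoc n(2)[symmetric])
  have "p * q * p = (p * u * p) * (p * adj u * p)"
  proof -
    have "(p * u * p) * (p * adj u * p) = p * u * (p * p) * adj u * p" by (simp only: mult.assoc)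
    then show ?thesis by (simp only: p_facts u(2) mult.assoc)
  qed
  also have "\<dots> = adj n * p * (n * p)" by (simp only: n' n(2) p_N[OF N.adj_closed[OF n(1)]])
  also have "\<dots> = adj n * (p * n) * p" by (simp only: mult.assoc)
  also have "\<dots> = adj n * n * (p * p)" by (simp only: p_N[OF n(1)] mult.assoc)
  also have "\<dots> = adj n * n * p" by (simp only: p_facts)
  also have "adj n * n = adj (u * n) * (u * n)"
  proof -
    have "adj (u * n) * (u * n) = adj n * (adj u * u) * n" by (simp add: mult.assoc)
    then show ?thesis using uM by simp
  qed
  finally show ?thesis using 1 uM NM[OF n(1)] by (intro bexI[of _ "u * n"]) (simp_all add: times_closed)
qed

text \<open>
  By the Pimsner--Popa bound the cross section \<open>g\<close> is differentiable with the curve, and differentiating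
  \<open>g\<^sup>*g p = p \<gamma> p\<close> at \<open>g = 1\<close> shows that its derivative is antihermitian.
\<close>

lemma tangent_at_p:
  assumes \<gamma>: "\<And>s. s \<in> S \<Longrightarrow> \<gamma> s \<in> orbit M p" and d: "(\<gamma> has_vector_derivative D) (at x within S)"
    and x: "x \<in> S" "x islimpt S" "\<gamma> x = p"
  shows "\<exists>m\<in>M. adj m = - m \<and> p * m * p = 0 \<and> D = m * p - p * m"
proof -
  obtain f where f: "\<And>n. f n \<in> S - {x}" "f \<longlonglongrightarrow> x" using x(2) by (auto simp: islimpt_sequential)
  have fS: "f n \<in> S" "f n \<noteq> x" for n using f(1)[of n] by auto
  define c where "c n = 1 / (f n - x)" for n
  define X where "X n = c n *\<^sub>R (\<gamma> (f n) - p)" for n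
  have X: "X \<longlonglongrightarrow> D"
    using has_vector_derivative_sequentially[OF d fS f(2)] by (simp only: x(3) X_def[abs_def] c_def)
  have q: "\<gamma> (f n) \<in> orbit M p" for n using \<gamma> fS by blast
  have lim\<gamma>: "(\<lambda>n. \<gamma> (f n)) \<longlonglongrightarrow> p"
  proof -
    have "continuous (at x within S) \<gamma>" by (rule has_vector_derivative_continuous[OF d])
    moreover have "filterlim f (at x within S) sequentially" using fS f(2) by (simp add: filterlim_at)
    ultimately show ?thesis using filterlim_compose[of \<gamma> "nhds p" "at x within S" f sequentially]
      by (simp add: continuous_within x(3))
  qed
  have adjD: "adj D = D"
  proof -
    have "adj (X n) = X n" for n using orbit_proj(2)[OF q, of n] by (simp add: X_def p_facts)
    then have "X \<longlonglongrightarrow> adj D" using bounded_linear.tendsto[OF bounded_linear_adj X] by simp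
    then show ?thesis using LIMSEQ_unique[OF _ X] by blast
  qed
  \<comment> \<open>The derivative of the idempotent relation; the difference quotients satisfy the
    Leibniz identity exactly. It forces \<open>p * D * p = 0\<close>.\<close>
  have idD: "D = p * D + D * p"
  proof -
    have "X n = \<gamma> (f n) * X n + X n * p" for n
    proof -
      have "\<gamma> (f n) - p = \<gamma> (f n) * (\<gamma> (f n) - p) + (\<gamma> (f n) - p) * p"
        by (simp add: right_diff_distrib left_diff_distrib orbit_proj(1)[OF q] p_facts)
      then have "c n *\<^sub>R (\<gamma> (f n) - p) = c n *\<^sub>R (\<gamma> (f n) * (\<gamma> (f n) - p) + (\<gamma> (f n) - p) * p)" by (rule arg_cong)
      also have "\<dots> = \<gamma> (f n) * (c n *\<^sub>R (\<gamma> (f n) - p)) + (c n *\<^sub>R (\<gamma> (f n) - p)) * p"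
        by (simp only: scaleR_add_right mult_scaleR_left mult_scaleR_right)
      finally show ?thesis unfolding X_def .
    qed
    moreover have "(\<lambda>n. \<gamma> (f n) * X n + X n * p) \<longlonglongrightarrow> p * D + D * p"
      by (intro tendsto_intros lim\<gamma> X)
    ultimately have "X \<longlonglongrightarrow> p * D + D * p" by (simp only: flip: ext)
    then show ?thesis using LIMSEQ_unique[OF X] by blast
  qed
  have pDp: "p * D * p = 0"
  proof -
    have "p * D * p = p * (p * D + D * p) * p" by (simp only: idD[symmetric])
    also have "\<dots> = (p * p) * D * p + p * D * (p * p)" by (simp only: distrib_left distrib_right mult.assoc)
    finally show ?thesis by (simp add: p_facts)
  qed
  have "\<exists>g. \<forall>n. g n \<in> M \<and> g n * p = \<gamma> (f n) * p \<and> p * \<gamma> (f n) * p = adj (g n) * g n * p"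
    by (rule choice) (use orbit_section[OF q] in blast)
  then obtain g where g: "\<And>n. g n \<in> M" "\<And>n. g n * p = \<gamma> (f n) * p"
    "\<And>n. p * \<gamma> (f n) * p = adj (g n) * g n * p" by blast
  \<comment> \<open>Difference quotients of the section. Multiplied by \<open>p\<close> they are
    those of the curve, so \<open>pimsner_popa\<close> turns convergence of the latter into
    convergence of \<open>Y\<close>.\<close>
  define Y where "Y n = c n *\<^sub>R (g n - 1)" for n
  have YM: "Y n \<in> M" for n by (simp add: Y_def alg_closed g)
  have Yp: "Y n * p = X n * p" for n by (simp add: Y_def X_def left_diff_distrib g(2) p_facts)
  have "Cauchy Y"
  proof (rule CauchyI)
    fix e :: real assume e: "0 < e"
    have "(\<lambda>n. X n * p) \<longlonglongrightarrow> D * p" by (intro tendsto_intros X)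
    then have "Cauchy (\<lambda>n. X n * p)" by (rule LIMSEQ_imp_Cauchy)
    from CauchyD[OF this, of "lam * e"] obtain K where
      K: "\<And>m n. m \<ge> K \<Longrightarrow> n \<ge> K \<Longrightarrow> norm (X m * p - X n * p) < lam * e" using lam_pos e by auto
    have "norm (Y m - Y n) < e" if "m \<ge> K" "n \<ge> K" for m n
    proof -
      have "lam * norm (Y m - Y n) \<le> norm ((Y m - Y n) * p)" by (intro pimsner_popa minus_closed YM)
      also have "\<dots> < lam * e" using K[OF that] by (simp add: left_diff_distrib Yp)
      finally show ?thesis using lam_pos by simp
    qed
    then show "\<exists>K. \<forall>m\<ge>K. \<forall>n\<ge>K. norm (Y m - Y n) < e" by blast
  qed
  then obtain m where m: "Y \<longlonglongrightarrow> m" using Cauchy_convergent_iff convergent_def by blast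
  have mM: "m \<in> M" by (rule limit_closed[OF YM m])
  have mp: "m * p = D * p"
  proof -
    have "(\<lambda>n. Y n * p) \<longlonglongrightarrow> m * p" "(\<lambda>n. X n * p) \<longlonglongrightarrow> D * p" by (intro tendsto_intros X m)+
    then show ?thesis unfolding Yp using LIMSEQ_unique by blast
  qed
  have g1: "g \<longlonglongrightarrow> 1"
  proof -
    have "(\<lambda>n. (f n - x) *\<^sub>R Y n + 1) \<longlonglongrightarrow> (x - x) *\<^sub>R m + 1" by (intro tendsto_intros f m)
    moreover have "(f n - x) *\<^sub>R Y n + 1 = g n" for n using fS(2)[of n] by (simp add: Y_def c_def)
    ultimately show ?thesis by simp
  qed
  \<comment> \<open>The difference quotient of \<open>adj g * g\<close> at 1, in Leibniz form. Its
    product with \<open>p\<close> tends to \<open>p * D * p = 0\<close>, so \<open>mp_inj\<close>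
    gives \<open>adj m + m = 0\<close>.\<close>
  define Z where "Z n = adj (Y n) * g n + Y n" for n
  have Z: "Z \<longlonglongrightarrow> adj m + m"
  proof -
    have "Z \<longlonglongrightarrow> adj m * 1 + m" unfolding Z_def
      by (intro tendsto_intros bounded_linear.tendsto[OF bounded_linear_adj] m g1)
    then show ?thesis by simp
  qed
  have "Z n * p = p * X n * p" for n
  proof -
    have "(adj (g n) - 1) * g n + (g n - 1) = adj (g n) * g n - 1" by (simp add: left_diff_distrib)
    then have "Z n = c n *\<^sub>R (adj (g n) * g n - 1)"
      by (simp add: Z_def Y_def flip: scaleR_add_right)
    then have "Z n * p = c n *\<^sub>R (p * \<gamma> (f n) * p - p)" by (simp add: left_diff_distrib g(3))
    then show ?thesis by (simp add: X_def left_diff_distrib right_diff_distrib p_facts)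
  qed
  moreover have "(\<lambda>n. Z n * p) \<longlonglongrightarrow> (adj m + m) * p" by (intro tendsto_intros Z)
  moreover have "(\<lambda>n. p * X n * p) \<longlonglongrightarrow> p * D * p" by (intro tendsto_intros X)
  ultimately have "(adj m + m) * p = p * D * p" using LIMSEQ_unique by auto
  then have "adj m + m = 0" using mp_inj[of "adj m + m"] mM pDp by (simp add: alg_closed)
  then have ma: "adj m = - m" by (simp add: eq_neg_iff_add_eq_0)
  have "adj (m * p) = adj (D * p)" by (simp only: mp)
  then have "p * D = - (p * m)" by (simp add: ma adjD p_facts)
  then have "D = m * p - p * m" using idD mp by simp
  moreover have "p * m * p = 0" using pDp mp by (simp add: mult.assoc)
  ultimately show ?thesis using mM ma by blast
qed

text \<open>Conjugation by a unitary of \<open>M\<close> moves the point to \<open>p\<close>, where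
  \<open>tangent_at_p\<close> applies, and the generator is conjugated back.\<close>

lemma orbit_tangent:
  assumes \<gamma>: "\<And>s. s \<in> S \<Longrightarrow> \<gamma> s \<in> orbit M p" and d: "(\<gamma> has_vector_derivative D) (at x within S)"
    and x: "x \<in> S" "x islimpt S"
  shows "\<exists>z\<in>M. adj z = - z \<and> \<gamma> x * z * \<gamma> x = 0 \<and> D = z * \<gamma> x - \<gamma> x * z"
proof -
  obtain u where u: "u \<in> unitaries M" "\<gamma> x = u * p * adj u" using \<gamma>[OF x(1)] by (auto simp: orbit_def)
  note uM = unitaries_M[OF u(1)]
  define \<delta> where "\<delta> s = adj u * \<gamma> s * u" for s
  have 1: "\<delta> s \<in> orbit M p" if "s \<in> S" for s
    using orbit_conj[OF \<gamma>[OF that] unitaries_adj[OF u(1)]] by (simp add: \<delta>_def)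
  have 2: "(\<delta> has_vector_derivative adj u * D * u) (at x within S)"
    unfolding \<delta>_def
    by (intro bounded_linear.has_vector_derivative[OF bounded_linear_mult_left]
        bounded_linear.has_vector_derivative[OF bounded_linear_mult_right] d)
  have cancel: "adj u * (u * w) = w" "u * (adj u * w) = w" for w
    using uM by (simp_all add: mult.assoc[symmetric])
  have 3: "\<delta> x = p" using uM by (simp add: \<delta>_def u(2) mult.assoc cancel)
  obtain m where m: "m \<in> M" "adj m = - m" "p * m * p = 0" "adj u * D * u = m * p - p * m"
    using tangent_at_p[OF 1 2 x 3] by blast
  have "u * (adj u * D * u) * adj u = D" using uM by (simp add: mult.assoc cancel)
  then have D: "D = u * (m * p - p * m) * adj u" by (simp only: m(4))
  have "\<gamma> x * (u * m * adj u) * \<gamma> x = u * (p * m * p) * adj u" by (simp add: u(2) mult.assoc cancel)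
  then have "\<gamma> x * (u * m * adj u) * \<gamma> x = 0" by (simp only: m(3)) simp
  moreover have "D = (u * m * adj u) * \<gamma> x - \<gamma> x * (u * m * adj u)"
    by (simp add: D u(2) left_diff_distrib right_diff_distrib mult.assoc cancel)
  moreover have "adj (u * m * adj u) = - (u * m * adj u)" by (simp add: m(2) mult.assoc)
  ultimately show ?thesis using uM m(1) by (intro bexI[of _ "u * m * adj u"]) (auto simp: times_closed)
qed

end

section \<open>Piecewise smooth curves\<close>

text \<open>Choosing one derivative inside \<open>S\<close> for each member and iterating produces
  all higher derivatives, without explicit formulas for them.\<close>

lemma smooth_on_coinduct:
  assumes "f \<in> S" and step: "\<And>g. g \<in> S \<Longrightarrow> \<exists>g'\<in>S. \<forall>t\<in>{a..b}. (g has_vector_derivative g' t) (at t within {a..b})"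
  shows "smooth_on a b f"
proof -
  have "\<exists>d. \<forall>g\<in>S. d g \<in> S \<and> (\<forall>t\<in>{a..b}. (g has_vector_derivative d g t) (at t within {a..b}))"
    by (rule bchoice) (use step in blast)
  then obtain d where d: "\<And>g. g \<in> S \<Longrightarrow> d g \<in> S"
    "\<And>g t. g \<in> S \<Longrightarrow> t \<in> {a..b} \<Longrightarrow> (g has_vector_derivative d g t) (at t within {a..b})" by blast
  have S: "(d ^^ n) f \<in> S" for n by (induction n) (simp_all add: assms(1) d(1))
  show ?thesis unfolding smooth_on_def
    by (rule exI[of _ "\<lambda>n. (d ^^ n) f"]) (simp add: d(2)[OF S])
qed

lemma smooth_on_derivative:
  assumes "smooth_on a b f"
  shows "\<exists>f'. smooth_on a b f' \<and> (\<forall>t\<in>{a..b}. (f has_vector_derivative f' t) (at t within {a..b}))"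
proof -
  obtain D where D: "\<And>t. t \<in> {a..b} \<Longrightarrow> D 0 t = f t"
    "\<And>n t. t \<in> {a..b} \<Longrightarrow> (D n has_vector_derivative D (Suc n) t) (at t within {a..b})"
    using assms unfolding smooth_on_def by blast
  have "smooth_on a b (D 1)" unfolding smooth_on_def
    by (rule exI[of _ "\<lambda>n. D (Suc n)"]) (simp add: D(2))
  moreover have "(f has_vector_derivative D 1 t) (at t within {a..b})" if "t \<in> {a..b}" for t
    using D(2)[OF that, of 0] by (intro has_vector_derivative_transform[OF that, of f "D 0"]) (simp_all add: D(1))
  ultimately show ?thesis by blast
qed

lemma smooth_on_antiderivative:
  assumes f: "smooth_on a b f" and F: "\<And>t. t \<in> {a..b} \<Longrightarrow> (F has_vector_derivative f t) (at t within {a..b})"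
  shows "smooth_on a b F"
proof -
  obtain D where D: "\<And>t. t \<in> {a..b} \<Longrightarrow> D 0 t = f t"
    "\<And>n t. t \<in> {a..b} \<Longrightarrow> (D n has_vector_derivative D (Suc n) t) (at t within {a..b})"
    using f unfolding smooth_on_def by blast
  show ?thesis unfolding smooth_on_def
    by (rule exI[of _ "case_nat F D"]) (use D F in \<open>auto split: nat.split\<close>)
qed

lemma smooth_on_cong:
  assumes "smooth_on a b f" "\<And>t. t \<in> {a..b} \<Longrightarrow> f t = g t" shows "smooth_on a b g"
  using assms unfolding smooth_on_def by auto

lemma smooth_on_subset:
  assumes "smooth_on a b f" "a \<le> c" "d \<le> b" shows "smooth_on c d f"
proof -
  obtain D where D: "\<And>t. t \<in> {a..b} \<Longrightarrow> D 0 t = f t"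
    "\<And>n t. t \<in> {a..b} \<Longrightarrow> (D n has_vector_derivative D (Suc n) t) (at t within {a..b})"
    using assms(1) unfolding smooth_on_def by blast
  have sub: "{c..d} \<subseteq> {a..b}" using assms by auto
  show ?thesis unfolding smooth_on_def
    by (rule exI[of _ D]) (use D sub in \<open>auto intro: has_vector_derivative_within_subset[OF _ sub]\<close>)
qed

lemma smooth_on_continuous: "smooth_on a b f \<Longrightarrow> continuous_on {a..b} f"
proof -
  assume "smooth_on a b f"
  then obtain f' where "\<And>t. t \<in> {a..b} \<Longrightarrow> (f has_vector_derivative f' t) (at t within {a..b})"
    using smooth_on_derivative by blast
  then show ?thesis unfolding continuous_on_eq_continuous_within
    using has_vector_derivative_continuous by blast
qed

lemma smooth_on_const: "smooth_on a b (\<lambda>t. c)"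
  unfolding smooth_on_def
  by (rule exI[of _ "\<lambda>n t. if n = 0 then c else 0"]) (auto simp: has_vector_derivative_const)

text \<open>Finite sums of products are closed under differentiation, which gives the Leibniz rule by coinduction.\<close>

inductive_set smooth_products :: "('u::real_normed_vector \<Rightarrow> 'v::real_normed_vector \<Rightarrow> 'w::real_normed_vector) \<Rightarrow> real \<Rightarrow> real \<Rightarrow> (real \<Rightarrow> 'w) set"
  for pr a b where
  prod: "smooth_on a b F \<Longrightarrow> smooth_on a b G \<Longrightarrow> (\<lambda>t. pr (F t) (G t)) \<in> smooth_products pr a b"
| add: "f \<in> smooth_products pr a b \<Longrightarrow> g \<in> smooth_products pr a b \<Longrightarrow> (\<lambda>t. f t + g t) \<in> smooth_products pr a b"

lemma smooth_products_derivative: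
  assumes pr: "bounded_bilinear pr" and "f \<in> smooth_products pr a b"
  shows "\<exists>f'\<in>smooth_products pr a b. \<forall>t\<in>{a..b}. (f has_vector_derivative f' t) (at t within {a..b})"
  using assms(2)
proof induction
  case (prod F G)
  obtain F' where F': "smooth_on a b F'" "\<And>t. t \<in> {a..b} \<Longrightarrow> (F has_vector_derivative F' t) (at t within {a..b})"
    using smooth_on_derivative[OF prod(1)] by blast
  obtain G' where G': "smooth_on a b G'" "\<And>t. t \<in> {a..b} \<Longrightarrow> (G has_vector_derivative G' t) (at t within {a..b})"
    using smooth_on_derivative[OF prod(2)] by blast
  show ?case
    by (rule bexI[of _ "\<lambda>t. pr (F t) (G' t) + pr (F' t) (G t)"])
      (auto intro!: bounded_bilinear.has_vector_derivative[OF pr] F' G' smooth_products.intros prod)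
next
  case (add f g)
  then obtain f' g' where "f' \<in> smooth_products pr a b" "g' \<in> smooth_products pr a b"
    "\<And>t. t \<in> {a..b} \<Longrightarrow> (f has_vector_derivative f' t) (at t within {a..b})"
    "\<And>t. t \<in> {a..b} \<Longrightarrow> (g has_vector_derivative g' t) (at t within {a..b})" by blast
  then show ?case
    by (intro bexI[of _ "\<lambda>t. f' t + g' t"]) (auto intro!: has_vector_derivative_add smooth_products.add)
qed

lemma smooth_on_bilinear:
  assumes "bounded_bilinear pr" "smooth_on a b F" "smooth_on a b G"
  shows "smooth_on a b (\<lambda>t. pr (F t) (G t))"
  by (rule smooth_on_coinduct[of _ "smooth_products pr a b"])
    (use smooth_products.prod[OF assms(2,3)] smooth_products_derivative[OF assms(1)] in auto)

lemmas smooth_on_mult = smooth_on_bilinear[OF bounded_bilinear_mult]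
lemmas smooth_on_scaleR = smooth_on_bilinear[OF bounded_bilinear_scaleR]

lemma smooth_on_add:
  assumes "smooth_on a b F" "smooth_on a b G" shows "smooth_on a b (\<lambda>t. F t + G t)"
proof -
  \<comment> \<open>The factor 1 turns each summand into a product, so that the sum falls under
    \<open>smooth_products\<close>.\<close>
  have F: "(\<lambda>t. 1 *\<^sub>R F t) \<in> smooth_products scaleR a b" and G: "(\<lambda>t. 1 *\<^sub>R G t) \<in> smooth_products scaleR a b"
    using smooth_products.prod[OF smooth_on_const[of a b "1::real"]] assms by blast+
  have "(\<lambda>t. F t + G t) \<in> smooth_products scaleR a b" using smooth_products.add[OF F G] by simp
  then show ?thesis
    by (rule smooth_on_coinduct) (rule smooth_products_derivative[OF bounded_bilinear_scaleR])
qed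

lemma smooth_on_linear:
  assumes "bounded_linear h" "smooth_on a b F" shows "smooth_on a b (\<lambda>t. h (F t))"
proof (rule smooth_on_coinduct[of _ "{\<lambda>t. h (F t) | F. smooth_on a b F}"])
  fix g assume "g \<in> {\<lambda>t. h (F t) | F. smooth_on a b F}"
  then obtain F where F: "g = (\<lambda>t. h (F t))" "smooth_on a b F" by blast
  obtain F' where F': "smooth_on a b F'" "\<And>t. t \<in> {a..b} \<Longrightarrow> (F has_vector_derivative F' t) (at t within {a..b})"
    using smooth_on_derivative[OF F(2)] by blast
  show "\<exists>g'\<in>{\<lambda>t. h (F t) | F. smooth_on a b F}. \<forall>t\<in>{a..b}. (g has_vector_derivative g' t) (at t within {a..b})"
    unfolding F(1)
    by (rule bexI[of _ "\<lambda>t. h (F' t)"]) (auto intro!: bounded_linear.has_vector_derivative[OF assms(1)] F')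
qed (use assms(2) in blast)

lemma smooth_on_diff:
  "smooth_on a b F \<Longrightarrow> smooth_on a b G \<Longrightarrow> smooth_on a b (\<lambda>t. F t - G t)"
  using smooth_on_add[OF _ smooth_on_linear[OF bounded_linear_minus[OF bounded_linear_ident]], of a b F G] by simp

lemma exp_scaleR_derivative:
  fixes x :: "'v::{real_normed_algebra_1,banach}"
  assumes "(f has_vector_derivative f') (at t within S)"
  shows "((\<lambda>t. exp (f t *\<^sub>R x)) has_vector_derivative f' *\<^sub>R (x * exp (f t *\<^sub>R x))) (at t within S)"
proof -
  have "((\<lambda>s. exp (s *\<^sub>R x)) has_vector_derivative exp (f t *\<^sub>R x) * x) (at (f t) within f ` S)"
    by (rule exp_scaleR_has_vector_derivative_right)
  from vector_diff_chain_within[OF assms this] show ?thesis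
    by (simp add: o_def exp_times_scaleR_commute)
qed

lemma continuous_on_exp_scaleR:
  fixes x :: "'v::{real_normed_algebra_1,banach}"
  assumes "continuous_on S f" shows "continuous_on S (\<lambda>t. exp (f t *\<^sub>R x))"
proof (rule continuous_on_compose2[OF _ assms subset_UNIV])
  show "continuous_on UNIV (\<lambda>r. exp (r *\<^sub>R x))"
    unfolding continuous_on_eq_continuous_within
    using has_vector_derivative_continuous[OF exp_scaleR_has_vector_derivative_right] by blast
qed

text \<open>Smooth multiples of the exponential are closed under differentiation; the coefficient
  \<open>G\<close> is replaced by the \<open>H\<close> of the proof.\<close>

lemma smooth_on_exp:
  fixes x :: "'v::{real_normed_algebra_1,banach}"
  assumes f: "smooth_on a b f" shows "smooth_on a b (\<lambda>t. exp (f t *\<^sub>R x))"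
proof (rule smooth_on_coinduct[of _ "{\<lambda>t. G t * exp (f t *\<^sub>R x) | G. smooth_on a b G}"])
  show "(\<lambda>t. exp (f t *\<^sub>R x)) \<in> {\<lambda>t. G t * exp (f t *\<^sub>R x) | G. smooth_on a b G}"
    by (rule CollectI, rule exI[of _ "\<lambda>t. 1"]) (simp add: smooth_on_const)
  fix g assume "g \<in> {\<lambda>t. G t * exp (f t *\<^sub>R x) | G. smooth_on a b G}"
  then obtain G where G: "g = (\<lambda>t. G t * exp (f t *\<^sub>R x))" "smooth_on a b G" by blast
  obtain f' where f': "smooth_on a b f'" "\<And>t. t \<in> {a..b} \<Longrightarrow> (f has_vector_derivative f' t) (at t within {a..b})"
    using smooth_on_derivative[OF f] by blast
  obtain G' where G': "smooth_on a b G'" "\<And>t. t \<in> {a..b} \<Longrightarrow> (G has_vector_derivative G' t) (at t within {a..b})"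
    using smooth_on_derivative[OF G(2)] by blast
  define H where "H t = f' t *\<^sub>R (G t * x) + G' t" for t
  have "smooth_on a b H" unfolding H_def
    by (intro smooth_on_add smooth_on_scaleR smooth_on_mult smooth_on_const f' G' G(2))
  moreover have "(g has_vector_derivative H t * exp (f t *\<^sub>R x)) (at t within {a..b})" if t: "t \<in> {a..b}" for t
  proof -
    have "(g has_vector_derivative G t * (f' t *\<^sub>R (x * exp (f t *\<^sub>R x))) + G' t * exp (f t *\<^sub>R x)) (at t within {a..b})"
      unfolding G(1) by (intro has_vector_derivative_mult exp_scaleR_derivative f' G' t)
    then show ?thesis by (simp add: H_def distrib_right mult.assoc)
  qed
  ultimately show "\<exists>g'\<in>{\<lambda>t. G t * exp (f t *\<^sub>R x) | G. smooth_on a b G}.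
      \<forall>t\<in>{a..b}. (g has_vector_derivative g' t) (at t within {a..b})"
    by (intro bexI[of _ "\<lambda>t. H t * exp (f t *\<^sub>R x)"] ballI CollectI exI[of _ H] conjI refl)
qed

lemma integral_le_spike:
  fixes f g :: "real \<Rightarrow> real"
  assumes S: "finite S" and f: "f integrable_on T" and g: "g integrable_on T"
    and le: "\<And>t. t \<in> T - S \<Longrightarrow> f t \<le> g t"
  shows "integral T f \<le> integral T g"
proof -
  define h where "h t = (if t \<in> S then g t else f t)" for t
  have "integral T f = integral T h"
    by (rule integral_spike[OF negligible_finite[OF S]]) (simp add: h_def)
  also have "h integrable_on T" by (rule integrable_spike_finite[OF S _ f]) (simp add: h_def)
  then have "integral T h \<le> integral T g"
    by (rule integral_le[OF _ g]) (use le in \<open>auto simp: h_def\<close>)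
  finally show ?thesis .
qed

section \<open>Partitions of the unit interval and piecewise regular functions\<close>

definition partition01 :: "nat \<Rightarrow> (nat \<Rightarrow> real) \<Rightarrow> bool"
  where "partition01 m s \<longleftrightarrow> s 0 = 0 \<and> s m = 1 \<and> (\<forall>i<m. s i < s (Suc i))"

text \<open>Agreement is asked on open pieces only, since a velocity is arbitrary at the break
  points, while continuity of \<open>H\<close> on the closed piece guarantees one-sided
  limits.\<close>

definition pieces_cont :: "nat \<Rightarrow> (nat \<Rightarrow> real) \<Rightarrow> (real \<Rightarrow> 'v::real_normed_vector) \<Rightarrow> bool"
  where "pieces_cont m s F \<longleftrightarrow> (\<forall>i<m. \<exists>H. continuous_on {s i..s (Suc i)} H \<and> (\<forall>t\<in>{s i<..<s (Suc i)}. F t = H t))"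

definition pieces_smooth :: "nat \<Rightarrow> (nat \<Rightarrow> real) \<Rightarrow> (real \<Rightarrow> 'v::real_normed_vector) \<Rightarrow> bool"
  where "pieces_smooth m s F \<longleftrightarrow> (\<forall>i<m. \<exists>H. smooth_on (s i) (s (Suc i)) H \<and> (\<forall>t\<in>{s i<..<s (Suc i)}. F t = H t))"

lemma pieces_smooth_cont: "pieces_smooth m s F \<Longrightarrow> pieces_cont m s F"
  unfolding pieces_smooth_def pieces_cont_def using smooth_on_continuous by blast

lemma pieces_smooth_bilinear:
  assumes "bounded_bilinear pr" "pieces_smooth m s F" "pieces_smooth m s G"
  shows "pieces_smooth m s (\<lambda>t. pr (F t) (G t))"
  unfolding pieces_smooth_def
proof (intro allI impI)
  fix i assume "i < m"
  then obtain H K where "smooth_on (s i) (s (Suc i)) H" "\<forall>t\<in>{s i<..<s (Suc i)}. F t = H t"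
    "smooth_on (s i) (s (Suc i)) K" "\<forall>t\<in>{s i<..<s (Suc i)}. G t = K t"
    using assms unfolding pieces_smooth_def by meson
  then show "\<exists>H. smooth_on (s i) (s (Suc i)) H \<and> (\<forall>t\<in>{s i<..<s (Suc i)}. pr (F t) (G t) = H t)"
    by (intro exI[of _ "\<lambda>t. pr (H t) (K t)"] conjI smooth_on_bilinear[OF assms(1)]) auto
qed

lemma pieces_smooth_linear:
  assumes "bounded_linear h" "pieces_smooth m s F" shows "pieces_smooth m s (\<lambda>t. h (F t))"
  unfolding pieces_smooth_def
proof (intro allI impI)
  fix i assume "i < m"
  then obtain H where "smooth_on (s i) (s (Suc i)) H" "\<forall>t\<in>{s i<..<s (Suc i)}. F t = H t"
    using assms unfolding pieces_smooth_def by meson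
  then show "\<exists>H. smooth_on (s i) (s (Suc i)) H \<and> (\<forall>t\<in>{s i<..<s (Suc i)}. h (F t) = H t)"
    by (intro exI[of _ "\<lambda>t. h (H t)"] conjI smooth_on_linear[OF assms(1)]) auto
qed

lemma pieces_smooth_add:
  assumes "pieces_smooth m s F" "pieces_smooth m s H" shows "pieces_smooth m s (\<lambda>t. F t + H t)"
  unfolding pieces_smooth_def
proof (intro allI impI)
  fix i assume "i < m"
  then obtain A B where "smooth_on (s i) (s (Suc i)) A" "\<forall>t\<in>{s i<..<s (Suc i)}. F t = A t"
    "smooth_on (s i) (s (Suc i)) B" "\<forall>t\<in>{s i<..<s (Suc i)}. H t = B t"
    using assms unfolding pieces_smooth_def by meson
  then show "\<exists>K. smooth_on (s i) (s (Suc i)) K \<and> (\<forall>t\<in>{s i<..<s (Suc i)}. F t + H t = K t)"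
    by (intro exI[of _ "\<lambda>t. A t + B t"] conjI smooth_on_add) auto
qed

lemma pieces_cont_compose2:
  fixes F :: "real \<Rightarrow> real" and G :: "real \<Rightarrow> real"
  assumes h: "continuous_on UNIV (\<lambda>z. h (fst z) (snd z) :: real)" and "pieces_cont m s F" "pieces_cont m s G"
  shows "pieces_cont m s (\<lambda>t. h (F t) (G t))"
  unfolding pieces_cont_def
proof (intro allI impI)
  fix i assume "i < m"
  then obtain H K where "continuous_on {s i..s (Suc i)} H" "\<forall>t\<in>{s i<..<s (Suc i)}. F t = H t"
    "continuous_on {s i..s (Suc i)} K" "\<forall>t\<in>{s i<..<s (Suc i)}. G t = K t"
    using assms(2,3) unfolding pieces_cont_def by meson
  moreover from this have "continuous_on {s i..s (Suc i)} (\<lambda>t. h (H t) (K t))"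
    using continuous_on_compose2[OF h, of "{s i..s (Suc i)}" "\<lambda>t. (H t, K t)"]
    by (simp add: continuous_on_Pair)
  ultimately show "\<exists>H. continuous_on {s i..s (Suc i)} H \<and> (\<forall>t\<in>{s i<..<s (Suc i)}. h (F t) (G t) = H t)"
    by (intro exI[of _ "\<lambda>t. h (H t) (K t)"]) auto
qed

lemma pieces_cont_add:
  fixes F G :: "real \<Rightarrow> real"
  shows "pieces_cont m s F \<Longrightarrow> pieces_cont m s G \<Longrightarrow> pieces_cont m s (\<lambda>t. F t + G t)"
  by (rule pieces_cont_compose2) (intro continuous_intros)

lemma pieces_cont_mult:
  fixes F G :: "real \<Rightarrow> real"
  shows "pieces_cont m s F \<Longrightarrow> pieces_cont m s G \<Longrightarrow> pieces_cont m s (\<lambda>t. F t * G t)"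
  by (rule pieces_cont_compose2) (intro continuous_intros)

lemma pieces_cont_sqrt:
  assumes "pieces_cont m s F" shows "pieces_cont m s (\<lambda>t. sqrt (F t))"
  by (rule pieces_cont_compose2[of "\<lambda>x y. sqrt x" m s F F]) (intro continuous_intros assms)+

lemma pieces_cont_const: "pieces_cont m s (\<lambda>t. c)"
  unfolding pieces_cont_def by (auto intro!: exI[of _ "\<lambda>t. c"] continuous_on_const)

context
  fixes m s assumes part: "partition01 m s"
begin

lemma partition_step: "i < m \<Longrightarrow> s i < s (Suc i)"
  using part by (simp add: partition01_def)

lemma partition_mono: "i \<le> j \<Longrightarrow> j \<le> m \<Longrightarrow> s i \<le> s j"
proof (induction j)
  case (Suc j)
  show ?case
  proof (cases "i = Suc j")
    case False
    then have "s i \<le> s j" using Suc by simp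
    also have "s j < s (Suc j)" using Suc.prems by (intro partition_step) simp
    finally show ?thesis by simp
  qed simp
qed simp

lemma partition_bounds: "i \<le> m \<Longrightarrow> 0 \<le> s i \<and> s i \<le> 1"
  using partition_mono[of 0 i] partition_mono[of i m] part by (simp add: partition01_def)

lemma partition_cover: assumes "t \<in> {0..1}" shows "\<exists>i<m. s i \<le> t \<and> t \<le> s (Suc i)"
proof -
  have "k \<le> m \<Longrightarrow> 0 < k \<Longrightarrow> t \<le> s k \<Longrightarrow> \<exists>i<k. s i \<le> t \<and> t \<le> s (Suc i)" for k
  proof (induction k)
    case (Suc k)
    show ?case
    proof (cases "t \<le> s k \<and> 0 < k")
      case True
      then show ?thesis using Suc by (meson Suc_leD less_SucI)
    next
      case False
      then have "s k \<le> t" using assms part by (cases "k = 0") (auto simp: partition01_def)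
      then show ?thesis using Suc.prems by blast
    qed
  qed simp
  moreover have "0 < m" using part by (cases m) (auto simp: partition01_def)
  ultimately show ?thesis using assms part by (auto simp: partition01_def)
qed

lemma partition_cover_open:
  assumes "t \<in> {0..1} - s ` {..m}" shows "\<exists>i<m. s i < t \<and> t < s (Suc i)"
proof -
  obtain i where i: "i < m" "s i \<le> t" "t \<le> s (Suc i)" using partition_cover assms by blast
  moreover have "t \<noteq> s i" "t \<noteq> s (Suc i)" using assms i(1) by auto
  ultimately show ?thesis by (intro exI[of _ i]) auto
qed

lemma pieces_cont_integrable_piece:
  fixes F :: "real \<Rightarrow> real"
  assumes F: "pieces_cont m s F" "i < m" shows "F integrable_on {s i..s (Suc i)}"
proof -
  obtain H where H: "continuous_on {s i..s (Suc i)} H" "\<forall>t\<in>{s i<..<s (Suc i)}. F t = H t"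
    using F unfolding pieces_cont_def by blast
  show ?thesis
  proof (rule integrable_spike_finite[of "{s i, s (Suc i)}"])
    show "H integrable_on {s i..s (Suc i)}" by (rule integrable_continuous_real[OF H(1)])
    show "F t = H t" if "t \<in> {s i..s (Suc i)} - {s i, s (Suc i)}" for t using H(2) that by auto
  qed simp
qed

lemma pieces_cont_integrable:
  fixes F :: "real \<Rightarrow> real"
  assumes F: "pieces_cont m s F" shows "F integrable_on {0..1}"
proof -
  have "k \<le> m \<Longrightarrow> F integrable_on {s 0..s k}" for k
  proof (induction k)
    case 0
    show ?case using integrable_on_refl[of F "s 0"] by simp
  next
    case (Suc k)
    have "s 0 \<le> s k" "s k \<le> s (Suc k)" using partition_mono[of 0 k] partition_mono[of k "Suc k"] Suc.prems by simp_all
    moreover have "F integrable_on {s 0..s k}" using Suc by simp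
    moreover have "F integrable_on {s k..s (Suc k)}"
      using Suc.prems by (intro pieces_cont_integrable_piece[OF F]) simp
    ultimately show ?case by (rule Henstock_Kurzweil_Integration.integrable_combine)
  qed
  from this[of m] show ?thesis using part by (simp add: partition01_def)
qed

lemma pieces_cont_integrable_sub:
  fixes F :: "real \<Rightarrow> real"
  assumes "pieces_cont m s F" "0 \<le> a" "b \<le> 1" shows "F integrable_on {a..b}"
  using integrable_subinterval_real[OF pieces_cont_integrable[OF assms(1)], of a b] assms(2,3) by simp

text \<open>The representative \<open>H\<close> supplies the derivative at the end points of the
  piece as well, which smoothness on the closed piece demands.\<close>

lemma pieces_cont_integral_derivative:
  fixes F :: "real \<Rightarrow> real"
  assumes F: "pieces_cont m s F" and i: "i < m"
    and H: "continuous_on {s i..s (Suc i)} H" "\<forall>t\<in>{s i<..<s (Suc i)}. F t = H t"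
    and t: "t \<in> {s i..s (Suc i)}"
  shows "((\<lambda>u. integral {0..u} F) has_vector_derivative H t) (at t within {s i..s (Suc i)})"
proof (rule has_vector_derivative_transform[OF t])
  show "((\<lambda>u. integral {0..s i} F + integral {s i..u} H) has_vector_derivative H t) (at t within {s i..s (Suc i)})"
    using has_vector_derivative_add[OF has_vector_derivative_const integral_has_vector_derivative[OF H(1) t]]
    by simp
  fix u assume u: "u \<in> {s i..s (Suc i)}"
  have b: "0 \<le> s i" "s (Suc i) \<le> 1" using partition_bounds[of i] partition_bounds[of "Suc i"] i by simp_all
  have "integral {0..s i} F + integral {s i..u} F = integral {0..u} F"
    using u b by (intro Henstock_Kurzweil_Integration.integral_combine pieces_cont_integrable_sub[OF F]) auto
  moreover have "integral {s i..u} F = integral {s i..u} H"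
    by (rule integral_spike[of "{s i, s (Suc i)}"]) (use u H(2) in auto)
  ultimately show "integral {0..u} F = integral {0..s i} F + integral {s i..u} H" by simp
qed

lemma pieces_cont_integral_derivative_at:
  fixes F :: "real \<Rightarrow> real"
  assumes F: "pieces_cont m s F" and t: "t \<in> {0..1} - s ` {..m}"
  shows "((\<lambda>u. integral {0..u} F) has_vector_derivative F t) (at t)"
proof -
  obtain i where i: "i < m" "s i < t" "t < s (Suc i)" using partition_cover_open[OF t] by blast
  obtain H where H: "continuous_on {s i..s (Suc i)} H" "\<forall>t\<in>{s i<..<s (Suc i)}. F t = H t"
    using F i(1) unfolding pieces_cont_def by blast
  have "((\<lambda>u. integral {0..u} F) has_vector_derivative H t) (at t within {s i..s (Suc i)})"
    using i by (intro pieces_cont_integral_derivative[OF F i(1) H]) auto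
  then show ?thesis using i H(2) by (simp add: at_within_Icc_at)
qed

lemma pieces_smooth_integral:
  fixes F :: "real \<Rightarrow> real"
  assumes F: "pieces_smooth m s F" and i: "i < m"
  shows "smooth_on (s i) (s (Suc i)) (\<lambda>u. integral {0..u} F)"
proof -
  obtain H where H: "smooth_on (s i) (s (Suc i)) H" "\<forall>t\<in>{s i<..<s (Suc i)}. F t = H t"
    using F i unfolding pieces_smooth_def by blast
  show ?thesis
    by (rule smooth_on_antiderivative[OF H(1)])
      (intro pieces_cont_integral_derivative[OF pieces_smooth_cont[OF F] i smooth_on_continuous[OF H(1)] H(2)])
qed

lemma pieces_cont_integral_continuous:
  fixes F :: "real \<Rightarrow> real"
  assumes F: "pieces_cont m s F" shows "continuous_on {0..1} (\<lambda>u. integral {0..u} F)"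
  by (rule indefinite_integral_continuous_1[OF pieces_cont_integrable[OF F]])

text \<open>Every new piece lies in an old one and on one side of \<open>b\<close>, so a function
  with a kink at \<open>b\<close> can be smooth on all of them.\<close>

lemma partition_split:
  assumes j: "j < m" "s j < b" "b < s (Suc j)"
  shows "\<exists>s'. partition01 (Suc m) s' \<and>
    (\<forall>i<Suc m. \<exists>k<m. s k \<le> s' i \<and> s' (Suc i) \<le> s (Suc k) \<and> (s' (Suc i) \<le> b \<or> b \<le> s' i))"
proof -
  define s' where "s' i = (if i \<le> j then s i else if i = Suc j then b else s (i - 1))" for i
  have "partition01 (Suc m) s'"
    unfolding partition01_def
  proof (intro conjI allI impI)
    show "s' 0 = 0" "s' (Suc m) = 1" using part j by (auto simp: s'_def partition01_def)
    fix i assume i: "i < Suc m"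
    consider "i < j" | "i = j" | "i = Suc j" | "Suc j < i" by linarith
    then show "s' i < s' (Suc i)"
    proof cases
      case 4
      then have "s (i - 1) < s (Suc (i - 1))" using i by (intro partition_step) auto
      then show ?thesis using 4 by (simp add: s'_def)
    qed (use j partition_step in \<open>auto simp: s'_def\<close>)
  qed
  moreover have "\<exists>k<m. s k \<le> s' i \<and> s' (Suc i) \<le> s (Suc k) \<and> (s' (Suc i) \<le> b \<or> b \<le> s' i)" if i: "i < Suc m" for i
  proof -
    consider "i < j" | "i = j" | "i = Suc j" | "Suc j < i" by linarith
    then show ?thesis
    proof cases
      case 1
      then have "s (Suc i) \<le> s j" using j by (intro partition_mono) auto
      then show ?thesis using 1 j by (intro exI[of _ i]) (auto simp: s'_def)
    next
      case 2
      then show ?thesis using j by (intro exI[of _ j]) (auto simp: s'_def)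
    next
      case 3
      then show ?thesis using j by (intro exI[of _ j]) (auto simp: s'_def)
    next
      case 4
      then have "s (Suc j) \<le> s (i - 1)" using i by (intro partition_mono) auto
      then show ?thesis using 4 j i by (intro exI[of _ "i - 1"]) (auto simp: s'_def)
    qed
  qed
  ultimately show ?thesis by blast
qed

end

section \<open>Geodesics\<close>

lemma quadratic_nonneg_imp_zero:
  fixes A K :: real
  assumes "\<And>\<sigma>. 0 \<le> \<sigma> * A + \<sigma>\<^sup>2 * K" shows "A = 0"
proof (rule ccontr)
  assume A: "A \<noteq> 0"
  \<comment> \<open>A positive bound for \<open>K\<close>, which may itself be zero or negative;
    \<sigma> below minimizes the quadratic with \<open>L\<close> in place of
    \<open>K\<close>.\<close>
  define L where "L = \<bar>K\<bar> + 1"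
  have L: "0 < L" "K \<le> L" by (simp_all add: L_def)
  define \<sigma> where "\<sigma> = - A / (2 * L)"
  have "0 \<le> \<sigma> * A + \<sigma>\<^sup>2 * K" by (rule assms)
  also have "\<dots> \<le> \<sigma> * A + \<sigma>\<^sup>2 * L" using L by (intro add_left_mono mult_left_mono) auto
  also have "\<dots> = - A\<^sup>2 / (4 * L)" using L by (simp add: \<sigma>_def field_simps power2_eq_square)
  also have "\<dots> < 0" using A L by (simp add: divide_neg_pos)
  finally show False by simp
qed

text \<open>\<open>x\<close> commutes with its exponential, so the exponentials can be pulled out.
  As conjugation by a unitary preserves the 2-norm, only the inner bracket will count for the
  speed.\<close>

lemma conj_exp_derivative:
  fixes x :: "'v::{real_normed_algebra_1,banach}"
  assumes f: "(f has_vector_derivative f') (at t within S)" and c: "(c has_vector_derivative c') (at t within S)"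
  shows "((\<lambda>t. exp (f t *\<^sub>R x) * c t * exp (f t *\<^sub>R (- x))) has_vector_derivative
    exp (f t *\<^sub>R x) * (c' + f' *\<^sub>R (x * c t - c t * x)) * exp (f t *\<^sub>R (- x))) (at t within S)"
proof -
  let ?e = "exp (f t *\<^sub>R x)" and ?d = "exp (f t *\<^sub>R (- x))"
  have "((\<lambda>t. exp (f t *\<^sub>R x) * c t * exp (f t *\<^sub>R (- x))) has_vector_derivative
      (?e * c t) * (f' *\<^sub>R (- x * ?d)) + (?e * c' + f' *\<^sub>R (x * ?e) * c t) * ?d) (at t within S)"
    by (intro has_vector_derivative_mult exp_scaleR_derivative f c)
  moreover have "x * ?e = ?e * x" by (rule exp_times_scaleR_commute[symmetric])
  ultimately show ?thesis by (simp add: algebra_simps)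
qed

lemma exp_scaleR_inverse:
  fixes x :: "'v::{real_normed_algebra_1,banach}"
  shows "exp (r *\<^sub>R x) * exp (r *\<^sub>R (- x)) = 1" "exp (r *\<^sub>R (- x)) * exp (r *\<^sub>R x) = 1"
  using exp_minus_inverse[of "r *\<^sub>R x"] exp_minus_inverse[of "r *\<^sub>R (- x)"] by simp_all

lemma velocity_eq:
  assumes "(f has_vector_derivative D) (at t within {0..1})" "t \<in> {0..1}" shows "velocity f t = D"
  unfolding velocity_def using vector_derivative_within_cbox[of 0 1 t f D] assms by simp

lemma velocity_cong:
  assumes "\<And>t. t \<in> {0..1} \<Longrightarrow> f t = g t" "t \<in> {0..1}" shows "velocity f t = velocity g t"
proof -
  have "(f has_vector_derivative D) (at t within {0..1}) \<longleftrightarrow> (g has_vector_derivative D) (at t within {0..1})" for D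
    using has_vector_derivative_transform[OF assms(2), of f g D] has_vector_derivative_transform[OF assms(2), of g f D] assms(1)
    by auto
  then show ?thesis by (simp add: velocity_def vector_derivative_def)
qed

lemma geodesic_cong:
  assumes "geodesic \<tau> M p \<alpha>" "\<And>t. t \<in> {0..1} \<Longrightarrow> \<alpha> t = \<beta> t" shows "geodesic \<tau> M p \<beta>"
proof -
  have 1: "velocity \<alpha> t = velocity \<beta> t" if "t \<in> {0..1}" for t by (rule velocity_cong[OF assms(2) that])
  have 2: "velocity (velocity \<alpha>) t = velocity (velocity \<beta>) t" if "t \<in> {0..1}" for t
    by (rule velocity_cong[OF 1 that])
  have "smooth_on 0 1 \<beta>" using assms unfolding geodesic_def by (blast intro: smooth_on_cong)
  moreover have "\<beta> ` {0..1} = \<alpha> ` {0..1}" by (rule image_cong) (simp_all add: assms(2))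
  ultimately show ?thesis
    using assms(1) 2 assms(2) by (simp add: geodesic_def covariant_derivative_def)
qed

section \<open>The trace form on tangent vectors and exponential geodesics\<close>

context subfactor
begin

text \<open>With \<open>T.uw_ext\<close> in place of \<tau> the functional is bounded and linear on
  all operators, so it can be applied to smooth curves whose values are not known to lie in
  \<open>M1\<close>.\<close>

definition "R x = Re (T.uw_ext x)"

lemma bounded_linear_R: "bounded_linear R"
  unfolding R_def by (rule bounded_linear_compose[OF bounded_linear_Re T.bounded_linear_uw_ext])

lemmas R_add = linear_add[OF bounded_linear.linear[OF bounded_linear_R]]
lemmas R_scale = linear_scale[OF bounded_linear.linear[OF bounded_linear_R]]

lemma R_tau: "x \<in> M1 \<Longrightarrow> R x = Re (\<tau> x)" by (simp add: R_def T.uw_ext)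

lemma norm2_R: "x \<in> M1 \<Longrightarrow> adj x = x \<Longrightarrow> norm2 \<tau> x = sqrt (R (x * x))"
  by (simp add: norm2_def R_tau T.times_closed)

lemma R_sq_nonneg: "x \<in> M1 \<Longrightarrow> adj x = x \<Longrightarrow> 0 \<le> R (x * x)"
  using T.tr_nonneg[of x] by (simp add: R_tau T.times_closed)

lemma norm2_unitary:
  assumes u: "u \<in> unitaries M" and x: "x \<in> M1" shows "norm2 \<tau> (u * x * adj u) = norm2 \<tau> x"
proof -
  note uM = unitaries_M[OF u]
  have "adj (u * x * adj u) * (u * x * adj u) = u * (adj x * (adj u * u) * x * adj u)" by (simp add: mult.assoc)
  also have "\<dots> = u * (adj x * x * adj u)" using uM by simp
  finally have "\<tau> (adj (u * x * adj u) * (u * x * adj u)) = \<tau> (u * (adj x * x * adj u))" by simp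
  also have "\<dots> = \<tau> (adj x * x * adj u * u)"
    using uM x by (intro T.tr_commute) (simp_all add: T.alg_closed M_M1)
  also have "adj x * x * adj u * u = adj x * x" using uM by (simp add: mult.assoc)
  finally show ?thesis by (simp add: norm2_def)
qed

lemma commutator_facts:
  assumes "q \<in> orbit M p" "x \<in> M" "adj x = - x"
  shows "x * q - q * x \<in> M1" "adj (x * q - q * x) = x * q - q * x"
  using assms orbit_M1[OF assms(1)] orbit_proj(2)[OF assms(1)]
  by (simp_all add: T.alg_closed M_M1)

text \<open>Of the four terms of the product, two contain \<open>q * z * q\<close> up to a cyclic
  permutation and vanish; the Markov property evaluates the other two.\<close>

lemma tau_commutators:
  assumes q: "q \<in> orbit M p" and z: "z \<in> M" "q * z * q = 0" and x: "x \<in> M"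
  shows "\<tau> ((z * q - q * z) * (x * q - q * x)) = - 2 * of_real lam * \<tau> (z * x)"
proof -
  note cl = T.alg_closed M_M1[OF z(1)] M_M1[OF x] orbit_M1[OF q]
  have qq: "q * (q * v) = q * v" for v by (simp only: mult.assoc[symmetric] orbit_proj(1)[OF q])
  have "(z * q - q * z) * (x * q - q * x)
      = (z * q * x * q - z * q * x) - (q * z * x * q - q * z * q * x)"
    by (simp add: algebra_simps qq)
  then have "\<tau> ((z * q - q * z) * (x * q - q * x))
      = (\<tau> (z * q * x * q) - \<tau> (z * q * x)) - (\<tau> (q * z * x * q) - \<tau> (q * z * q * x))"
    by (simp only: T.tr_minus cl)
  also have "\<tau> (z * q * x * q) = \<tau> (q * z * q * x)"
  proof -
    have "\<tau> (z * q * x * q) = \<tau> (q * (z * q * x))" by (rule T.tr_commute) (simp_all add: cl)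
    then show ?thesis by (simp only: mult.assoc)
  qed
  also have "\<tau> (q * z * x * q) = \<tau> (q * (z * x))"
  proof -
    have "\<tau> (q * z * x * q) = \<tau> (q * (q * z * x))" by (rule T.tr_commute) (simp_all add: cl)
    also have "q * (q * z * x) = q * (z * x)" by (simp only: mult.assoc[symmetric] orbit_proj(1)[OF q])
    finally show ?thesis .
  qed
  also have "\<tau> (z * q * x) = \<tau> (q * (x * z))"
  proof -
    have "\<tau> (z * (q * x)) = \<tau> (q * x * z)" by (rule T.tr_commute) (simp_all add: cl)
    then show ?thesis by (simp only: mult.assoc)
  qed
  also have "\<tau> (q * (x * z)) = of_real lam * \<tau> (x * z)" by (intro tau_orbit[OF q] times_closed x z)
  also have "\<tau> (q * (z * x)) = of_real lam * \<tau> (z * x)" by (intro tau_orbit[OF q] times_closed x z)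
  also have "\<tau> (x * z) = \<tau> (z * x)" by (rule T.tr_commute) (simp_all add: cl)
  finally show ?thesis by (simp add: z(2) T.tr_zero)
qed

lemma exp_antiherm:
  assumes "z \<in> M" "adj z = - z"
  shows "exp (r *\<^sub>R z) \<in> unitaries M" "adj (exp (r *\<^sub>R z)) = exp (r *\<^sub>R (- z))"
  using assms exp_unitary[of "r *\<^sub>R z"] by (simp_all add: scaleR_closed adj_exp)

text \<open>The acceleration is a double commutator with \<open>z\<close>. Paired with a tangent
  vector generated by \<open>x\<close>, it reduces through the Jacobi identity and
  \<open>tau_commutators\<close> to a multiple of \<open>\<tau> (z * (x * z - z * x))\<close>, which
  vanishes by traciality.\<close>

lemma geodesic_exp:
  assumes q: "q \<in> orbit M p" and z: "z \<in> M" "adj z = - z" "q * z * q = 0"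
  shows "geodesic \<tau> M p (\<lambda>t. exp (t *\<^sub>R z) * q * exp (t *\<^sub>R (- z)))" (is "geodesic _ _ _ ?\<alpha>")
proof -
  have comm: "exp (t *\<^sub>R z) * z = z * exp (t *\<^sub>R z)" "exp (t *\<^sub>R (- z)) * z = z * exp (t *\<^sub>R (- z))" for t
    using exp_times_scaleR_commute[of t z] exp_times_scaleR_commute[of t "- z"] by simp_all
  have orb: "?\<alpha> t \<in> orbit M p" for t
    using orbit_conj[OF q exp_antiherm(1)[OF z(1,2)], of t] by (simp add: exp_antiherm(2)[OF z(1,2)])
  have ezq: "?\<alpha> t * z * ?\<alpha> t = 0" for t
  proof -
    let ?e = "exp (t *\<^sub>R z)" and ?d = "exp (t *\<^sub>R (- z))"
    have "?\<alpha> t * z * ?\<alpha> t = ?e * q * (?d * z) * ?e * q * ?d" by (simp only: mult.assoc)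
    also have "\<dots> = ?e * q * z * (?d * ?e) * q * ?d" by (simp only: comm mult.assoc)
    also have "\<dots> = ?e * (q * z * q) * ?d" by (simp only: exp_scaleR_inverse mult_1_right) (simp only: mult.assoc)
    finally show ?thesis by (simp add: z(3))
  qed
  have d: "(?\<alpha> has_vector_derivative z * ?\<alpha> t - ?\<alpha> t * z) (at t within S)" for t S
  proof -
    have "(?\<alpha> has_vector_derivative exp (t *\<^sub>R z) * (0 + 1 *\<^sub>R (z * q - q * z)) * exp (t *\<^sub>R (- z))) (at t within S)"
      by (rule conj_exp_derivative[of "\<lambda>t. t", OF has_vector_derivative_id has_vector_derivative_const])
    moreover have "exp (t *\<^sub>R z) * (0 + 1 *\<^sub>R (z * q - q * z)) * exp (t *\<^sub>R (- z)) = z * ?\<alpha> t - ?\<alpha> t * z"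
    proof -
      let ?e = "exp (t *\<^sub>R z)" and ?d = "exp (t *\<^sub>R (- z))"
      have "?e * (0 + 1 *\<^sub>R (z * q - q * z)) * ?d = (?e * z) * q * ?d - ?e * q * (z * ?d)"
        by (simp add: right_diff_distrib left_diff_distrib mult.assoc)
      also have "\<dots> = (z * ?e) * q * ?d - ?e * q * (?d * z)" by (simp only: comm)
      finally show ?thesis by (simp only: mult.assoc)
    qed
    ultimately show ?thesis by simp
  qed
  have v: "velocity ?\<alpha> t = z * ?\<alpha> t - ?\<alpha> t * z" if "t \<in> {0..1}" for t
    by (rule velocity_eq[OF d that])
  have vv: "velocity (velocity ?\<alpha>) t = z * (z * ?\<alpha> t - ?\<alpha> t * z) - (z * ?\<alpha> t - ?\<alpha> t * z) * z" if t: "t \<in> {0..1}" for t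
  proof -
    have "velocity (velocity ?\<alpha>) t = velocity (\<lambda>t. z * ?\<alpha> t - ?\<alpha> t * z) t" by (rule velocity_cong[OF v t])
    also have "\<dots> = z * (z * ?\<alpha> t - ?\<alpha> t * z) - (z * ?\<alpha> t - ?\<alpha> t * z) * z"
      by (rule velocity_eq[OF _ t]) (intro has_vector_derivative_diff d
          bounded_linear.has_vector_derivative[OF bounded_linear_mult_left]
          bounded_linear.has_vector_derivative[OF bounded_linear_mult_right])
    finally show ?thesis .
  qed
  have "covariant_derivative \<tau> M ?\<alpha> (velocity ?\<alpha>) t = 0" if t: "t \<in> {0..1}" for t
  proof -
    define r where "r = ?\<alpha> t"
    define X where "X = velocity (velocity ?\<alpha>) t"
    have rO: "r \<in> orbit M p" unfolding r_def by (rule orb)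
    have rz: "r * z * r = 0" unfolding r_def by (rule ezq)
    have X: "X = z * (z * r - r * z) - (z * r - r * z) * z" unfolding X_def r_def by (rule vv[OF t])
    note cl = T.alg_closed M_M1[OF z(1)] orbit_M1[OF rO]
    have X1: "X \<in> M1" by (simp add: X cl)
    have orth: "\<tau> (adj w * X) = 0" if w: "w \<in> tangent_space M r" for w
    proof -
      obtain x where x: "x \<in> M" "adj x = - x" "w = x * r - r * x" using w by (auto simp: tangent_space_def)
      note cl = cl M_M1[OF x(1)]
      have adjw: "adj w = w" unfolding x(3) by (rule commutator_facts(2)[OF rO x(1,2)])
      have com: "\<tau> (w * (z * d)) - \<tau> (w * (d * z)) = \<tau> ((w * z - z * w) * d)" if d: "d \<in> M1" for d
      proof -
        have w1: "w \<in> M1" by (simp add: x(3) cl)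
        have "\<tau> (w * (d * z)) = \<tau> ((w * d) * z)" by (simp only: mult.assoc)
        also have "\<dots> = \<tau> (z * (w * d))" by (rule T.tr_commute) (simp_all add: w1 d cl)
        finally have "\<tau> (w * (z * d)) - \<tau> (w * (d * z)) = \<tau> (w * (z * d) - z * (w * d))"
          by (simp add: T.tr_minus w1 d cl)
        then show ?thesis by (simp only: left_diff_distrib mult.assoc)
      qed
      define d where "d = z * r - r * z"
      have d1: "d \<in> M1" by (simp add: d_def cl)
      have w1: "w \<in> M1" by (simp add: x(3) cl)
      define y where "y = x * z - z * x"
      have yM: "y \<in> M" using x z by (simp add: y_def alg_closed)
      have "\<tau> (adj w * X) = \<tau> (w * (z * d)) - \<tau> (w * (d * z))"
        by (simp add: X adjw d_def[symmetric] right_diff_distrib T.tr_minus w1 d1 cl)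
      also have "\<dots> = \<tau> ((w * z - z * w) * d)" by (rule com[OF d1])
      \<comment> \<open>Jacobi identity for the commutator of \<open>w\<close> with
        \<open>z\<close>, where \<open>w\<close> is the commutator of \<open>x\<close> with
        \<open>r\<close>.\<close>
      also have "w * z - z * w = (y * r - r * y) - (x * d - d * x)"
        by (simp add: x(3) y_def d_def algebra_simps)
      also have "((y * r - r * y) - (x * d - d * x)) * d = (y * r - r * y) * d - (x * d * d - d * x * d)"
        by (simp only: left_diff_distrib)
      also have "\<tau> \<dots> = \<tau> ((y * r - r * y) * d) - (\<tau> (x * d * d) - \<tau> (d * x * d))"
        using yM by (simp add: T.tr_minus d1 cl M_M1)
      also have "\<tau> (d * x * d) = \<tau> (x * d * d)"
        using T.tr_commute[of d "x * d"] by (simp add: d1 cl mult.assoc)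
      also have "\<tau> ((y * r - r * y) * d) = \<tau> (d * (y * r - r * y))"
        using yM by (intro T.tr_commute) (simp_all add: d1 cl M_M1)
      also have "\<dots> = - 2 * of_real lam * \<tau> (z * y)"
        unfolding d_def by (rule tau_commutators[OF rO z(1) rz yM])
      also have "\<tau> (z * y) = 0"
      proof -
        have "\<tau> (z * y) = \<tau> (z * (x * z)) - \<tau> (z * (z * x))" by (simp add: y_def right_diff_distrib T.tr_minus cl)
        also have "\<tau> (z * (z * x)) = \<tau> ((z * x) * z)" by (rule T.tr_commute) (simp_all add: cl)
        finally show ?thesis by (simp add: mult.assoc)
      qed
      finally show ?thesis by simp
    qed
    have "tangent_proj \<tau> M r X = 0" unfolding tangent_proj_def
    proof (rule the_equality)
      show "0 \<in> tangent_space M r \<and> (\<forall>w\<in>tangent_space M r. \<tau> (adj w * (X - 0)) = 0)"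
        using orth by (auto simp: tangent_space_def intro!: exI[of _ 0] zero_closed)
      \<comment> \<open>A competing tangent vector is orthogonal to \<open>X\<close> by
        \<open>orth\<close> and to \<open>X - y\<close> by assumption, hence to itself.\<close>
      fix y assume y: "y \<in> tangent_space M r \<and> (\<forall>w\<in>tangent_space M r. \<tau> (adj w * (X - y)) = 0)"
      then obtain x where x: "x \<in> M" "adj x = - x" "y = x * r - r * x" by (auto simp: tangent_space_def)
      have y1: "y \<in> M1" unfolding x(3) by (rule commutator_facts(1)[OF rO x(1,2)])
      have "\<tau> (adj y * (X - y)) = \<tau> (adj y * X) - \<tau> (adj y * y)"
        by (simp add: right_diff_distrib T.tr_minus y1 X1 T.alg_closed)
      then have "\<tau> (adj y * y) = 0" using y orth[of y] by simp
      then show "y = 0" by (rule T.tr_faithful[OF y1])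
    qed
    then show ?thesis by (simp add: covariant_derivative_def r_def X_def)
  qed
  moreover have "smooth_on 0 1 ?\<alpha>"
  proof -
    have "smooth_on 0 1 (\<lambda>t::real. t)"
      by (rule smooth_on_antiderivative[OF smooth_on_const[of 0 1 1]]) (rule has_vector_derivative_id)
    then show ?thesis by (intro smooth_on_mult smooth_on_exp smooth_on_const)
  qed
  ultimately show ?thesis using orb by (auto simp: geodesic_def)
qed

end

section \<open>First variation of length\<close>

locale short_in_orbit = subfactor M \<Omega> N tN for M :: "'a::complex_hilbert bop set" and \<Omega> N tN +
  fixes \<gamma> :: "real \<Rightarrow> 'a bop" and m :: nat and s :: "nat \<Rightarrow> real"
  assumes part: "partition01 m s"
    and smooth: "\<And>i. i < m \<Longrightarrow> smooth_on (s i) (s (Suc i)) \<gamma>"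
    and orbit: "\<And>t. t \<in> {0..1} \<Longrightarrow> \<gamma> t \<in> orbit M p"
    and minimal: "\<And>\<beta>. piecewise_smooth_in (orbit M p) \<beta> \<Longrightarrow> \<beta> 0 = \<gamma> 0 \<Longrightarrow> \<beta> 1 = \<gamma> 1 \<Longrightarrow>
      length2 \<tau> \<gamma> \<le> length2 \<tau> \<beta>"
begin

abbreviation "g \<equiv> velocity \<gamma>"
text \<open>The break points include 0 and 1, so every parameter in \<open>G\<close> is interior to
  a piece and admits two-sided derivatives.\<close>

abbreviation "G \<equiv> {0..1} - s ` {..m}"

text \<open>The field along the curve given by the infinitesimal action of \<open>x\<close> on the
  orbit.\<close>

definition "V x t = x * \<gamma> t - \<gamma> t * x"
text \<open>
  At the break points \<open>velocity \<gamma>\<close> is arbitrary, so there \<open>w\<close> may even be negative (the square root of a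
  negative real is negative); all statements are therefore restricted to \<open>G\<close>.
\<close>

definition "w t = sqrt (R (g t * g t))"

lemma piece_velocity:
  assumes i: "i < m" shows "\<exists>H. smooth_on (s i) (s (Suc i)) H \<and>
    (\<forall>t\<in>{s i<..<s (Suc i)}. (\<gamma> has_vector_derivative g t) (at t) \<and> g t = H t)"
proof -
  obtain H where H: "smooth_on (s i) (s (Suc i)) H"
    "\<And>t. t \<in> {s i..s (Suc i)} \<Longrightarrow> (\<gamma> has_vector_derivative H t) (at t within {s i..s (Suc i)})"
    using smooth_on_derivative[OF smooth[OF i]] by blast
  have "(\<gamma> has_vector_derivative g t) (at t) \<and> g t = H t" if t: "t \<in> {s i<..<s (Suc i)}" for t
  proof -
    have d: "(\<gamma> has_vector_derivative H t) (at t)" using H(2)[of t] t by (simp add: at_within_Icc_at)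
    have "t \<in> {0..1}" using t partition_bounds[OF part, of i] partition_bounds[OF part, of "Suc i"] i by auto
    then have "g t = H t" by (intro velocity_eq has_vector_derivative_at_within[OF d])
    then show ?thesis using d by simp
  qed
  with H(1) show ?thesis by blast
qed

lemma smooth_g: "pieces_smooth m s g"
  unfolding pieces_smooth_def using piece_velocity by blast

lemma smooth_\<gamma>: "pieces_smooth m s \<gamma>"
  unfolding pieces_smooth_def using smooth by blast

lemma smooth_V: "pieces_smooth m s (V x)"
  unfolding V_def[abs_def]
  by (rule pieces_smooth_linear[OF bounded_linear_sub[OF bounded_linear_mult_right bounded_linear_mult_left] smooth_\<gamma>])

lemma smooth_R_mult:
  "pieces_smooth m s F \<Longrightarrow> pieces_smooth m s H \<Longrightarrow> pieces_smooth m s (\<lambda>t. R (F t * H t))"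
  by (rule pieces_smooth_linear[OF bounded_linear_R]) (rule pieces_smooth_bilinear[OF bounded_bilinear_mult])

lemma cont_w: "pieces_cont m s w"
  unfolding w_def by (intro pieces_cont_sqrt pieces_smooth_cont smooth_R_mult smooth_g)

lemma g_derivative: assumes "t \<in> G" shows "(\<gamma> has_vector_derivative g t) (at t)"
  using partition_cover_open[OF part assms] piece_velocity by (meson greaterThanLessThan_iff)

lemma g_tangent: assumes "t \<in> G"
  shows "\<exists>z\<in>M. adj z = - z \<and> \<gamma> t * z * \<gamma> t = 0 \<and> g t = z * \<gamma> t - \<gamma> t * z"
proof (rule orbit_tangent[of "{0..1}"])
  show "(\<gamma> has_vector_derivative g t) (at t within {0..1})"
    by (rule has_vector_derivative_at_within[OF g_derivative[OF assms]])
  show "t \<in> {0..1}" using assms by blast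
  then show "t islimpt {0..1}" by (simp add: islimpt_Icc)
qed (rule orbit)

lemma g_facts: assumes "t \<in> G" shows "g t \<in> M1" "adj (g t) = g t"
proof -
  obtain z where z: "z \<in> M" "adj z = - z" "g t = z * \<gamma> t - \<gamma> t * z" using g_tangent[OF assms] by blast
  have "\<gamma> t \<in> orbit M p" using assms orbit by blast
  from commutator_facts[OF this z(1,2)] show "g t \<in> M1" "adj (g t) = g t" by (simp_all only: z(3))
qed

lemma V_facts: assumes "t \<in> G" "x \<in> M" "adj x = - x" shows "V x t \<in> M1" "adj (V x t) = V x t"
  using commutator_facts[OF orbit assms(2,3), of t] assms(1) by (simp_all add: V_def)

lemma w_sq: "t \<in> G \<Longrightarrow> (w t)\<^sup>2 = R (g t * g t)"
  using R_sq_nonneg[OF g_facts] by (simp add: w_def)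

lemma w_nonneg: "t \<in> G \<Longrightarrow> 0 \<le> w t"
  using R_sq_nonneg[OF g_facts] by (simp add: w_def)

lemma w_norm2: "t \<in> G \<Longrightarrow> norm2 \<tau> (g t) = w t"
  using norm2_R[OF g_facts] by (simp add: w_def)

lemma w_zero: "t \<in> G \<Longrightarrow> w t = 0 \<Longrightarrow> g t = 0"
  using T.norm2_zero[OF g_facts(1)] w_norm2 by simp

lemma finite_breaks: "finite (s ` {..m})" by simp

lemma length2_w: "length2 \<tau> \<gamma> = integral {0..1} w"
  unfolding length2_def by (rule integral_spike[OF negligible_finite[OF finite_breaks]]) (simp add: w_norm2)

text \<open>\<open>W\<close> is the accumulated energy. \<open>I\<close> integrates the momentum
  weighted by the speed, which is the first-order change of length when the rate of rotation is
  proportional to the squared speed.\<close>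

definition "W t = integral {0..t} (\<lambda>t. R (g t * g t))"
definition "I x t = integral {0..t} (\<lambda>t. w t * R (g t * V x t))"

text \<open>An upper bound is what a comparison with a minimizer needs. It comes from the
  arithmetic-geometric mean inequality between the new speed and \<open>w t\<close>; the squared
  speed in the perturbation cancels the division by \<open>w t\<close>, so the bound also holds
  where the curve pauses.\<close>

lemma speed_perturbed:
  assumes t: "t \<in> G" and x: "x \<in> M" "adj x = - x"
  shows "sqrt (R ((g t + (\<sigma> * R (g t * g t)) *\<^sub>R V x t) * (g t + (\<sigma> * R (g t * g t)) *\<^sub>R V x t)))
    \<le> w t + \<sigma> * (w t * R (g t * V x t)) + \<sigma>\<^sup>2 * (w t * w t * w t * R (V x t * V x t) / 2)"
proof -
  define r where "r = \<sigma> * R (g t * g t)"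
  define h where "h = R (g t * V x t)"
  define v where "v = R (V x t * V x t)"
  have "R (V x t * g t) = h"
    using g_facts[OF t] V_facts[OF t x] T.tr_commute[of "V x t" "g t"] by (simp add: h_def R_tau T.times_closed)
  moreover have "R (g t * g t) = w t * w t" using w_sq[OF t] by (simp add: power2_eq_square)
  ultimately have e: "R ((g t + r *\<^sub>R V x t) * (g t + r *\<^sub>R V x t)) = (w t)\<^sup>2 + 2 * r * h + r\<^sup>2 * v"
    by (simp add: distrib_left distrib_right R_add R_scale h_def v_def power2_eq_square algebra_simps)
  have r: "r = \<sigma> * (w t)\<^sup>2" by (simp add: r_def w_sq[OF t])
  have "sqrt ((w t)\<^sup>2 + 2 * r * h + r\<^sup>2 * v) \<le> w t + \<sigma> * (w t * h) + \<sigma>\<^sup>2 * (w t * w t * w t * v / 2)"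
  proof (cases "w t = 0")
    case True
    then show ?thesis by (simp add: r)
  next
    case False
    then have w: "0 < w t" using w_nonneg[OF t] by simp
    define y where "y = (w t)\<^sup>2 + 2 * r * h + r\<^sup>2 * v"
    have "g t + r *\<^sub>R V x t \<in> M1" "adj (g t + r *\<^sub>R V x t) = g t + r *\<^sub>R V x t"
      using g_facts[OF t] V_facts[OF t x] by (simp_all add: T.alg_closed)
    from R_sq_nonneg[OF this] have y0: "0 \<le> y" by (simp only: e y_def)
    have "0 \<le> (sqrt y - w t)\<^sup>2" by simp
    then have "2 * w t * sqrt y \<le> (w t)\<^sup>2 + y" using y0 by (simp add: power2_diff algebra_simps)
    then have "sqrt y \<le> ((w t)\<^sup>2 + y) / (2 * w t)" using w by (simp add: field_simps)
    also have "\<dots> = w t + \<sigma> * (w t * h) + \<sigma>\<^sup>2 * (w t * w t * w t * v / 2)"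
      using w by (simp add: y_def r field_simps power2_eq_square)
    finally show ?thesis by (simp only: y_def)
  qed
  then show ?thesis by (simp only: r_def[symmetric] e h_def v_def)
qed

text \<open>
  The variation is \<open>\<beta> = e\<^sup>f\<^sup>x \<gamma> e\<^sup>-\<^sup>f\<^sup>x\<close>, whose speed is \<open>\<parallel>\<gamma>' + f' [x, \<gamma>]\<parallel>\<close>. Choosing \<open>f'\<close> proportional to
  the square of the speed of \<open>\<gamma>\<close> avoids the points where the norm is not differentiable, and a jump of
  \<open>f'\<close> at \<open>b\<close> is harmless because corners are allowed.
\<close>

lemma variation_bound:
  assumes x: "x \<in> M" "adj x = - x" and b: "b \<in> G"
  shows "\<exists>K. \<forall>\<sigma>. length2 \<tau> \<gamma> \<le> length2 \<tau> \<gamma> + (\<sigma> * (W 1 * I x b - W b * I x 1) + \<sigma>\<^sup>2 * K)"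
proof -
  define u where "u t = w t * R (g t * V x t)" for t
  define k where "k t = w t * w t * w t * R (V x t * V x t) / 2" for t
  have cw2: "pieces_smooth m s (\<lambda>t. R (g t * g t))" by (intro smooth_R_mult smooth_g)
  have cu: "pieces_cont m s u"
    unfolding u_def by (intro pieces_cont_mult cw2 pieces_smooth_cont[OF smooth_R_mult] cont_w smooth_g smooth_V)
  have ck: "pieces_cont m s k"
  proof -
    have "pieces_cont m s (\<lambda>t. (w t * w t * w t * R (V x t * V x t)) * (1/2))"
      by (intro pieces_cont_mult pieces_cont_const pieces_smooth_cont[OF smooth_R_mult] cont_w smooth_V)
    then show ?thesis by (simp add: k_def[abs_def])
  qed
  obtain j where j: "j < m" "s j < b" "b < s (Suc j)" using partition_cover_open[OF part b] by blast
  have b01: "0 \<le> b" "b \<le> 1" using b by auto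
  obtain s' where s': "partition01 (Suc m) s'"
    "\<And>i. i < Suc m \<Longrightarrow> \<exists>k<m. s k \<le> s' i \<and> s' (Suc i) \<le> s (Suc k) \<and> (s' (Suc i) \<le> b \<or> b \<le> s' i)"
    using partition_split[OF part j] by blast
  \<comment> \<open>Slopes of the variation before and after \<open>b\<close>, relative to the
    energy. They are chosen so that \<open>c1 * W b + c2 * (W 1 - W b) = 0\<close>, which makes
    \<open>f\<close> vanish again at 1.\<close>
  define c1 where "c1 = W 1 - W b"
  define c2 where "c2 = - W b"
  define K where "K = c1\<^sup>2 * integral {0..b} k + c2\<^sup>2 * integral {b..1} k"
  have "length2 \<tau> \<gamma> \<le> length2 \<tau> \<gamma> + (\<sigma> * (W 1 * I x b - W b * I x 1) + \<sigma>\<^sup>2 * K)" for \<sigma>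
  proof -
    define f where "f t = \<sigma> * (W 1 * W (min t b) - W b * W t)" for t
    define \<beta> where "\<beta> t = exp (f t *\<^sub>R x) * \<gamma> t * exp (f t *\<^sub>R (- x))" for t
    have W0: "W 0 = 0" by (simp add: W_def)
    have f01: "f 0 = 0" "f 1 = 0" using b01 by (simp_all add: f_def W0)
    have \<beta>01: "\<beta> 0 = \<gamma> 0" "\<beta> 1 = \<gamma> 1" by (simp_all add: \<beta>_def f01)
    have WS: "smooth_on (s i) (s (Suc i)) W" if "i < m" for i
      unfolding W_def by (rule pieces_smooth_integral[OF part cw2 that])
    have "smooth_on (s' i) (s' (Suc i)) \<beta>" if i: "i < Suc m" for i
    proof -
      obtain k where k: "k < m" "s k \<le> s' i" "s' (Suc i) \<le> s (Suc k)" "s' (Suc i) \<le> b \<or> b \<le> s' i"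
        using s'(2)[OF i] by blast
      have W': "smooth_on (s' i) (s' (Suc i)) W" by (rule smooth_on_subset[OF WS[OF k(1)] k(2,3)])
      have \<gamma>': "smooth_on (s' i) (s' (Suc i)) \<gamma>" by (rule smooth_on_subset[OF smooth[OF k(1)] k(2,3)])
      have f': "smooth_on (s' i) (s' (Suc i)) f" using k(4)
      proof
        assume "s' (Suc i) \<le> b"
        then have "\<sigma> * (W 1 * W t - W b * W t) = f t" if "t \<in> {s' i..s' (Suc i)}" for t
          using that by (simp add: f_def min_absorb1)
        moreover have "smooth_on (s' i) (s' (Suc i)) (\<lambda>t. \<sigma> * (W 1 * W t - W b * W t))"
          by (intro smooth_on_mult smooth_on_diff smooth_on_const W')
        ultimately show ?thesis by (rule smooth_on_cong[rotated])
      next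
        assume "b \<le> s' i"
        then have "\<sigma> * (W 1 * W b - W b * W t) = f t" if "t \<in> {s' i..s' (Suc i)}" for t
          using that by (simp add: f_def min_absorb2)
        moreover have "smooth_on (s' i) (s' (Suc i)) (\<lambda>t. \<sigma> * (W 1 * W b - W b * W t))"
          by (intro smooth_on_mult smooth_on_diff smooth_on_const W')
        ultimately show ?thesis by (rule smooth_on_cong[rotated])
      qed
      show ?thesis unfolding \<beta>_def by (intro smooth_on_mult smooth_on_exp f' \<gamma>')
    qed
    then have "piecewise_smooth \<beta>"
      using s'(1) unfolding piecewise_smooth_def partition01_def
      by (intro exI[of _ "Suc m"] exI[of _ s']) simp
    moreover have "\<beta> t \<in> orbit M p" if "t \<in> {0..1}" for t
      unfolding \<beta>_def using orbit_conj[OF orbit[OF that] exp_antiherm(1)[OF x], of "f t"]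
      by (simp only: exp_antiherm(2)[OF x])
    ultimately have "piecewise_smooth_in (orbit M p) \<beta>" by (auto simp: piecewise_smooth_in_def)
    then have min: "length2 \<tau> \<gamma> \<le> length2 \<tau> \<beta>" using \<beta>01 by (rule minimal)
    define F where "F c t = sqrt (R ((g t + (c * R (g t * g t)) *\<^sub>R V x t) * (g t + (c * R (g t * g t)) *\<^sub>R V x t)))" for c t
    have F_vel: "norm2 \<tau> (velocity \<beta> t) = F (\<sigma> * c) t"
      if t: "t \<in> G" and f: "(f has_vector_derivative \<sigma> * (c * R (g t * g t))) (at t)" for c t
    proof -
      define r where "r = \<sigma> * (c * R (g t * g t))"
      have t01: "t \<in> {0..1}" using t by blast
      have "(\<beta> has_vector_derivative exp (f t *\<^sub>R x) * (g t + r *\<^sub>R (x * \<gamma> t - \<gamma> t * x)) * exp (f t *\<^sub>R (- x))) (at t within {0..1})"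
        unfolding \<beta>_def r_def
        by (intro conj_exp_derivative has_vector_derivative_at_within[OF f] has_vector_derivative_at_within[OF g_derivative[OF t]])
      then have v: "velocity \<beta> t = exp (f t *\<^sub>R x) * (g t + r *\<^sub>R V x t) * adj (exp (f t *\<^sub>R x))"
        unfolding V_def exp_antiherm(2)[OF x] by (rule velocity_eq[OF _ t01])
      have 1: "g t + r *\<^sub>R V x t \<in> M1" "adj (g t + r *\<^sub>R V x t) = g t + r *\<^sub>R V x t"
        using g_facts[OF t] V_facts[OF t x] by (simp_all add: T.alg_closed)
      have "norm2 \<tau> (velocity \<beta> t) = norm2 \<tau> (g t + r *\<^sub>R V x t)"
        unfolding v by (rule norm2_unitary[OF exp_antiherm(1)[OF x] 1(1)])
      also have "\<dots> = F (\<sigma> * c) t" unfolding norm2_R[OF 1] by (simp only: F_def r_def mult.assoc)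
      finally show ?thesis .
    qed
    have Wd: "(W has_vector_derivative R (g t * g t)) (at t)" if "t \<in> G" for t
      unfolding W_def by (rule pieces_cont_integral_derivative_at[OF part pieces_smooth_cont[OF cw2] that])
    have F1: "norm2 \<tau> (velocity \<beta> t) = F (\<sigma> * c1) t" if t: "t \<in> {0..b} - insert b (s ` {..m})" for t
    proof (rule F_vel)
      show tG: "t \<in> G" using t b01 by auto
      have "((\<lambda>t. \<sigma> * (c1 * W t)) has_vector_derivative \<sigma> * (c1 * R (g t * g t))) (at t)"
        by (intro has_vector_derivative_mult_right Wd tG)
      then show "(f has_vector_derivative \<sigma> * (c1 * R (g t * g t))) (at t)"
      proof (rule has_vector_derivative_transform_within_open[of _ _ _ "{..<b}"])
        show "\<sigma> * (c1 * W y) = f y" if "y \<in> {..<b}" for y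
          using that by (simp add: f_def c1_def left_diff_distrib)
      qed (use t in auto)
    qed
    have F2: "norm2 \<tau> (velocity \<beta> t) = F (\<sigma> * c2) t" if t: "t \<in> {b..1} - insert b (s ` {..m})" for t
    proof (rule F_vel)
      show tG: "t \<in> G" using t b01 by auto
      have "((\<lambda>t. \<sigma> * (W 1 * W b + c2 * W t)) has_vector_derivative \<sigma> * (0 + c2 * R (g t * g t))) (at t)"
        by (intro has_vector_derivative_mult_right has_vector_derivative_add has_vector_derivative_const Wd tG)
      then have "((\<lambda>t. \<sigma> * (W 1 * W b + c2 * W t)) has_vector_derivative \<sigma> * (c2 * R (g t * g t))) (at t)" by simp
      then show "(f has_vector_derivative \<sigma> * (c2 * R (g t * g t))) (at t)"
      proof (rule has_vector_derivative_transform_within_open[of _ _ _ "{b<..}"])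
        show "\<sigma> * (W 1 * W b + c2 * W y) = f y" if "y \<in> {b<..}" for y
          using that by (simp add: f_def c2_def)
      qed (use t in auto)
    qed
    have cF: "pieces_cont m s (F c)" for c
    proof -
      have "pieces_smooth m s (\<lambda>t. g t + (c * R (g t * g t)) *\<^sub>R V x t)"
      proof -
        have 1: "pieces_smooth m s (\<lambda>t. (\<lambda>r. c * r) (R (g t * g t)))"
          by (intro pieces_smooth_linear[OF _ cw2] bounded_linear_mult_right)
        show ?thesis by (intro pieces_smooth_add smooth_g pieces_smooth_bilinear[OF bounded_bilinear_scaleR 1] smooth_V)
      qed
      then show ?thesis unfolding F_def by (intro pieces_cont_sqrt pieces_smooth_cont smooth_R_mult)
    qed
    note int = pieces_cont_integrable_sub[OF part]
    have bound: "integral {d..e} (F (\<sigma> * c)) \<le>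
        integral {d..e} w + \<sigma> * (c * integral {d..e} u) + \<sigma>\<^sup>2 * (c\<^sup>2 * integral {d..e} k)"
      if de: "0 \<le> d" "e \<le> 1" for d e c
    proof -
      let ?B = "\<lambda>t. w t + (\<sigma> * c) * u t + (\<sigma> * c)\<^sup>2 * k t"
      have cB: "pieces_cont m s ?B" by (intro pieces_cont_add pieces_cont_mult pieces_cont_const cont_w cu ck)
      have "integral {d..e} (F (\<sigma> * c)) \<le> integral {d..e} ?B"
      proof (rule integral_le_spike[OF finite_breaks])
        show "F (\<sigma> * c) t \<le> ?B t" if "t \<in> {d..e} - s ` {..m}" for t
          unfolding F_def u_def k_def using speed_perturbed[OF _ x, of t "\<sigma> * c"] that de by auto
      qed (rule int[OF cF de] int[OF cB de])+
      also have "\<dots> = integral {d..e} w + (\<sigma> * c) * integral {d..e} u + (\<sigma> * c)\<^sup>2 * integral {d..e} k"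
        using int[OF cont_w de] int[OF cu de] int[OF ck de]
        by (simp add: Henstock_Kurzweil_Integration.integral_add integrable_add integrable_on_mult_right)
      finally show ?thesis by (simp add: power_mult_distrib mult.assoc)
    qed
    have comb: "integral {0..b} F' + integral {b..1} F' = integral {0..1} F'" if "pieces_cont m s F'" for F' :: "real \<Rightarrow> real"
      by (intro Henstock_Kurzweil_Integration.integral_combine b01 pieces_cont_integrable[OF part that])
    have "length2 \<tau> \<beta> = integral {0..b} (\<lambda>t. norm2 \<tau> (velocity \<beta> t)) + integral {b..1} (\<lambda>t. norm2 \<tau> (velocity \<beta> t))"
    proof -
      have "(\<lambda>t. norm2 \<tau> (velocity \<beta> t)) integrable_on {0..b}"
        by (rule integrable_spike_finite[of "insert b (s ` {..m})", OF _ F1 int[OF cF]]) (simp_all add: b01)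
      moreover have "(\<lambda>t. norm2 \<tau> (velocity \<beta> t)) integrable_on {b..1}"
        by (rule integrable_spike_finite[of "insert b (s ` {..m})", OF _ F2 int[OF cF]]) (simp_all add: b01)
      ultimately have "(\<lambda>t. norm2 \<tau> (velocity \<beta> t)) integrable_on {0..1}"
        by (rule Henstock_Kurzweil_Integration.integrable_combine[OF b01])
      then show ?thesis unfolding length2_def
        by (intro Henstock_Kurzweil_Integration.integral_combine[symmetric] b01)
    qed
    also have "integral {0..b} (\<lambda>t. norm2 \<tau> (velocity \<beta> t)) = integral {0..b} (F (\<sigma> * c1))"
      by (rule integral_spike[OF negligible_finite[of "insert b (s ` {..m})"]]) (simp_all add: F1)
    also have "integral {b..1} (\<lambda>t. norm2 \<tau> (velocity \<beta> t)) = integral {b..1} (F (\<sigma> * c2))"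
      by (rule integral_spike[OF negligible_finite[of "insert b (s ` {..m})"]]) (simp_all add: F2)
    finally have "length2 \<tau> \<beta> \<le> (integral {0..b} w + \<sigma> * (c1 * integral {0..b} u) + \<sigma>\<^sup>2 * (c1\<^sup>2 * integral {0..b} k))
      + (integral {b..1} w + \<sigma> * (c2 * integral {b..1} u) + \<sigma>\<^sup>2 * (c2\<^sup>2 * integral {b..1} k))"
      using bound[of 0 b c1] bound[of b 1 c2] b01 by simp
    also have "\<dots> = length2 \<tau> \<gamma> + (\<sigma> * (W 1 * I x b - W b * I x 1) + \<sigma>\<^sup>2 * K)"
    proof -
      \<comment> \<open>The first-order terms collapse to the bracket of the claim; the second-order
        ones form \<open>K\<close>, which does not depend on \<sigma>.\<close>
      have 1: "integral {0..b} w + integral {b..1} w = length2 \<tau> \<gamma>" by (simp only: length2_w comb[OF cont_w])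
      have 2: "integral {b..1} u = I x 1 - I x b" "integral {0..b} u = I x b"
        using comb[OF cu] by (simp_all add: I_def u_def[abs_def])
      have 3: "c1 * I x b + c2 * (I x 1 - I x b) = W 1 * I x b - W b * I x 1"
        by (simp add: c1_def c2_def algebra_simps)
      show ?thesis unfolding 1[symmetric] 2 3[symmetric] K_def by (simp add: algebra_simps)
    qed
    finally show ?thesis using min by linarith
  qed
  then show ?thesis by blast
qed

text \<open>Since \<sigma> takes both signs in \<open>variation_bound\<close>,
  \<open>W 1 * I x t = W t * I x 1\<close> at every regular \<open>t\<close>. This holds on an
  interval around \<open>b\<close> and can be differentiated there; dividing by the squared speed
  leaves a momentum per unit speed that is independent of time.\<close>

lemma euler_lagrange:
  assumes x: "x \<in> M" "adj x = - x" and b: "b \<in> G"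
  shows "W 1 * (w b * R (g b * V x b)) = R (g b * g b) * I x 1"
proof -
  have eq: "W 1 * I x t = W t * I x 1" if t: "t \<in> G" for t
  proof -
    obtain K where K: "\<And>\<sigma>. length2 \<tau> \<gamma> \<le> length2 \<tau> \<gamma> + (\<sigma> * (W 1 * I x t - W t * I x 1) + \<sigma>\<^sup>2 * K)"
      using variation_bound[OF x t] by blast
    have "W 1 * I x t - W t * I x 1 = 0"
      by (rule quadratic_nonneg_imp_zero[of _ K]) (use K in \<open>simp add: le_add_same_cancel1\<close>)
    then show ?thesis by simp
  qed
  obtain j where j: "j < m" "s j < b" "b < s (Suc j)" using partition_cover_open[OF part b] by blast
  have inG: "t \<in> G" if "t \<in> {s j<..<s (Suc j)}" for t
  proof -
    have "t \<noteq> s i" if "i \<le> m" for i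
    proof (cases "i \<le> j")
      case True
      then have "s i \<le> s j" using j(1) by (intro partition_mono[OF part]) auto
      then show ?thesis using \<open>t \<in> {s j<..<s (Suc j)}\<close> by auto
    next
      case False
      then have "s (Suc j) \<le> s i" using that by (intro partition_mono[OF part]) auto
      then show ?thesis using \<open>t \<in> {s j<..<s (Suc j)}\<close> by auto
    qed
    moreover have "t \<in> {0..1}"
      using that partition_bounds[OF part, of j] partition_bounds[OF part, of "Suc j"] j(1) by auto
    ultimately show ?thesis by blast
  qed
  have "pieces_cont m s (\<lambda>t. w t * R (g t * V x t))"
    by (intro pieces_cont_mult cont_w pieces_smooth_cont[OF smooth_R_mult] smooth_g smooth_V)
  then have "(I x has_vector_derivative w b * R (g b * V x b)) (at b)"
    unfolding I_def by (rule pieces_cont_integral_derivative_at[OF part _ b])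
  then have 1: "((\<lambda>t. W 1 * I x t) has_vector_derivative W 1 * (w b * R (g b * V x b))) (at b)"
    by (rule has_vector_derivative_mult_right)
  have "(W has_vector_derivative R (g b * g b)) (at b)"
    unfolding W_def by (intro pieces_cont_integral_derivative_at[OF part _ b] pieces_smooth_cont smooth_R_mult smooth_g)
  then have "((\<lambda>t. W t * I x 1) has_vector_derivative R (g b * g b) * I x 1) (at b)"
    by (rule has_vector_derivative_mult_left)
  then have "((\<lambda>t. W 1 * I x t) has_vector_derivative R (g b * g b) * I x 1) (at b)"
    by (rule has_vector_derivative_transform_within_open[of _ _ _ "{s j<..<s (Suc j)}"])
      (use j eq[OF inG] in auto)
  with 1 show ?thesis by (rule vector_derivative_unique_at)
qed

end

section \<open>From the conservation law to a one-parameter group\<close>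

context short_in_orbit
begin

lemma integral_pieces_mono:
  assumes F: "pieces_cont m s F" "\<And>t. t \<in> G \<Longrightarrow> (0::real) \<le> F t" and ab: "0 \<le> a" "a \<le> b" "b \<le> 1"
  shows "integral {0..a} F \<le> integral {0..b} F"
proof -
  have "integral {a..b} (\<lambda>t. 0) \<le> integral {a..b} F"
    by (rule integral_le_spike[OF finite_breaks])
      (use ab F in \<open>auto intro: pieces_cont_integrable_sub[OF part F(1)]\<close>)
  moreover have "integral {0..a} F + integral {a..b} F = integral {0..b} F"
    using ab by (intro Henstock_Kurzweil_Integration.integral_combine pieces_cont_integrable_sub[OF part F(1)]) auto
  ultimately show ?thesis by simp
qed

text \<open>The primitive is monotone with equal end values, hence zero; its derivative at a regular
  parameter gives the pointwise statement.\<close>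

lemma integral_pieces_zero:
  assumes F: "pieces_cont m s F" "\<And>t. t \<in> G \<Longrightarrow> (0::real) \<le> F t" and 0: "integral {0..1} F = 0"
  shows "t \<in> {0..1} \<Longrightarrow> integral {0..t} F = 0" and "t \<in> G \<Longrightarrow> F t = 0"
proof -
  show z: "integral {0..t} F = 0" if "t \<in> {0..1}" for t
    using integral_pieces_mono[OF F, of 0 t] integral_pieces_mono[OF F, of t 1] that 0 by simp
  assume t: "t \<in> G"
  obtain j where j: "j < m" "s j < t" "t < s (Suc j)" using partition_cover_open[OF part t] by blast
  have "((\<lambda>u. integral {0..u} F) has_vector_derivative F t) (at t)"
    by (rule pieces_cont_integral_derivative_at[OF part F(1) t])
  then have "((\<lambda>u. 0) has_vector_derivative F t) (at t)"
  proof (rule has_vector_derivative_transform_within_open[of _ _ _ "{s j<..<s (Suc j)}"])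
    show "integral {0..u} F = 0" if "u \<in> {s j<..<s (Suc j)}" for u
      using that partition_bounds[OF part, of j] partition_bounds[OF part, of "Suc j"] j by (intro z) auto
  qed (use j in auto)
  then show "F t = 0" by (rule vector_derivative_unique_at[OF _ has_vector_derivative_const])
qed

lemma continuous_\<gamma>: "continuous_on {0..1} \<gamma>"
proof -
  have "continuous_on (\<Union>i\<in>{..<m}. {s i..s (Suc i)}) \<gamma>"
    by (rule continuous_on_closed_Union) (use smooth smooth_on_continuous in auto)
  moreover have "{0..1} \<subseteq> (\<Union>i\<in>{..<m}. {s i..s (Suc i)})"
  proof
    fix t :: real assume "t \<in> {0..1}"
    then obtain i where "i < m" "s i \<le> t" "t \<le> s (Suc i)" using partition_cover[OF part] by blast
    then show "t \<in> (\<Union>i\<in>{..<m}. {s i..s (Suc i)})" by auto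
  qed
  ultimately show ?thesis by (rule continuous_on_subset)
qed

lemma R_commutators:
  assumes t: "t \<in> G" and z: "z \<in> M" "\<gamma> t * z * \<gamma> t = 0" and g: "g t = z * \<gamma> t - \<gamma> t * z"
    and x: "x \<in> M" "adj x = - x"
  shows "R (g t * V x t) = - 2 * lam * Re (\<tau> (z * x))"
proof -
  have "\<gamma> t \<in> orbit M p" using t orbit by blast
  from tau_commutators[OF this z x(1)]
  have "Re (\<tau> (g t * V x t)) = - 2 * lam * Re (\<tau> (z * x))" by (simp add: g V_def)
  then show ?thesis using g_facts(1)[OF t] V_facts(1)[OF t x] by (simp add: R_tau T.times_closed)
qed

lemma constant_generator:
  assumes t0: "t0 \<in> G" "w t0 \<noteq> 0"
  shows "\<exists>z\<in>M. adj z = - z \<and> \<gamma> t0 * z * \<gamma> t0 = 0 \<and> (\<forall>t\<in>G. g t = w t *\<^sub>R (z * \<gamma> t - \<gamma> t * z))"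
proof -
  obtain z0 where z0: "z0 \<in> M" "adj z0 = - z0" "\<gamma> t0 * z0 * \<gamma> t0 = 0" "g t0 = z0 * \<gamma> t0 - \<gamma> t0 * z0"
    using g_tangent[OF t0(1)] by blast
  define z where "z = (1 / w t0) *\<^sub>R z0"
  have z: "z \<in> M" "adj z = - z" "\<gamma> t0 * z * \<gamma> t0 = 0" using z0 by (simp_all add: z_def scaleR_closed)
  have cw2: "pieces_cont m s (\<lambda>t. R (g t * g t))" by (intro pieces_smooth_cont smooth_R_mult smooth_g)
  have W1: "W 1 \<noteq> 0"
  proof
    assume "W 1 = 0"
    then have "R (g t0 * g t0) = 0"
      unfolding W_def by (intro integral_pieces_zero(2)[OF cw2 _ _ t0(1)] R_sq_nonneg g_facts)
    then show False using w_sq[OF t0(1)] t0(2) by simp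
  qed
  have momentum: "R (g t * V x t) / w t = I x 1 / W 1" if "t \<in> G" "w t \<noteq> 0" "x \<in> M" "adj x = - x" for t x
  proof -
    have "w t * (W 1 * R (g t * V x t)) = w t * (w t * I x 1)"
      using euler_lagrange[OF that(3,4,1)] w_sq[OF that(1)] by (simp add: power2_eq_square mult_ac)
    then have "W 1 * R (g t * V x t) = w t * I x 1" using that(2) by simp
    then show ?thesis using W1 that(2) by (simp add: field_simps)
  qed
  have "g t = w t *\<^sub>R (z * \<gamma> t - \<gamma> t * z)" if t: "t \<in> G" for t
  proof (cases "w t = 0")
    case True
    then show ?thesis using w_zero[OF t] by simp
  next
    case False
    obtain y where y: "y \<in> M" "adj y = - y" "\<gamma> t * y * \<gamma> t = 0" "g t = y * \<gamma> t - \<gamma> t * y"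
      using g_tangent[OF t] by blast
    \<comment> \<open>The normalized generators at \<open>t\<close> and at \<open>t0\<close> have
      the same pairing with every antihermitian element of \<open>M\<close>. Their difference
      \<open>d\<close> is such an element, and testing with it gives the vanishing of
      \<open>norm2 \<tau> d\<close>.\<close>
    define d where "d = (1 / w t) *\<^sub>R y - z"
    have d: "d \<in> M" "adj d = - d" using y z by (simp_all add: d_def alg_closed)
    have "R (g t * V d t) / w t = R (g t0 * V d t0) / w t0"
      using momentum[OF t False d] momentum[OF t0 d] by simp
    then have "- 2 * lam * Re (\<tau> (y * d)) / w t = - 2 * lam * Re (\<tau> (z0 * d)) / w t0"
      by (simp only: R_commutators[OF t y(1,3,4) d] R_commutators[OF t0(1) z0(1,3,4) d])
    then have "(2 * lam) * (Re (\<tau> (y * d)) / w t) = (2 * lam) * (Re (\<tau> (z0 * d)) / w t0)" by simp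
    then have eq: "Re (\<tau> (y * d)) / w t = Re (\<tau> (z0 * d)) / w t0"
      using lam_pos unfolding mult_cancel_left by simp
    have "adj d * d = z * d - (1 / w t) *\<^sub>R (y * d)"
      by (simp add: d(2)) (simp add: d_def left_diff_distrib)
    then have "\<tau> (adj d * d) = \<tau> (z * d) - of_real (1 / w t) * \<tau> (y * d)"
      using z y d by (simp only: T.tr_minus T.tr_scaleR T.alg_closed M_M1)
    moreover have "\<tau> (z * d) = of_real (1 / w t0) * \<tau> (z0 * d)"
      using T.tr_scaleR[of "z0 * d" "1 / w t0"] z0 d by (simp add: z_def T.times_closed M_M1)
    ultimately have "Re (\<tau> (adj d * d)) = 0" using eq by simp
    then have "norm2 \<tau> d = 0" by (simp add: norm2_def)
    then have "d = 0" by (rule T.norm2_zero[OF M_M1[OF d(1)]])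
    then have "z = (1 / w t) *\<^sub>R y" by (simp add: d_def)
    then have "y = w t *\<^sub>R z" using False by simp
    then show ?thesis by (simp add: y(4) scaleR_diff_right)
  qed
  with z show ?thesis by blast
qed

text \<open>Arc length, which becomes the time parameter of the one-parameter group.\<close>

definition "\<phi> t = integral {0..t} w"

text \<open>The back-rotated curve \<Theta> is continuous and has zero derivative off the finitely
  many break points, so it is constant.\<close>

lemma curve_eq:
  assumes z: "z \<in> M" "adj z = - z" and g: "\<And>t. t \<in> G \<Longrightarrow> g t = w t *\<^sub>R (z * \<gamma> t - \<gamma> t * z)"
    and t: "t \<in> {0..1}"
  shows "\<gamma> t = exp (\<phi> t *\<^sub>R z) * \<gamma> 0 * exp (\<phi> t *\<^sub>R (- z))"
proof -
  define \<Theta> where "\<Theta> u = exp (\<phi> u *\<^sub>R (- z)) * \<gamma> u * exp (\<phi> u *\<^sub>R (- (- z)))" for u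
  have c\<phi>: "continuous_on {0..1} \<phi>"
    unfolding \<phi>_def by (rule pieces_cont_integral_continuous[OF part cont_w])
  have "\<Theta> t = \<gamma> 0"
  proof (rule has_derivative_zero_unique_strong_interval[OF finite_breaks _ _ _ t])
    show "continuous_on {0..1} \<Theta>"
      unfolding \<Theta>_def by (intro continuous_on_mult continuous_on_exp_scaleR c\<phi> continuous_\<gamma>)
    show "\<Theta> 0 = \<gamma> 0" by (simp add: \<Theta>_def \<phi>_def)
    fix u assume u: "u \<in> G"
    have d\<phi>: "(\<phi> has_vector_derivative w u) (at u within {0..1})"
      unfolding \<phi>_def[abs_def]
      by (rule has_vector_derivative_at_within[OF pieces_cont_integral_derivative_at[OF part cont_w u]])
    have "(\<Theta> has_vector_derivative exp (\<phi> u *\<^sub>R (- z)) * (g u + w u *\<^sub>R ((- z) * \<gamma> u - \<gamma> u * (- z)))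
        * exp (\<phi> u *\<^sub>R (- (- z)))) (at u within {0..1})"
      unfolding \<Theta>_def[abs_def]
      by (rule conj_exp_derivative[OF d\<phi> has_vector_derivative_at_within[OF g_derivative[OF u]]])
    moreover have "g u + w u *\<^sub>R ((- z) * \<gamma> u - \<gamma> u * (- z)) = 0"
      by (simp add: g[OF u] flip: scaleR_add_right)
    ultimately show "(\<Theta> has_derivative (\<lambda>h. 0)) (at u within {0..1})"
      by (simp add: has_vector_derivative_def)
  qed
  then have \<gamma>0: "\<gamma> 0 = exp (\<phi> t *\<^sub>R (- z)) * \<gamma> t * exp (\<phi> t *\<^sub>R z)" by (simp only: \<Theta>_def minus_minus)
  have "exp (\<phi> t *\<^sub>R z) * \<gamma> 0 * exp (\<phi> t *\<^sub>R (- z))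
      = (exp (\<phi> t *\<^sub>R z) * exp (\<phi> t *\<^sub>R (- z))) * \<gamma> t * (exp (\<phi> t *\<^sub>R z) * exp (\<phi> t *\<^sub>R (- z)))"
    unfolding \<gamma>0 by (simp only: mult.assoc)
  then show ?thesis by (simp only: exp_scaleR_inverse mult_1_left mult_1_right)
qed

text \<open>A curve at rest takes the generator 0. Otherwise the normalization of \<open>z\<close>,
  obtained at a time of motion, is carried to time 0, since \<open>z\<close> commutes with the
  exponentials that relate the two points.\<close>

lemma curve_exp:
  "\<exists>z\<in>M. adj z = - z \<and> \<gamma> 0 * z * \<gamma> 0 = 0 \<and>
    (\<forall>t\<in>{0..1}. \<gamma> t = exp (\<phi> t *\<^sub>R z) * \<gamma> 0 * exp (\<phi> t *\<^sub>R (- z)))"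
proof (cases "\<forall>t\<in>G. w t = 0")
  case True
  then have g: "g t = w t *\<^sub>R (0 * \<gamma> t - \<gamma> t * 0)" if "t \<in> G" for t using w_zero[OF that] that by simp
  have e: "\<gamma> t = exp (\<phi> t *\<^sub>R 0) * \<gamma> 0 * exp (\<phi> t *\<^sub>R (- 0))" if "t \<in> {0..1}" for t
    by (rule curve_eq[OF zero_closed _ g that]) simp_all
  show ?thesis
  proof (intro bexI[of _ 0] conjI ballI)
    show "\<gamma> t = exp (\<phi> t *\<^sub>R 0) * \<gamma> 0 * exp (\<phi> t *\<^sub>R (- 0))" if "t \<in> {0..1}" for t by (rule e[OF that])
  qed (simp_all add: zero_closed)
next
  case False
  then obtain t0 where t0: "t0 \<in> G" "w t0 \<noteq> 0" by blast
  obtain z where z: "z \<in> M" "adj z = - z" "\<gamma> t0 * z * \<gamma> t0 = 0"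
    and g: "\<And>t. t \<in> G \<Longrightarrow> g t = w t *\<^sub>R (z * \<gamma> t - \<gamma> t * z)"
    using constant_generator[OF t0] by blast
  have eq: "\<gamma> t = exp (\<phi> t *\<^sub>R z) * \<gamma> 0 * exp (\<phi> t *\<^sub>R (- z))" if "t \<in> {0..1}" for t
    by (rule curve_eq[OF z(1,2) _ that]) (rule g)
  let ?e = "exp (\<phi> t0 *\<^sub>R z)" and ?d = "exp (\<phi> t0 *\<^sub>R (- z))"
  have t01: "t0 \<in> {0..1}" using t0 by blast
  have "?d * \<gamma> t0 * ?e = (?d * ?e) * \<gamma> 0 * (?d * ?e)" by (simp only: eq[OF t01] mult.assoc)
  then have g0: "\<gamma> 0 = ?d * \<gamma> t0 * ?e" by (simp only: exp_scaleR_inverse mult_1_left mult_1_right)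
  have comm: "?e * z = z * ?e" by (rule exp_times_scaleR_commute)
  have "\<gamma> 0 * z * \<gamma> 0 = ?d * \<gamma> t0 * (?e * z) * ?d * \<gamma> t0 * ?e" unfolding g0 by (simp only: mult.assoc)
  also have "\<dots> = ?d * \<gamma> t0 * z * (?e * ?d) * \<gamma> t0 * ?e" by (simp only: comm mult.assoc)
  also have "\<dots> = ?d * (\<gamma> t0 * z * \<gamma> t0) * ?e" by (simp only: exp_scaleR_inverse mult_1_right) (simp only: mult.assoc)
  finally have "\<gamma> 0 * z * \<gamma> 0 = 0" by (simp add: z(3))
  with z eq show ?thesis by blast
qed

lemma \<gamma>0_orbit: "\<gamma> 0 \<in> orbit M p" using orbit[of 0] by simp

lemma reparametrized_geodesic: "geodesic_up_to_reparam \<tau> M p \<gamma>"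
proof -
  obtain z where z: "z \<in> M" "adj z = - z" "\<gamma> 0 * z * \<gamma> 0 = 0"
    and eq: "\<And>t. t \<in> {0..1} \<Longrightarrow> \<gamma> t = exp (\<phi> t *\<^sub>R z) * \<gamma> 0 * exp (\<phi> t *\<^sub>R (- z))"
    using curve_exp by blast
  have mono: "\<phi> a \<le> \<phi> b" if "0 \<le> a" "a \<le> b" "b \<le> 1" for a b
    unfolding \<phi>_def by (rule integral_pieces_mono[OF cont_w w_nonneg that])
  have \<phi>0: "\<phi> 0 = 0" by (simp add: \<phi>_def)
  show ?thesis
  proof (cases "\<phi> 1 = 0")
    case True
    \<comment> \<open>A constant curve has no normalized arc length, yet the change of parameter
      must be onto the unit interval; the identity and a constant geodesic serve.\<close>
    define \<alpha> where "\<alpha> t = exp (t *\<^sub>R 0) * \<gamma> 0 * exp (t *\<^sub>R (- 0 :: 'a bop))" for t :: real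
    have "geodesic \<tau> M p \<alpha>" unfolding \<alpha>_def by (rule geodesic_exp[OF \<gamma>0_orbit zero_closed]) simp_all
    moreover have "\<gamma> t = \<alpha> t" if t: "t \<in> {0..1}" for t
    proof -
      have "\<phi> t = 0" using mono[of 0 t] mono[of t 1] t \<phi>0 True by simp
      then show ?thesis using eq[OF t] by (simp add: \<alpha>_def)
    qed
    ultimately show ?thesis unfolding geodesic_up_to_reparam_def
      by (intro exI[of _ \<alpha>] exI[of _ "\<lambda>t. t"]) (simp add: mono_on_def)
  next
    case False
    then have L: "0 < \<phi> 1" using mono[of 0 1] \<phi>0 by simp
    define y where "y = \<phi> 1 *\<^sub>R z"
    define \<psi> where "\<psi> t = \<phi> t / \<phi> 1" for t
    define \<alpha> where "\<alpha> t = exp (t *\<^sub>R y) * \<gamma> 0 * exp (t *\<^sub>R (- y))" for t :: real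
    have "geodesic \<tau> M p \<alpha>"
      unfolding \<alpha>_def by (rule geodesic_exp[OF \<gamma>0_orbit]) (simp_all add: y_def z scaleR_closed)
    moreover have m\<psi>: "mono_on {0..1} \<psi>"
      using mono L by (auto simp: mono_on_def \<psi>_def intro: divide_right_mono)
    moreover have "\<psi> ` {0..1} = {0..1}"
    proof (intro set_eqI iffI)
      fix r assume "r \<in> \<psi> ` {0..1}"
      then obtain t where t: "t \<in> {0..1}" "r = \<psi> t" by blast
      then show "r \<in> {0..1}" using mono[of 0 t] mono[of t 1] \<phi>0 L by (simp add: \<psi>_def)
    next
      fix r :: real assume r: "r \<in> {0..1}"
      have "continuous_on {0..1} \<phi>"
        unfolding \<phi>_def by (rule pieces_cont_integral_continuous[OF part cont_w])
      then have "continuous_on {0..1} \<psi>"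
        unfolding \<psi>_def using L by (intro continuous_on_divide continuous_on_const) auto
      moreover have "\<psi> 0 \<le> r" "r \<le> \<psi> 1" using r L by (simp_all add: \<psi>_def \<phi>0)
      ultimately obtain t where "0 \<le> t" "t \<le> 1" "\<psi> t = r" using IVT'[of \<psi> 0 r 1] by auto
      then show "r \<in> \<psi> ` {0..1}" by auto
    qed
    moreover have "\<gamma> t = \<alpha> (\<psi> t)" if "t \<in> {0..1}" for t
      using eq[OF that] L by (simp add: \<psi>_def y_def \<alpha>_def)
    ultimately show ?thesis unfolding geodesic_up_to_reparam_def
      by (intro exI[of _ \<alpha>] exI[of _ \<psi>]) simp
  qed
qed

lemma constant_speed_geodesic:
  assumes "constant_speed \<tau> \<gamma>" shows "geodesic \<tau> M p \<gamma>"
proof -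
  obtain z where z: "z \<in> M" "adj z = - z" "\<gamma> 0 * z * \<gamma> 0 = 0"
    and eq: "\<And>t. t \<in> {0..1} \<Longrightarrow> \<gamma> t = exp (\<phi> t *\<^sub>R z) * \<gamma> 0 * exp (\<phi> t *\<^sub>R (- z))"
    using curve_exp by blast
  obtain c F where F: "finite F" "\<And>t. t \<in> {0..1} - F \<Longrightarrow> norm2 \<tau> (g t) = c"
    using assms unfolding constant_speed_def by blast
  \<comment> \<open>Constant speed off a finite set makes arc length linear, so the curve itself is
    the geodesic generated by \<open>c *\<^sub>R z\<close>.\<close>
  have \<phi>: "\<phi> t = t * c" if t: "t \<in> {0..1}" for t
  proof -
    have "\<phi> t = integral {0..t} (\<lambda>u. c)" unfolding \<phi>_def
    proof (rule integral_spike[OF negligible_finite[of "F \<union> s ` {..m}"]])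
      show "c = w u" if "u \<in> {0..t} - (F \<union> s ` {..m})" for u
        using F(2)[of u] w_norm2[of u] that t by auto
    qed (simp add: F(1))
    then show ?thesis using t by simp
  qed
  have "geodesic \<tau> M p (\<lambda>t. exp (t *\<^sub>R (c *\<^sub>R z)) * \<gamma> 0 * exp (t *\<^sub>R (- (c *\<^sub>R z))))"
    by (rule geodesic_exp[OF \<gamma>0_orbit]) (simp_all add: z scaleR_closed)
  then show ?thesis
  proof (rule geodesic_cong)
    fix t :: real assume t: "t \<in> {0..1}"
    show "exp (t *\<^sub>R (c *\<^sub>R z)) * \<gamma> 0 * exp (t *\<^sub>R (- (c *\<^sub>R z))) = \<gamma> t"
      by (simp only: eq[OF t] \<phi>[OF t] scaleR_scaleR scaleR_minus_right)
  qed
qed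

end

theorem theorem5p2:
  fixes N M :: "'h::complex_hilbert bop set" and \<Omega> :: 'h
    and p :: "'h bop" and \<tau> :: "'h bop \<Rightarrow> complex" and \<gamma> :: "real \<Rightarrow> 'h bop"
  assumes "II1_factor N" and "II1_factor M" and "N \<subseteq> M"
    and "standard_rep M \<Omega>"
    and "jones_index N < \<infinity>"
    and "p = jones_projection N \<Omega>"
    and "\<tau> = trace_of (basic_construction M p)"
    and "short_curve \<tau> (orbit M p) \<gamma>"
  shows "geodesic_up_to_reparam \<tau> M p \<gamma> \<and>
    (constant_speed \<tau> \<gamma> \<longrightarrow> geodesic \<tau> M p \<gamma>)"
proof -
  \<comment> \<open>A coupling constant below infinity selects the first branch of its definition,
    that is, a trace on \<open>commutant N\<close>.\<close>
  obtain t where t: "normalized_trace (commutant N) t"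
    using assms(5) unfolding jones_index_def coupling_constant_def by (auto split: if_splits)
  interpret S: subfactor M \<Omega> N t
    using assms(1-4) t
    by unfold_locales (simp_all add: II1_factor_def factor_def)
  have p: "S.p = p" by (simp add: S.p_def assms(6))
  have \<tau>: "S.\<tau> = \<tau>" by (simp add: S.\<tau>_def S.M1_def p assms(7))
  have short: "piecewise_smooth \<gamma>" "\<gamma> ` {0..1} \<subseteq> orbit M p"
    and min: "\<And>\<beta>. piecewise_smooth_in (orbit M p) \<beta> \<Longrightarrow> \<beta> 0 = \<gamma> 0 \<Longrightarrow> \<beta> 1 = \<gamma> 1 \<Longrightarrow> length2 \<tau> \<gamma> \<le> length2 \<tau> \<beta>"
    using assms(8) unfolding short_curve_def piecewise_smooth_in_def by blast+
  obtain m s where ms: "s 0 = 0" "s m = 1" "\<And>i. i < m \<Longrightarrow> s i < s (Suc i) \<and> smooth_on (s i) (s (Suc i)) \<gamma>"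
    using short(1) unfolding piecewise_smooth_def by blast
  interpret C: short_in_orbit M \<Omega> N t \<gamma> m s
  proof unfold_locales
    show "partition01 m s" using ms by (simp add: partition01_def)
    show "smooth_on (s i) (s (Suc i)) \<gamma>" if "i < m" for i using ms(3)[OF that] by blast
    show "\<gamma> t \<in> orbit M S.p" if "t \<in> {0..1}" for t using short(2) that by (auto simp: p)
    show "length2 S.\<tau> \<gamma> \<le> length2 S.\<tau> \<beta>"
      if "piecewise_smooth_in (orbit M S.p) \<beta>" "\<beta> 0 = \<gamma> 0" "\<beta> 1 = \<gamma> 1" for \<beta>
      unfolding \<tau> by (rule min[OF that(1)[unfolded p] that(2,3)])
  qed
  show ?thesis
    using C.reparametrized_geodesic C.constant_speed_geodesic by (simp add: p \<tau>)
qed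

end
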